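(* Let $(q_n)_{n\ge 0}$ be a $[0,1]$-valued sequence such that $n(1-q_n)/\log n\to\infty$ and $nq_n\to\infty$. Then $$\frac{h(T_{n,q_n})-n(1-q_n)-c^*\log\big((1-q_n)^{-1}\big)}{\sqrt{n(1-q_n)q_n}}$$ converges in distribution, as $n\to\infty$, to a standard normal random variable.
   Context: Let $T_\infty=\bigcup_{k\ge 0}\{\overline 0,\overline 1\}^k$ be the complete infinite rooted binary tree: nodes are finite strings over $\{\overline 0,\overline 1\}$, the root is the empty string $\varnothing$, the node $u$ has left child $u\overline 0$ and right child $u\overline 1$, and $|u|$ (the depth of $u$) is the length of $u$. For a set $V\subset T_\infty$ write $uV=\{uv:v\in V\}$. A tree is a connected subset of $T_\infty$; its height is $h(T)=\sup_{u\in T}|u|-\inf_{u\in T}|u|$. For a finite sequence $f=(f(1),\dots,f(n))$ of distinct positive integers, the binary search tree $T\langle f\rangle\subset T_\infty$ is defined inductively: $T\langle f\rangle=\emptyset$ if $n=0$; otherwise $T\langle f\rangle=\{\varnothing\}\cup \overline 0\,T\langle f^-\rangle\cup\overline 1\,T\langle f^+\rangle$, where $f^-$ (resp. $f^+$) is the subsequence of terms $f(i)<f(1)$ (resp. $f(i)>f(1)$), in the same order as in $f$. For $n\ge 0$ and $q\in[0,1]$, the Mallows distribution $\pi_{n,q}$ on the symmetric group $\mathcal S_n$ gives each $\sigma$ probability proportional to $q^{\mathrm{Inv}(\sigma)}$, where $\mathrm{Inv}(\sigma)=|\{i<j:\sigma(i)>\sigma(j)\}|$ (with $0^0=1$, so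 that $\pi_{n,0}$ is concentrated on the identity). $T_{n,q}$ denotes a random tree distributed as $T\langle\sigma\rangle$ with $\sigma\sim\pi_{n,q}$. $c^*=4.311\ldots$ is the unique solution of $c\log(2e/c)=1$ with $c\ge 2$. *)

theory Defs
  imports "HOL-Probability.Probability" "HOL-Combinatorics.Permutations"
begin

text \<open>
  Nodes of the complete infinite binary tree are finite strings over
  \<open>{False, True}\<close>, where \<open>False\<close> stands for \<open>0\<close> (left) and \<open>True\<close> for \<open>1\<close> (right).
  The root is \<open>[]\<close>, and the first letter of a string is the first step away from the root.
\<close>

type_synonym node = "bool list"

function bst :: "nat list \<Rightarrow> node set" where
  "bst [] = {}"
| "bst (x # xs) =
     {[]} \<union> (#) False ` bst (filter (\<lambda>y. y < x) (x # xs))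
          \<union> (#) True ` bst (filter (\<lambda>y. y > x) (x # xs))"
  by pat_completeness auto
termination
  by (relation "Wellfounded.measure length") (auto simp: le_imp_less_Suc)

text \<open>
  Only meaningful for finite trees. On a nonempty finite set the subtraction does not truncate;
  the empty tree is given height \<open>0\<close>.
\<close>

definition height :: "node set \<Rightarrow> nat" where
  "height T = (SUP u\<in>T. length u) - (INF u\<in>T. length u)"

definition inv_count :: "nat \<Rightarrow> (nat \<Rightarrow> nat) \<Rightarrow> nat" where
  "inv_count n \<sigma> = card {(i, j). i \<in> {1..n} \<and> j \<in> {1..n} \<and> i < j \<and> \<sigma> i > \<sigma> j}"

definition mallows_const :: "nat \<Rightarrow> real \<Rightarrow> real" where
  "mallows_const n q = (\<Sum>\<sigma> | \<sigma> permutes {1..n}. q ^ inv_count n \<sigma>)"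

definition mallows_pmf :: "nat \<Rightarrow> real \<Rightarrow> (nat \<Rightarrow> nat) pmf" where
  "mallows_pmf n q =
     embed_pmf (\<lambda>\<sigma>. if \<sigma> permutes {1..n} then q ^ inv_count n \<sigma> / mallows_const n q else 0)"

lemma inv_count_id: "inv_count n id = 0"
proof -
  have "{(i, j). i \<in> {1..n} \<and> j \<in> {1..n} \<and> i < j \<and> id i > id j} = {}" by auto
  then show ?thesis unfolding inv_count_def by (simp only: card.empty)
qed

lemma mallows_const_pos:
  assumes "0 \<le> q"
  shows "mallows_const n q > 0"
proof -
  have "finite {\<sigma>. \<sigma> permutes {1..n}}" by (simp add: finite_permutations)
  moreover have "id \<in> {\<sigma>. \<sigma> permutes {1..n}}" by (simp add: permutes_id)
  moreover have "0 < q ^ inv_count n id" by (simp add: inv_count_id)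
  ultimately show ?thesis
    unfolding mallows_const_def using assms
    by (intro sum_pos2[where i = id]) auto
qed

text \<open>\<open>embed_pmf\<close> only has the intended meaning for a genuine probability mass function.\<close>

lemma pmf_mallows_pmf:
  assumes "0 \<le> q"
  shows "pmf (mallows_pmf n q) \<sigma> =
           (if \<sigma> permutes {1..n} then q ^ inv_count n \<sigma> / mallows_const n q else 0)"
  unfolding mallows_pmf_def
proof (rule pmf_embed_pmf)
  let ?w = "\<lambda>\<sigma>. q ^ inv_count n \<sigma> / mallows_const n q"
  let ?P = "{\<sigma>. \<sigma> permutes {1..n}}"
  note pos = mallows_const_pos[OF assms, of n]
  have fin: "finite ?P" by (simp add: finite_permutations)
  show "0 \<le> (if \<sigma> permutes {1..n} then ?w \<sigma> else 0)" for \<sigma>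
    using assms pos by simp
  have "(\<integral>\<^sup>+\<sigma>. ennreal (if \<sigma> permutes {1..n} then ?w \<sigma> else 0) \<partial>count_space UNIV)
      = (\<Sum>\<sigma>\<in>?P. ennreal (if \<sigma> permutes {1..n} then ?w \<sigma> else 0))"
    by (rule nn_integral_count_space') (use fin in auto)
  also have "\<dots> = (\<Sum>\<sigma>\<in>?P. ennreal (?w \<sigma>))" by (intro sum.cong) auto
  also have "\<dots> = ennreal (\<Sum>\<sigma>\<in>?P. ?w \<sigma>)"
    using assms pos by (intro sum_ennreal) simp
  also have "(\<Sum>\<sigma>\<in>?P. ?w \<sigma>) = 1"
    using pos by (simp add: sum_divide_distrib[symmetric] mallows_const_def)
  finally show "(\<integral>\<^sup>+\<sigma>. ennreal (if \<sigma> permutes {1..n} then ?w \<sigma> else 0) \<partial>count_space UNIV) = 1"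
    by simp
qed

definition mallows_tree_pmf :: "nat \<Rightarrow> real \<Rightarrow> node set pmf" where
  "mallows_tree_pmf n q = map_pmf (\<lambda>\<sigma>. bst (map \<sigma> [1..<Suc n])) (mallows_pmf n q)"

definition c_star :: real where
  "c_star = (THE c. c \<ge> 2 \<and> c * ln (2 * exp 1 / c) = 1)"

lemma c_star_ex1: "\<exists>!c::real. c \<ge> 2 \<and> c * ln (2 * exp 1 / c) = 1"
proof -
  define f where "f = (\<lambda>c::real. c * ln (2 * exp 1 / c))"
  have f_eq: "f c = c * (ln 2 + 1 - ln c)" if "c > 0" for c
    using that by (simp add: f_def ln_div ln_mult)
  have less: "f b < f a" if "2 \<le> a" "a < b" for a b
  proof -
    have "\<exists>z. a < z \<and> z < b \<and>
        b * (ln 2 + 1 - ln b) - a * (ln 2 + 1 - ln a) = (b - a) * (ln 2 - ln z)"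
      by (rule MVT2[OF that(2)]) (use that in \<open>auto intro!: derivative_eq_intros\<close>)
    then obtain z where z: "a < z"
      "b * (ln 2 + 1 - ln b) - a * (ln 2 + 1 - ln a) = (b - a) * (ln 2 - ln z)"
      by blast
    have "f a = a * (ln 2 + 1 - ln a)" "f b = b * (ln 2 + 1 - ln b)"
      using that by (auto intro!: f_eq)
    with z(2) have "f b - f a = (b - a) * (ln 2 - ln z)" by simp
    moreover have "(b - a) * (ln 2 - ln z) < 0"
      using z(1) that by (intro mult_pos_neg) simp_all
    ultimately show ?thesis by simp
  qed
  have "\<exists>c\<ge>2. c \<le> 2 * exp 1 \<and> f c = 1"
  proof (rule IVT2')
    show "f (2 * exp 1) \<le> 1" by (simp add: f_def)
    show "1 \<le> f 2" by (simp add: f_def)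
    show "(2::real) \<le> 2 * exp 1" by simp
    show "continuous_on {2..2 * exp 1} f"
      unfolding f_def by (intro continuous_intros) auto
  qed
  then obtain c where c: "c \<ge> 2" "f c = 1" by auto
  show ?thesis
    unfolding f_def[symmetric]
  proof (rule ex1I[of _ c])
    show "c \<ge> 2 \<and> c * ln (2 * exp 1 / c) = 1" using c by (simp add: f_def)
    fix d :: real assume "d \<ge> 2 \<and> d * ln (2 * exp 1 / d) = 1"
    then have "d \<ge> 2" "f d = 1" by (auto simp: f_def)
    then show "d = c" using c less[of c d] less[of d c] by (cases c d rule: linorder_cases) auto
  qed
qed

end

theory Submission
  imports Defs "HOL-Combinatorics.Multiset_Permutations" "HOL-Real_Asymp.Real_Asymp"
begin

text \<open>
  Why the theorem holds. Let \<open>m = 1 / (1 - q)\<close>. The root of a Mallows tree with \<open>n\<close> nodes has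
  a left subtree of truncated geometric size, \<open>P(size = i) = q ^ i / [n]\<close> with
  \<open>[n] = 1 + q + ... + q ^ (n - 1)\<close>, and given the sizes the two subtrees are independent Mallows
  trees with the same \<open>q\<close>; this is the shuffle identity \<open>perm_sum_shuffle\<close>. It yields a recursion for
  \<open>level_cdf\<close>, the distribution function of the number of levels, and the theorem is a statement about
  its solution.

  Walking down the right spine, one leaves behind about \<open>m\<close> nodes per step. The number \<open>T\<close> of steps
  until at most \<open>M\<close> nodes remain is exactly a sum of independent Bernoulli variables with parameters
  \<open>1 / [i]\<close> (\<open>spine_exp_step\<close>), so for \<open>M\<close> of order \<open>m\<close>, or not much smaller, it is asymptotically normal
  with mean \<open>n (1 - q)\<close> and variance \<open>n (1 - q) q\<close>, up to small errors (\<open>spine_clt\<close>). Trees much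
  smaller than \<open>m\<close> split almost uniformly, like random binary search trees, and a tree with about \<open>m\<close>
  nodes has height about \<open>c* ln m\<close>. So the height should be \<open>T + c* ln m\<close>, and it remains to control the error on the scale
  \<open>sqrt (n (1 - q) q)\<close>. Under the hypotheses this scale dominates \<open>sqrt (ln m) + 1\<close>
  (\<open>ln_gap_over_scale\<close>), but it need not dominate \<open>ln m\<close>, so the constant \<open>c*\<close> really matters and
  error terms up to \<open>O (sqrt (ln m) + 1)\<close> are affordable.

  Upper bound (\<open>level_tail_upper\<close>). The expected number of nodes on a given level has an explicit
  supersolution, which shows that a tree of size \<open>O(m)\<close> exceeds \<open>c* ln m + K\<close> levels with a
  probability exponentially small in \<open>K\<close>. A left subtree that branches off \<open>r\<close> steps before the end
  of the spine has to exceed this by a further \<open>r\<close> levels in order to matter, so the failure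
  probabilities are summable along the spine.

  Lower bound (\<open>level_tail_lower\<close>). For uniform splitting the linearised recursion has the exact
  solutions \<open>level_weight t\<close>, one for each exponent \<open>t\<close>. The positive part of a combination of three
  of them with exponents close to the critical one, \<open>c* - 1\<close>, is a bounded subsolution of the linear
  recursion, and multiplied by a small constant it becomes a subsolution of the nonlinear one. This
  plays the role of a second moment argument for paths confined to a window, and shows that
  \<open>c* ln m - O (sqrt (ln m))\<close> levels are reached with probability at least
  \<open>exp (- O (sqrt (ln m)))\<close>. A further \<open>O (sqrt (ln m))\<close> levels at the top provide enough independent
  attempts to turn this into probability close to one (\<open>level_cdf_amplify\<close>).
\<close>

section \<open>Mallows trees and the recursion for their height\<close>

primrec inversions :: "nat list \<Rightarrow> nat" where
  "inversions [] = 0"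
| "inversions (x # xs) = length (filter (\<lambda>y. y < x) xs) + inversions xs"

text \<open>
  One more than the height for a nonempty tree and 0 for the empty one, which makes the recursion
  uniform.
\<close>

function levels :: "nat list \<Rightarrow> nat" where
  "levels [] = 0"
| "levels (x # xs) =
     Suc (max (levels (filter (\<lambda>y. y < x) xs)) (levels (filter (\<lambda>y. y > x) xs)))"
  by pat_completeness auto
termination
  by (relation "Wellfounded.measure length") (auto simp: le_imp_less_Suc)

lemma bst_Cons:
  "bst (x # xs) = {[]} \<union> (#) False ` bst (filter (\<lambda>y. y < x) xs)
     \<union> (#) True ` bst (filter (\<lambda>y. y > x) xs)"
  by simp

declare bst.simps(2) [simp del]

lemma finite_bst: "finite (bst xs)"
  by (induction xs rule: levels.induct) (auto simp: bst_Cons)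

lemma bst_depth_less_iff: "(\<forall>u\<in>bst xs. length u < k) \<longleftrightarrow> levels xs \<le> k"
proof (induction xs arbitrary: k rule: levels.induct)
  case (2 x xs)
  show ?case
  proof (cases k)
    case (Suc j)
    then show ?thesis using "2.IH"(1)[of j] "2.IH"(2)[of j] by (auto simp: bst_Cons ball_Un)
  qed (auto simp: bst_Cons)
qed simp

text \<open>
  The root has depth 0, so the infimum in the definition of the height vanishes and the height is the
  depth of the deepest node.
\<close>

lemma height_bst_le_iff: "height (bst xs) \<le> k \<longleftrightarrow> levels xs \<le> Suc k"
proof (cases xs)
  case Nil
  then show ?thesis by (simp add: height_def)
next
  case (Cons x ys)
  let ?D = "length ` bst xs"
  have fin: "finite ?D" using finite_bst by simp
  have root: "0 \<in> ?D" using Cons by (force simp: bst_Cons)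
  have "Inf ?D = 0" using root by (metis bot.extremum_uniqueI bot_nat_def cInf_lower fin bdd_below_bot)
  moreover have "Sup ?D = Max ?D" using root by (auto simp: Sup_nat_def)
  ultimately have "height (bst xs) = Max ?D" by (simp add: height_def)
  then have "height (bst xs) \<le> k \<longleftrightarrow> (\<forall>u\<in>bst xs. length u < Suc k)"
    using fin root by (subst \<open>height (bst xs) = Max ?D\<close>, subst Max_le_iff) auto
  then show ?thesis by (simp add: bst_depth_less_iff)
qed

text \<open>
  The q-analogue \<open>[n]\<close> of \<open>n\<close>, the normalising constant of the truncated geometric law
  of the size of the left subtree.
\<close>

definition q_number :: "real \<Rightarrow> nat \<Rightarrow> real" where
  "q_number q n = (\<Sum>i<n. q ^ i)"

lemma q_number_0 [simp]: "q_number q 0 = 0" by (simp add: q_number_def)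

lemma q_number_Suc: "q_number q (Suc n) = q_number q n + q ^ n"
  by (simp add: q_number_def)

lemma q_number_Suc': "q_number q (Suc n) = 1 + q * q_number q n"
  unfolding q_number_def by (subst sum.lessThan_Suc_shift) (simp add: sum_distrib_left)

lemma q_number_ge_1: "0 \<le> q \<Longrightarrow> 0 < n \<Longrightarrow> 1 \<le> q_number q n"
  using sum_nonneg[of "{..<n - 1}" "\<lambda>i. q ^ i"]
  by (cases n) (auto simp: q_number_Suc' q_number_def[symmetric] simp del: sum_nonneg)

lemma q_number_pos: "0 \<le> q \<Longrightarrow> 0 < n \<Longrightarrow> 0 < q_number q n"
  using q_number_ge_1 by (metis less_le_trans zero_less_one)

text \<open>
  The probability that a Mallows tree with \<open>n\<close> nodes has at most \<open>k\<close> levels. The recursion is a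
  decomposition at the root: the left subtree has \<open>i\<close> nodes with probability \<open>q ^ i / [n]\<close>, and both
  subtrees must fit into \<open>k\<close> levels. That this is the law in question is \<open>mallows_height_le\<close>.
\<close>

primrec level_cdf :: "real \<Rightarrow> nat \<Rightarrow> nat \<Rightarrow> real" where
  "level_cdf q 0 n = (if n = 0 then 1 else 0)"
| "level_cdf q (Suc k) n = (if n = 0 then 1
     else (\<Sum>i<n. q ^ i * level_cdf q k i * level_cdf q k (n - 1 - i)) / q_number q n)"

primrec q_factorial :: "real \<Rightarrow> nat \<Rightarrow> real" where
  "q_factorial q 0 = 1"
| "q_factorial q (Suc n) = q_number q (Suc n) * q_factorial q n"

lemma q_factorial_pos: "0 \<le> q \<Longrightarrow> 0 < q_factorial q n"
  by (induction n) (auto intro!: mult_pos_pos q_number_pos)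

text \<open>
  The Gaussian binomial coefficient: it weighs the interleavings of a block of \<open>a\<close> small and a block
  of \<open>b\<close> large elements by their inversions. The last equation asks which block provides the first
  element; a large one is inverted with all the small ones.
\<close>

fun q_binomial :: "real \<Rightarrow> nat \<Rightarrow> nat \<Rightarrow> real" where
  "q_binomial q 0 b = 1"
| "q_binomial q a 0 = 1"
| "q_binomial q (Suc a) (Suc b) = q_binomial q a (Suc b) + q ^ Suc a * q_binomial q (Suc a) b"

lemma q_binomial_0_right [simp]: "q_binomial q a 0 = 1"
  by (cases a) auto

text \<open>
  The unnormalised Mallows expectation over the orderings of a finite set.
\<close>

definition perm_sum :: "real \<Rightarrow> nat set \<Rightarrow> (nat list \<Rightarrow> real) \<Rightarrow> real" where
  "perm_sum q A f = (\<Sum>xs\<in>permutations_of_set A. q ^ inversions xs * f xs)"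

lemma perm_sum_empty [simp]: "perm_sum q {} f = f []"
  by (simp add: perm_sum_def)

text \<open>
  The first entry of a word is inverted with exactly the smaller ones.
\<close>

lemma perm_sum_Cons:
  assumes "finite A" "A \<noteq> {}"
  shows "perm_sum q A f =
    (\<Sum>x\<in>A. q ^ card {y \<in> A. y < x} * perm_sum q (A - {x}) (\<lambda>xs. f (x # xs)))"
proof -
  have inv: "inversions (x # xs) = card {y \<in> A. y < x} + inversions xs"
    if "x \<in> A" "xs \<in> permutations_of_set (A - {x})" for x xs
  proof -
    have "distinct xs" "set xs = A - {x}" using that by (auto simp: permutations_of_set_def)
    then have "length (filter (\<lambda>y. y < x) xs) = card {y \<in> A - {x}. y < x}"
      by (metis distinct_card distinct_filter set_filter)
    also have "{y \<in> A - {x}. y < x} = {y \<in> A. y < x}" by auto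
    finally show ?thesis by simp
  qed
  have "perm_sum q A f = (\<Sum>x\<in>A. \<Sum>xs\<in>(#) x ` permutations_of_set (A - {x}). q ^ inversions xs * f xs)"
    unfolding perm_sum_def permutations_of_set_nonempty[OF assms(2)]
    by (rule sum.UNION_disjoint) (use assms in auto)
  also have "\<dots> = (\<Sum>x\<in>A. q ^ card {y \<in> A. y < x} * perm_sum q (A - {x}) (\<lambda>xs. f (x # xs)))"
  proof (intro sum.cong refl)
    fix x assume x: "x \<in> A"
    have "(\<Sum>xs\<in>(#) x ` permutations_of_set (A - {x}). q ^ inversions xs * f xs) =
        (\<Sum>xs\<in>permutations_of_set (A - {x}). q ^ inversions (x # xs) * f (x # xs))"
      by (subst sum.reindex) (simp_all add: inj_on_def)
    also have "\<dots> = q ^ card {y \<in> A. y < x} * perm_sum q (A - {x}) (\<lambda>xs. f (x # xs))"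
      unfolding perm_sum_def sum_distrib_left
      by (intro sum.cong refl, subst inv[OF x]) (simp_all add: power_add mult.assoc)
    finally show "(\<Sum>xs\<in>(#) x ` permutations_of_set (A - {x}). q ^ inversions xs * f xs) = \<dots>" .
  qed
  finally show ?thesis .
qed

text \<open>
  The ranks of the elements of \<open>A\<close> are \<open>0, ..., card A - 1\<close>, each taken once.
\<close>

lemma sum_over_ranks:
  fixes A :: "nat set" and g :: "nat \<Rightarrow> real"
  assumes "finite A"
  shows "(\<Sum>x\<in>A. g (card {y \<in> A. y < x})) = (\<Sum>i<card A. g i)"
  using assms
proof (induction rule: finite_linorder_max_induct)
  case (insert b A)
  have "{y \<in> insert b A. y < b} = A" using insert by auto
  moreover have "{y \<in> insert b A. y < x} = {y \<in> A. y < x}" if "x \<in> A" for x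
    using insert that by auto
  moreover have "b \<notin> A" using insert by auto
  ultimately show ?case using insert by simp
qed simp

lemma perm_sum_1: "finite A \<Longrightarrow> perm_sum q A (\<lambda>_. 1) = q_factorial q (card A)"
proof (induction "card A" arbitrary: A)
  case (Suc n)
  have "A \<noteq> {}" using Suc by auto
  have "perm_sum q A (\<lambda>_. 1) = (\<Sum>x\<in>A. q ^ card {y \<in> A. y < x} * q_factorial q n)"
    unfolding perm_sum_Cons[OF Suc.prems \<open>A \<noteq> {}\<close>]
    by (intro sum.cong refl arg_cong2[where f = "(*)"])
       (use Suc in \<open>metis card_Diff_singleton diff_Suc_1 finite_Diff\<close>)
  also have "\<dots> = q_number q (Suc n) * q_factorial q n"
    using sum_over_ranks[OF Suc.prems, of "\<lambda>i. q ^ i"] Suc(2)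
    by (simp add: q_number_def flip: sum_distrib_right)
  finally show ?case using Suc(2) by (metis q_factorial.simps(2))
qed simp

text \<open>
  This is the independence of the two subtrees of the root. A word over \<open>A \<union> B\<close> is a word over \<open>A\<close>,
  a word over \<open>B\<close> and an interleaving; its inversions are those of the three parts, and the cross
  inversions depend on the interleaving only. The proof removes the first letter of the word, which
  turns the claim into the recursion of the Gaussian binomial coefficients.
\<close>

lemma perm_sum_shuffle:
  assumes "finite A" "finite B" "\<And>y. y \<in> A \<Longrightarrow> y < x" "\<And>y. y \<in> B \<Longrightarrow> x < y"
  shows "perm_sum q (A \<union> B) (\<lambda>xs. f (filter (\<lambda>y. y < x) xs) * g (filter (\<lambda>y. y > x) xs))
       = q_binomial q (card A) (card B) * perm_sum q A f * perm_sum q B g"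
  using assms
proof (induction "card A + card B" arbitrary: A B f g)
  case 0
  then show ?case by simp
next
  case (Suc N)
  let ?h = "\<lambda>f g xs. f (filter (\<lambda>y. y < x) xs) * g (filter (\<lambda>y. y > x) xs) :: real"
  note fin = Suc.prems(1,2)
  have disj: "A \<inter> B = {}" using Suc.prems(3,4) by fastforce
  have rankA: "{y \<in> A \<union> B. y < z} = {y \<in> A. y < z}" if "z \<in> A" for z
    using that Suc.prems(3,4) by fastforce
  have rankB: "card {y \<in> A \<union> B. y < z} = card A + card {y \<in> B. y < z}" if "z \<in> B" for z
  proof -
    have "{y \<in> A \<union> B. y < z} = A \<union> {y \<in> B. y < z}"
      using that Suc.prems(3,4) by fastforce
    then show ?thesis using fin disj by (auto intro!: card_Un_disjoint)
  qed
  have stepA: "perm_sum q (A \<union> B - {z}) (\<lambda>xs. ?h f g (z # xs)) =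
      q_binomial q (card A - 1) (card B) * perm_sum q (A - {z}) (\<lambda>xs. f (z # xs)) * perm_sum q B g"
    if "z \<in> A" for z
  proof -
    have "z < x" using that Suc.prems by auto
    then have "\<not> x < z" by simp
    have eq: "A \<union> B - {z} = (A - {z}) \<union> B" using that disj by auto
    have "0 < card A" using that fin by (auto simp: card_gt_0_iff)
    then have "N = card (A - {z}) + card B" using Suc(2) that fin by simp
    from Suc(1)[OF this, of "\<lambda>xs. f (z # xs)" g] show ?thesis
      using Suc.prems \<open>z < x\<close> \<open>\<not> x < z\<close> that by (simp add: eq)
  qed
  have stepB: "perm_sum q (A \<union> B - {z}) (\<lambda>xs. ?h f g (z # xs)) =
      q_binomial q (card A) (card B - 1) * perm_sum q A f * perm_sum q (B - {z}) (\<lambda>xs. g (z # xs))"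
    if "z \<in> B" for z
  proof -
    have "x < z" using that Suc.prems by auto
    then have "\<not> z < x" by simp
    have eq: "A \<union> B - {z} = A \<union> (B - {z})" using that disj by auto
    have "0 < card B" using that fin by (auto simp: card_gt_0_iff)
    then have "N = card A + card (B - {z})" using Suc(2) that fin by simp
    from Suc(1)[OF this, of f "\<lambda>xs. g (z # xs)"] show ?thesis
      using Suc.prems \<open>x < z\<close> \<open>\<not> z < x\<close> that by (simp add: eq)
  qed
  have ne: "A \<union> B \<noteq> {}" using Suc(2) by auto
  have termA: "q ^ card {y \<in> A \<union> B. y < z} * perm_sum q (A \<union> B - {z}) (\<lambda>xs. ?h f g (z # xs)) =
      q_binomial q (card A - 1) (card B) * perm_sum q B g *
        (q ^ card {y \<in> A. y < z} * perm_sum q (A - {z}) (\<lambda>xs. f (z # xs)))" if "z \<in> A" for z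
    unfolding rankA[OF that] stepA[OF that] by (simp only: mult_ac)
  have termB: "q ^ card {y \<in> A \<union> B. y < z} * perm_sum q (A \<union> B - {z}) (\<lambda>xs. ?h f g (z # xs)) =
      q ^ card A * q_binomial q (card A) (card B - 1) * perm_sum q A f *
        (q ^ card {y \<in> B. y < z} * perm_sum q (B - {z}) (\<lambda>xs. g (z # xs)))" if "z \<in> B" for z
    unfolding rankB[OF that] stepB[OF that] by (simp only: mult_ac power_add)
  have *: "perm_sum q (A \<union> B) (?h f g) =
     q_binomial q (card A - 1) (card B) * perm_sum q B g *
        (\<Sum>z\<in>A. q ^ card {y \<in> A. y < z} * perm_sum q (A - {z}) (\<lambda>xs. f (z # xs)))
     + q ^ card A * q_binomial q (card A) (card B - 1) * perm_sum q A f *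
        (\<Sum>z\<in>B. q ^ card {y \<in> B. y < z} * perm_sum q (B - {z}) (\<lambda>xs. g (z # xs)))"
    unfolding perm_sum_Cons[OF finite_UnI[OF fin] ne] sum.union_disjoint[OF fin disj]
    unfolding sum_distrib_left
    by (intro arg_cong2[where f = "(+)"] sum.cong refl) (rule termA termB, assumption)+
  show ?case
  proof (cases "A = {} \<or> B = {}")
    case True
    then show ?thesis
    proof
      assume "A = {}"
      then show ?thesis using * fin ne by (simp add: perm_sum_Cons[of B])
    next
      assume "B = {}"
      then show ?thesis using * fin ne by (cases "card A") (simp_all add: perm_sum_Cons[of A])
    qed
  next
    case False
    then obtain a b where ab: "card A = Suc a" "card B = Suc b"
      using fin by (metis card_gt_0_iff gr0_implies_Suc)
    show ?thesis
      unfolding * using False ab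
      by (simp add: perm_sum_Cons[of A q f, symmetric] perm_sum_Cons[of B q g, symmetric] fin)
         (simp add: algebra_simps)
  qed
qed

text \<open>
  The shuffle identity with constant functions.
\<close>

lemma q_binomial_factorial:
  "q_binomial q a b * q_factorial q a * q_factorial q b = q_factorial q (a + b)"
proof -
  have "perm_sum q ({..<a} \<union> {Suc a..<Suc a + b})
      (\<lambda>xs. (\<lambda>_. 1) (filter (\<lambda>y. y < a) xs) * (\<lambda>_. 1) (filter (\<lambda>y. y > a) xs)) =
      q_binomial q (card {..<a}) (card {Suc a..<Suc a + b}) *
        perm_sum q {..<a} (\<lambda>_. 1) * perm_sum q {Suc a..<Suc a + b} (\<lambda>_. 1)"
    by (rule perm_sum_shuffle) auto
  moreover have "card ({..<a} \<union> {Suc a..<Suc a + b}) = a + b"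
    by (subst card_Un_disjoint) auto
  ultimately show ?thesis by (simp add: perm_sum_1)
qed

lemma levels_le_Suc_iff:
  "(of_bool (levels (x # xs) \<le> Suc k) :: real) =
    of_bool (levels (filter (\<lambda>y. y < x) xs) \<le> k) * of_bool (levels (filter (\<lambda>y. y > x) xs) \<le> k)"
  by simp

text \<open>
  The first entry \<open>x\<close> becomes the root and its rank the size of the left subtree; the remaining
  entries are split by the shuffle identity.
\<close>

lemma perm_sum_levels:
  assumes "0 \<le> q"
  shows "finite A \<Longrightarrow> perm_sum q A (\<lambda>xs. of_bool (levels xs \<le> k)) = q_factorial q (card A) * level_cdf q k (card A)"
proof (induction k arbitrary: A)
  case 0
  show ?case
  proof (cases "A = {}")
    case False
    have "of_bool (levels xs \<le> 0) = (0::real)" if "xs \<in> permutations_of_set A" for xs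
      using that False by (cases xs) (auto simp: permutations_of_set_def)
    then have "perm_sum q A (\<lambda>xs. of_bool (levels xs \<le> 0)) = 0"
      unfolding perm_sum_def by (intro sum.neutral) simp
    then show ?thesis using False 0 by simp
  qed simp
next
  case (Suc k)
  show ?case
  proof (cases "A = {}")
    case False
    define n where "n = card A - 1"
    have n: "card A = Suc n" unfolding n_def using False Suc.prems by (simp add: card_gt_0_iff)
    let ?rk = "\<lambda>x. card {y \<in> A. y < x}"
    have "perm_sum q A (\<lambda>xs. of_bool (levels xs \<le> Suc k)) =
        (\<Sum>x\<in>A. q ^ ?rk x * (q_factorial q n * level_cdf q k (?rk x) * level_cdf q k (n - ?rk x)))"
      unfolding perm_sum_Cons[OF Suc.prems False] levels_le_Suc_iff
    proof (intro sum.cong refl arg_cong2[where f = "(*)"])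
      fix x assume x: "x \<in> A"
      let ?A = "{y \<in> A. y < x}" and ?B = "{y \<in> A. x < y}"
      have fin: "finite ?A" "finite ?B" using Suc.prems by auto
      have split: "A - {x} = ?A \<union> ?B" by auto
      have "card (?A \<union> ?B) = n" unfolding split[symmetric] using n x Suc.prems by simp
      moreover have "card (?A \<union> ?B) = card ?A + card ?B"
        using fin by (intro card_Un_disjoint) auto
      ultimately have cB: "card ?B = n - card ?A" and le: "card ?A \<le> n" by auto
      show "perm_sum q (A - {x}) (\<lambda>xs. of_bool (levels (filter (\<lambda>y. y < x) xs) \<le> k) *
              of_bool (levels (filter (\<lambda>y. x < y) xs) \<le> k)) =
            q_factorial q n * level_cdf q k (card ?A) * level_cdf q k (n - card ?A)"
        unfolding split
        by (subst perm_sum_shuffle) (use fin q_binomial_factorial[of q "card ?A" "n - card ?A"] le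
           in \<open>auto simp: Suc.IH cB\<close>)
    qed
    also have "\<dots> = q_factorial q n * (\<Sum>i<Suc n. q ^ i * level_cdf q k i * level_cdf q k (n - i))"
      using sum_over_ranks[OF Suc.prems, of "\<lambda>i. q ^ i * (q_factorial q n * level_cdf q k i * level_cdf q k (n - i))"] n
      by (simp add: sum_distrib_left distrib_left mult_ac)
    also have "\<dots> = q_factorial q (card A) * level_cdf q (Suc k) (card A)"
      using q_number_pos[OF assms, of "Suc n"] by (simp add: n)
    finally show ?thesis .
  qed simp
qed

lemma inversions_map:
  "inversions (map \<sigma> [a..<b]) = card {(i, j). i \<in> {a..<b} \<and> j \<in> {a..<b} \<and> i < j \<and> \<sigma> i > \<sigma> j}"
proof (induction "b - a" arbitrary: a)
  case 0
  then have "{(i, j). i \<in> {a..<b} \<and> j \<in> {a..<b} \<and> i < j \<and> \<sigma> i > \<sigma> j} = {}" by auto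
  then show ?case using 0 by (metis card.empty diff_is_0_eq inversions.simps(1) list.map(1) upt_conv_Nil)
next
  case (Suc n)
  then have less: "a < b" by simp
  let ?S = "\<lambda>a. {(i, j). i \<in> {a..<b} \<and> j \<in> {a..<b} \<and> i < j \<and> \<sigma> i > \<sigma> j}"
  let ?R = "{j \<in> {Suc a..<b}. \<sigma> j < \<sigma> a}"
  have S: "?S a = Pair a ` ?R \<union> ?S (Suc a)" using less by (auto simp: Suc_le_eq order_le_less)
  have fin: "finite (?S (Suc a))"
    by (rule finite_subset[of _ "{a..<b} \<times> {a..<b}"]) auto
  have "card (?S a) = card ?R + card (?S (Suc a))"
    unfolding S by (subst card_Un_disjoint) (use fin in \<open>auto simp: card_image inj_on_def\<close>)
  moreover have "length (filter (\<lambda>y. y < \<sigma> a) (map \<sigma> [Suc a..<b])) = card ?R"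
  proof -
    have "card ?R = length (filter (\<lambda>j. \<sigma> j < \<sigma> a) [Suc a..<b])"
      by (subst distinct_card[symmetric]) (auto intro!: arg_cong[where f = card])
    then show ?thesis by (simp add: filter_map comp_def)
  qed
  moreover have "inversions (map \<sigma> [Suc a..<b]) = card (?S (Suc a))"
    by (rule Suc(1)) (use Suc(2) in simp)
  ultimately show ?case using less by (simp add: upt_conv_Cons)
qed

lemma sum_permutes_eq_perm_sum:
  "(\<Sum>\<sigma> | \<sigma> permutes {1..n}. q ^ inv_count n \<sigma> * f (map \<sigma> [1..<Suc n])) = perm_sum q {1..n} f"
proof -
  let ?w = "\<lambda>\<sigma>::nat \<Rightarrow> nat. map \<sigma> [1..<Suc n]"
  have set_upt: "set [1..<Suc n] = {1..n}" by auto
  have inj: "inj_on ?w {\<sigma>. \<sigma> permutes {1..n}}"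
  proof (rule inj_onI)
    fix \<sigma> \<tau> assume h: "\<sigma> \<in> {\<sigma>. \<sigma> permutes {1..n}}" "\<tau> \<in> {\<sigma>. \<sigma> permutes {1..n}}" "?w \<sigma> = ?w \<tau>"
    show "\<sigma> = \<tau>"
    proof
      fix i show "\<sigma> i = \<tau> i"
      proof (cases "i \<in> {1..n}")
        case True
        then show ?thesis using h(3) set_upt by (metis map_eq_conv)
      next
        case False
        then show ?thesis using h by (simp add: permutes_not_in)
      qed
    qed
  qed
  have sub: "?w ` {\<sigma>. \<sigma> permutes {1..n}} \<subseteq> permutations_of_set {1..n}"
  proof (rule image_subsetI)
    fix \<sigma> assume "\<sigma> \<in> {\<sigma>. \<sigma> permutes {1..n}}"
    then have p: "\<sigma> permutes {1..n}" by simp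
    then have "distinct (?w \<sigma>)" by (simp only: distinct_map distinct_upt permutes_inj_on simp_thms)
    moreover have "set (?w \<sigma>) = {1..n}" unfolding set_map set_upt using permutes_image[OF p] .
    ultimately show "?w \<sigma> \<in> permutations_of_set {1..n}" by (simp only: permutations_of_set_def mem_Collect_eq simp_thms)
  qed
  have "card (?w ` {\<sigma>. \<sigma> permutes {1..n}}) = card (permutations_of_set {1..n})"
    unfolding card_image[OF inj] by (subst card_permutations[of _ n]) auto
  then have img: "?w ` {\<sigma>. \<sigma> permutes {1..n}} = permutations_of_set {1..n}"
    using sub by (intro card_subset_eq) auto
  have "inv_count n \<sigma> = inversions (?w \<sigma>)" for \<sigma>
    unfolding inversions_map inv_count_def by (intro arg_cong[where f = card]) auto
  then show ?thesis
    unfolding perm_sum_def img[symmetric] sum.reindex[OF inj] by (simp only: comp_def)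
qed

theorem mallows_height_le:
  assumes "0 \<le> q"
  shows "measure_pmf.prob (mallows_tree_pmf n q) {T. height T \<le> k} = level_cdf q (Suc k) n"
proof -
  let ?P = "{\<sigma>. \<sigma> permutes {1..n}}"
  let ?E = "{\<sigma>. height (bst (map \<sigma> [1..<Suc n])) \<le> k}"
  have fin: "finite ?P" by (simp add: finite_permutations)
  have Z: "mallows_const n q = q_factorial q n"
    unfolding mallows_const_def using sum_permutes_eq_perm_sum[of q n "\<lambda>_. 1"]
    by (simp add: perm_sum_1)
  have supp: "set_pmf (mallows_pmf n q) \<subseteq> ?P"
    using assms by (auto simp: set_pmf_eq pmf_mallows_pmf)
  have "measure_pmf.prob (mallows_tree_pmf n q) {T. height T \<le> k} = measure_pmf.prob (mallows_pmf n q) ?E"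
    by (simp only: mallows_tree_pmf_def measure_map_pmf vimage_def mem_Collect_eq)
  also have "\<dots> = measure_pmf.prob (mallows_pmf n q) (?E \<inter> ?P)"
    using supp by (intro measure_eq_AE) (auto simp: AE_measure_pmf_iff)
  also have "\<dots> = (\<Sum>\<sigma>\<in>?E \<inter> ?P. pmf (mallows_pmf n q) \<sigma>)"
    by (rule measure_measure_pmf_finite) (use fin in auto)
  also have "\<dots> = (\<Sum>\<sigma>\<in>?P. q ^ inv_count n \<sigma> * of_bool (levels (map \<sigma> [1..<Suc n]) \<le> Suc k) / q_factorial q n)"
    by (rule sum.mono_neutral_cong_left)
       (use fin in \<open>auto simp: pmf_mallows_pmf[OF assms] Z height_bst_le_iff simp del: upt_Suc\<close>)
  also have "\<dots> = perm_sum q {1..n} (\<lambda>xs. of_bool (levels xs \<le> Suc k)) / q_factorial q n"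
    by (simp only: sum_divide_distrib[symmetric] sum_permutes_eq_perm_sum[symmetric])
  also have "\<dots> = level_cdf q (Suc k) n"
    using q_factorial_pos[OF assms, of n] by (simp add: perm_sum_levels[OF assms])
  finally show ?thesis .
qed

section \<open>The walk down the right spine\<close>

text \<open>
  Success probabilities of the Bernoulli variables whose sum is the number of steps down the right
  spine until at most \<open>M\<close> nodes remain. In a Mallows permutation the \<open>i\<close>-th entry is a record with
  probability \<open>1 / [i]\<close>, and the records are the nodes of the spine. The value 1 at \<open>M + 1\<close> says that
  a single step suffices from there.
\<close>

definition spine_prob :: "real \<Rightarrow> nat \<Rightarrow> nat \<Rightarrow> real" where
  "spine_prob q M i = (if i \<le> M then 0 else if i = Suc M then 1 else 1 / q_number q i)"

primrec spine_pmf :: "real \<Rightarrow> nat \<Rightarrow> nat \<Rightarrow> nat pmf" where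
  "spine_pmf q M 0 = return_pmf 0"
| "spine_pmf q M (Suc n) = bind_pmf (bernoulli_pmf (spine_prob q M (Suc n)))
     (\<lambda>b. map_pmf (\<lambda>t. if b then Suc t else t) (spine_pmf q M n))"

abbreviation spine_exp :: "real \<Rightarrow> nat \<Rightarrow> nat \<Rightarrow> (nat \<Rightarrow> 'a::{banach, second_countable_topology}) \<Rightarrow> 'a" where
  "spine_exp q M n f \<equiv> measure_pmf.expectation (spine_pmf q M n) f"

lemma spine_prob_bounds: "0 \<le> q \<Longrightarrow> 0 \<le> spine_prob q M i \<and> spine_prob q M i \<le> 1"
  using q_number_ge_1[of q i] by (cases "i = 0") (auto simp: spine_prob_def)

lemma finite_set_spine_pmf: "finite (set_pmf (spine_pmf q M n))"
  by (induction n) auto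

lemma integrable_spine [simp]:
  "integrable (measure_pmf (spine_pmf q M n)) (f :: nat \<Rightarrow> 'a::{banach, second_countable_topology})"
  by (intro integrable_measure_pmf_finite finite_set_spine_pmf)

lemma spine_exp_Suc:
  assumes "0 \<le> q"
  shows "spine_exp q M (Suc n) f =
    spine_prob q M (Suc n) *\<^sub>R spine_exp q M n (\<lambda>t. f (Suc t)) + (1 - spine_prob q M (Suc n)) *\<^sub>R spine_exp q M n f"
  using spine_prob_bounds[OF assms]
  by (simp, subst pmf_expectation_bind[of UNIV]) (auto simp: UNIV_bool finite_set_spine_pmf)

lemma spine_exp_small: "0 \<le> q \<Longrightarrow> n \<le> M \<Longrightarrow> spine_exp q M n f = f 0"
  by (induction n) (simp_all add: spine_exp_Suc spine_prob_def del: spine_pmf.simps(2))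

text \<open>
  The walk described by \<open>spine_pmf\<close> makes a first step to the right child, which leaves \<open>i\<close> nodes
  behind with probability \<open>q ^ i / [n]\<close>. Both descriptions of the walk satisfy the same recursion in
  \<open>n\<close>, because \<open>[n + 1] = 1 + q [n]\<close>.
\<close>

lemma spine_exp_step:
  fixes f :: "nat \<Rightarrow> real"
  assumes "0 \<le> q" "M < n"
  shows "q_number q n * spine_exp q M n f = (\<Sum>i<n. q ^ i * spine_exp q M (n - 1 - i) (\<lambda>t. f (Suc t)))"
proof -
  have "Suc M \<le> n" using assms by simp
  then show ?thesis
  proof (induction n rule: dec_induct)
    case base
    have "spine_exp q M (Suc M) f = f 1"
      using assms(1) by (simp add: spine_exp_Suc spine_prob_def spine_exp_small del: spine_pmf.simps(2))
    then show ?case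
      using assms(1) by (simp add: spine_exp_small q_number_def sum_distrib_right del: spine_pmf.simps(2) sum.lessThan_Suc)
  next
    case (step n)
    let ?g = "\<lambda>t. f (Suc t)"
    have pos: "q_number q (Suc n) > 0" by (rule q_number_pos[OF assms(1)]) simp
    have "q_number q (Suc n) * spine_exp q M (Suc n) f = spine_exp q M n ?g + (q_number q (Suc n) - 1) * spine_exp q M n f"
      using pos step by (simp add: spine_exp_Suc[OF assms(1)] spine_prob_def field_simps del: spine_pmf.simps(2))
    also have "q_number q (Suc n) - 1 = q * q_number q n" by (simp add: q_number_Suc')
    also have "spine_exp q M n ?g + q * q_number q n * spine_exp q M n f
        = spine_exp q M n ?g + q * (\<Sum>i<n. q ^ i * spine_exp q M (n - 1 - i) ?g)"
      using step.IH by simp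
    also have "\<dots> = (\<Sum>i<Suc n. q ^ i * spine_exp q M (Suc n - 1 - i) ?g)"
      by (subst sum.lessThan_Suc_shift) (simp add: sum_distrib_left mult_ac)
    finally show ?case .
  qed
qed

section \<open>A first moment bound for the height\<close>

declare level_cdf.simps(2) [simp del]

lemma level_cdf_empty [simp]: "level_cdf q k 0 = 1"
  by (cases k) (auto simp: level_cdf.simps(2))

lemma level_cdf_bounds: "0 \<le> q \<Longrightarrow> 0 \<le> level_cdf q k n \<and> level_cdf q k n \<le> 1"
proof (induction k arbitrary: n)
  case (Suc k)
  show ?case
  proof (cases "n = 0")
    case False
    have "(\<Sum>i<n. q ^ i * level_cdf q k i * level_cdf q k (n - 1 - i)) \<le> q_number q n"
      unfolding q_number_def using Suc by (intro sum_mono) (auto simp: mult.assoc intro!: mult_left_le mult_le_one)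
    moreover have "0 \<le> (\<Sum>i<n. q ^ i * level_cdf q k i * level_cdf q k (n - 1 - i))"
      using Suc by (intro sum_nonneg) auto
    ultimately show ?thesis using q_number_pos[of q n] Suc.prems False by (simp add: level_cdf.simps(2))
  qed simp
qed simp

lemmas level_cdf_nonneg = level_cdf_bounds[THEN conjunct1]
lemmas level_cdf_le_1 = level_cdf_bounds[THEN conjunct2]

lemma level_cdf_Suc:
  assumes "0 \<le> q" "0 < n"
  shows "q_number q n * level_cdf q (Suc k) n = (\<Sum>i<n. q ^ i * (level_cdf q k i * level_cdf q k (n - 1 - i)))"
  using assms q_number_pos[of q n] by (simp add: level_cdf.simps(2) mult.assoc)

lemma level_cdf_mono_Suc: "0 \<le> q \<Longrightarrow> level_cdf q k n \<le> level_cdf q (Suc k) n"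
proof (induction k arbitrary: n)
  case 0
  then show ?case using level_cdf_nonneg[of q "Suc 0" n] by auto
next
  case (Suc k)
  show ?case
  proof (cases "n = 0")
    case False
    have "q_number q n * level_cdf q (Suc k) n \<le> q_number q n * level_cdf q (Suc (Suc k)) n"
      unfolding level_cdf_Suc[OF Suc.prems False[THEN neq0_conv[THEN iffD1]]]
      by (intro sum_mono mult_left_mono mult_mono level_cdf_nonneg Suc.IH Suc.prems zero_le_power)
    then show ?thesis using q_number_pos[of q n] False Suc by simp
  qed simp
qed

text \<open>
  The generalised binomial coefficient of \<open>n + s\<close> over \<open>n\<close>, which grows like \<open>n powr s\<close>.
\<close>

primrec binom_growth :: "real \<Rightarrow> nat \<Rightarrow> real" where
  "binom_growth s 0 = 1"
| "binom_growth s (Suc n) = binom_growth s n * (1 + s / real (Suc n))"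

lemma binom_growth_pos:
  assumes "-1 < s"
  shows "0 < binom_growth s n"
proof (induction n)
  case (Suc n)
  have "0 < 1 + s / real (Suc n)" using assms by (simp add: field_simps)
  with Suc show ?case by simp
qed simp

text \<open>
  The hockey-stick identity. It makes \<open>binom_growth s\<close> an exact eigenfunction of averaging over
  uniform splits, with eigenvalue \<open>1 / (s + 1)\<close>, exactly as \<open>x powr s\<close> is for uniform splits of an
  interval.
\<close>

lemma sum_binom_growth: "(s + 1) * (\<Sum>i<n. binom_growth s i) = real n * binom_growth s n"
proof (induction n)
  case (Suc n)
  have "(s + 1) * (\<Sum>i<Suc n. binom_growth s i) = (real n + s + 1) * binom_growth s n"
    using Suc by (simp add: algebra_simps)
  also have "\<dots> = real (Suc n) * binom_growth s (Suc n)"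
    by (simp add: field_simps)
  finally show ?case .
qed simp

lemma one_plus_powr_le:
  fixes x t :: real
  assumes "0 \<le> x" "0 \<le> t" "t \<le> 1"
  shows "(1 + x) powr t \<le> 1 + t * x"
  using Youngs_inequality_0[of t "1 - t" "1 + x" 1] assms by (simp add: algebra_simps)

lemma one_plus_mult_le_powr:
  fixes x s :: real
  assumes "0 \<le> x" "1 \<le> s"
  shows "1 + s * x \<le> (1 + x) powr s"
proof -
  have "(1 + s * x) powr (1 / s) \<le> 1 + x"
    using one_plus_powr_le[of "s * x" "1 / s"] assms by simp
  then have "((1 + s * x) powr (1 / s)) powr s \<le> (1 + x) powr s"
    using assms by (intro powr_mono2) auto
  moreover have "0 < 1 + s * x" using assms by (intro add_pos_nonneg) auto
  ultimately show ?thesis using assms by (simp add: powr_powr)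
qed

lemma binom_growth_le_powr:
  assumes "1 \<le> s"
  shows "binom_growth s n \<le> (real n + 1) powr s"
proof (induction n)
  case (Suc n)
  have "1 + s / real (Suc n) \<le> (1 + 1 / real (Suc n)) powr s"
  proof -
    have "1 + s * (1 / real (Suc n)) \<le> (1 + 1 / real (Suc n)) powr s"
      by (rule one_plus_mult_le_powr) (use assms in auto)
    then show ?thesis by simp
  qed
  then have "binom_growth s (Suc n) \<le> (real n + 1) powr s * (1 + 1 / real (Suc n)) powr s"
    using Suc assms binom_growth_pos[of s n] by (simp add: mult_mono)
  also have "\<dots> = ((real n + 1) * (1 + 1 / real (Suc n))) powr s"
    by (subst powr_mult) auto
  also have "(real n + 1) * (1 + 1 / real (Suc n)) = real (Suc n) + 1" by (simp add: field_simps)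
  finally show ?case .
qed simp

lemma one_minus_q_times_q_number: "(1 - q) * q_number q n = 1 - q ^ n"
proof (induction n)
  case (Suc n)
  then show ?case unfolding q_number_Suc power_Suc distrib_left by (simp add: algebra_simps)
qed simp

lemma q_number_ge_last: "0 \<le> q \<Longrightarrow> q \<le> 1 \<Longrightarrow> real n * q ^ n \<le> q_number q n"
proof -
  assume q: "0 \<le> q" "q \<le> 1"
  have "(\<Sum>i<n. q ^ n) \<le> (\<Sum>i<n. q ^ i)" by (intro sum_mono power_decreasing) (use q in auto)
  then show ?thesis by (simp add: q_number_def)
qed

lemma q_number_le: "0 \<le> q \<Longrightarrow> q \<le> 1 \<Longrightarrow> q_number q n \<le> real n"
  unfolding q_number_def using sum_mono[of "{..<n}" "\<lambda>i. q ^ i" "\<lambda>_. 1"] by (simp add: power_le_one)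

text \<open>
  The geometric factor \<open>\<rho> ^ n\<close> by which the supersolution below is multiplied has to compensate that
  splits are not uniform: the right subtree is favoured once \<open>n\<close> exceeds \<open>1 / (1 - q)\<close>. The rate
  \<open>(s + 1) (1 - q)\<close> is what an induction on \<open>n\<close> requires.
\<close>

lemma discounted_growth_sum:
  fixes q s \<rho> :: real
  assumes q: "0 \<le> q" "q \<le> 1" and s: "0 \<le> s" and \<rho>: "1 + (s + 1) * (1 - q) \<le> \<rho>"
  shows "(s + 1) * (\<Sum>i<n. (1 / \<rho>) ^ i * binom_growth s (n - 1 - i)) \<le> \<rho> * q_number q n * binom_growth s n"
proof (induction n)
  case (Suc n)
  let ?S = "\<lambda>n. \<Sum>i<n. (1 / \<rho>) ^ i * binom_growth s (n - 1 - i)"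
  let ?g = "binom_growth s n"
  have g: "0 < ?g" using s by (intro binom_growth_pos) simp
  have "0 \<le> (s + 1) * (1 - q)" using s q by simp
  then have \<rho>1: "1 \<le> \<rho>" using \<rho> by linarith
  have "?S (Suc n) = ?g + ?S n / \<rho>"
    by (subst sum.lessThan_Suc_shift) (simp add: sum_divide_distrib mult_ac)
  then have "(s + 1) * ?S (Suc n) = (s + 1) * ?g + (s + 1) * ?S n / \<rho>"
    by (simp add: distrib_left)
  also have "\<dots> \<le> (s + 1) * ?g + q_number q n * ?g"
    using Suc \<rho>1 by (simp add: divide_le_eq mult_ac)
  also have "\<dots> = (s + 1 + q_number q n) * ?g" by (simp add: algebra_simps)
  also have "s + 1 + q_number q n \<le> \<rho> * q_number q (Suc n) * (1 + s / real (Suc n))"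
  proof -
    let ?Q = "q_number q (Suc n)"
    have Q: "0 \<le> ?Q" using q_number_pos[of q "Suc n"] q by simp
    have "(1 + (s + 1) * (1 - q)) * (1 + s / real (Suc n)) \<ge> 1 + (s + 1) * (1 - q) + s / real (Suc n)"
    proof -
      have "1 + u + v \<le> (1 + u) * (1 + v)" if "0 \<le> u * v" for u v :: real
        using that by (simp add: algebra_simps)
      then show ?thesis using s q by simp
    qed
    moreover have "\<rho> * (1 + s / real (Suc n)) \<ge> (1 + (s + 1) * (1 - q)) * (1 + s / real (Suc n))"
      using \<rho> s by (intro mult_right_mono) auto
    ultimately have "?Q * (1 + (s + 1) * (1 - q) + s / real (Suc n)) \<le> ?Q * (\<rho> * (1 + s / real (Suc n)))"
      using Q by (intro mult_left_mono) auto
    moreover have "?Q * (1 + (s + 1) * (1 - q) + s / real (Suc n)) = ?Q + (s + 1) * (1 - q ^ Suc n) + s * (?Q / real (Suc n))"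
      unfolding one_minus_q_times_q_number[symmetric] by (simp add: algebra_simps)
    moreover have "s * q ^ Suc n \<le> s * (?Q / real (Suc n))"
      using q_number_ge_last[OF q, of "Suc n"] s by (intro mult_left_mono) (simp_all add: pos_le_divide_eq mult.commute)
    moreover have "q ^ Suc n \<le> q ^ n" using q by (intro power_decreasing) auto
    moreover have "(s + 1) * (1 - q ^ Suc n) + s * q ^ Suc n = s + 1 - q ^ Suc n" by algebra
    moreover have "?Q * (\<rho> * (1 + s / real (Suc n))) = \<rho> * ?Q * (1 + s / real (Suc n))"
      by (simp only: mult_ac)
    ultimately show ?thesis using q_number_Suc[of q n] by linarith
  qed
  then have "(s + 1 + q_number q n) * ?g \<le> \<rho> * q_number q (Suc n) * (1 + s / real (Suc n)) * ?g"
    using g by (intro mult_right_mono) auto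
  finally show ?case by (simp add: mult_ac)
qed simp

text \<open>
  The probability of exceeding \<open>k\<close> levels is at most the expected number of nodes at depth \<open>k\<close>, which
  solves the linear recursion obtained from \<open>1 - a b \<le> (1 - a) + (1 - b)\<close>. The right-hand side is a
  supersolution of that recursion. For \<open>s = c* - 1\<close> it equals 1 at about \<open>k = c* ln n\<close> as long as
  \<open>n (1 - q)\<close> is bounded.
\<close>

lemma level_tail_le_growth:
  fixes q s \<rho> :: real
  assumes q: "0 \<le> q" "q \<le> 1" and s: "0 \<le> s" and \<rho>: "1 + (s + 1) * (1 - q) \<le> \<rho>"
  shows "1 - level_cdf q k n \<le> binom_growth s n * \<rho> ^ n * (2 / (s + 1)) ^ k"
proof (induction k arbitrary: n)
  have "0 \<le> (s + 1) * (1 - q)" using s q by simp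
  then have \<rho>1: "1 \<le> \<rho>" using \<rho> by linarith
  have g: "1 \<le> binom_growth s n" for n
    using s by (induction n) (auto intro!: mult_ge1_I)
  {
    case 0
    have "1 \<le> binom_growth s n * \<rho> ^ n" using g \<rho>1 by (intro mult_ge1_I) auto
    then show ?case by auto
  next
    case (Suc k)
    let ?a = "\<lambda>n. binom_growth s n * \<rho> ^ n" and ?\<mu> = "2 / (s + 1)"
    have a: "0 \<le> ?a n" for n using g[of n] \<rho>1 by simp
    show ?case
    proof (cases "n = 0")
      case True
      then show ?thesis using s by simp
    next
      case False
      have Q: "0 < q_number q n" using False q by (intro q_number_pos) auto
      have "q_number q n * (1 - level_cdf q (Suc k) n) = (\<Sum>i<n. q ^ i * (1 - level_cdf q k i * level_cdf q k (n - 1 - i)))"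
        using level_cdf_Suc[of q n k] False q by (simp add: right_diff_distrib sum_subtractf q_number_def)
      also have "\<dots> \<le> (\<Sum>i<n. q ^ i * (?\<mu> ^ k * (?a i + ?a (n - 1 - i))))"
      proof (intro sum_mono mult_left_mono)
        fix i
        have "1 - level_cdf q k i * level_cdf q k (n - 1 - i) \<le> (1 - level_cdf q k i) + (1 - level_cdf q k (n - 1 - i))"
          using mult_nonneg_nonneg[of "1 - level_cdf q k i" "1 - level_cdf q k (n - 1 - i)"] level_cdf_le_1[OF q(1)]
          by (simp add: algebra_simps)
        also have "\<dots> \<le> ?\<mu> ^ k * (?a i + ?a (n - 1 - i))"
          using Suc[of i] Suc[of "n - 1 - i"] by (simp add: algebra_simps)
        finally show "1 - level_cdf q k i * level_cdf q k (n - 1 - i) \<le> ?\<mu> ^ k * (?a i + ?a (n - 1 - i))" .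
      qed (use q in auto)
      also have "\<dots> = ?\<mu> ^ k * ((\<Sum>i<n. q ^ i * ?a i) + (\<Sum>i<n. q ^ i * ?a (n - 1 - i)))"
        by (simp add: sum_distrib_left sum.distrib[symmetric] algebra_simps)
      also have "\<dots> \<le> ?\<mu> ^ k * ((\<Sum>i<n. ?a i) + (\<Sum>i<n. ?a (n - 1 - i)))"
        using q s by (intro mult_left_mono add_mono sum_mono mult_left_le_one_le a power_le_one) auto
      also have "(\<Sum>i<n. ?a i) = (\<Sum>i<n. ?a (n - 1 - i))"
        by (subst sum.nat_diff_reindex[symmetric]) simp
      also have "(\<Sum>i<n. ?a (n - 1 - i)) = \<rho> ^ (n - 1) * (\<Sum>i<n. (1 / \<rho>) ^ i * binom_growth s (n - 1 - i))"
        unfolding sum_distrib_left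
      proof (intro sum.cong refl)
        fix i assume "i \<in> {..<n}"
        then have "\<rho> ^ (n - 1) = \<rho> ^ (n - 1 - i) * \<rho> ^ i" by (simp flip: power_add)
        then show "?a (n - 1 - i) = \<rho> ^ (n - 1) * ((1 / \<rho>) ^ i * binom_growth s (n - 1 - i))"
          using \<rho>1 by (simp add: power_one_over)
      qed
      also have "?\<mu> ^ k * (\<dots> + \<dots>) \<le> ?\<mu> ^ k * (?\<mu> * (\<rho> ^ (n - 1) * (\<rho> * q_number q n * binom_growth s n)))"
      proof -
        have "\<rho> ^ (n - 1) * ((s + 1) * (\<Sum>i<n. (1 / \<rho>) ^ i * binom_growth s (n - 1 - i))) \<le> \<rho> ^ (n - 1) * (\<rho> * q_number q n * binom_growth s n)"
          by (intro mult_left_mono discounted_growth_sum assms) (use \<rho>1 in auto)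
        then show ?thesis using s by (intro mult_left_mono) (auto simp: field_simps)
      qed
      also have "\<rho> ^ (n - 1) * (\<rho> * q_number q n * binom_growth s n) = q_number q n * ?a n"
        using False by (cases n) auto
      also have "?\<mu> ^ k * (?\<mu> * (q_number q n * ?a n)) = q_number q n * (?a n * ?\<mu> ^ Suc k)" by simp
      finally show ?thesis using Q by (rule mult_left_le_imp_le)
    qed
  }
qed

section \<open>The height is at most the spine plus a critical tree\<close>

lemma c_star_ge_2: "2 \<le> c_star" and c_star_eq: "c_star * ln (2 * exp 1 / c_star) = 1"
  using theI'[OF c_star_ex1] unfolding c_star_def by auto

lemma c_star_le_6: "c_star \<le> 6"
proof -
  have "0 < ln (2 * exp 1 / c_star)"
    using c_star_ge_2 c_star_eq by (metis less_le_trans zero_less_mult_pos zero_less_numeral zero_less_one)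
  then have "1 < 2 * exp 1 / c_star" using c_star_ge_2 by (subst (asm) ln_gt_zero_iff) auto
  then show ?thesis using c_star_ge_2 exp_le by (simp add: field_simps)
qed

text \<open>
  The equation for \<open>c*\<close> in the form in which it enters: a factor \<open>n powr (c* - 1)\<close> is compensated by
  \<open>c* ln n\<close> factors \<open>2 / c*\<close>.
\<close>

lemma ln_half_c_star: "ln (c_star / 2) = (c_star - 1) / c_star"
proof -
  have "ln (2 * exp 1 / c_star) = 1 - ln (c_star / 2)"
    using c_star_ge_2 by (simp add: ln_div ln_mult)
  moreover have "ln (2 * exp 1 / c_star) = 1 / c_star"
    using c_star_eq c_star_ge_2 by (simp add: field_simps)
  ultimately have "ln (c_star / 2) = 1 - 1 / c_star" by linarith
  then show ?thesis using c_star_ge_2 by (simp add: diff_divide_distrib)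
qed

text \<open>
  The Laplace transform of the spine walk. As a function of \<open>n\<close> it measures, with geometric weights,
  how much of the spine is still to come.
\<close>

abbreviation laplace :: "real \<Rightarrow> nat \<Rightarrow> real \<Rightarrow> nat \<Rightarrow> real" where
  "laplace q M \<eta> n \<equiv> spine_exp q M n (\<lambda>t. \<eta> ^ t)"

lemma laplace_Suc:
  "0 \<le> q \<Longrightarrow> laplace q M \<eta> (Suc n) = (1 - spine_prob q M (Suc n) * (1 - \<eta>)) * laplace q M \<eta> n"
  by (simp add: spine_exp_Suc algebra_simps del: spine_pmf.simps(2))

lemma laplace_nonneg: "0 \<le> \<eta> \<Longrightarrow> 0 \<le> laplace q M \<eta> n"
  by (intro Bochner_Integration.integral_nonneg) auto

lemma laplace_le_1: "0 \<le> q \<Longrightarrow> 0 \<le> \<eta> \<Longrightarrow> \<eta> \<le> 1 \<Longrightarrow> laplace q M \<eta> n \<le> 1"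
  by (rule measure_pmf.integral_le_const) (auto simp: power_le_one)

lemma laplace_antimono:
  assumes "0 \<le> q" "0 \<le> \<eta>" "\<eta> \<le> 1" "a \<le> b"
  shows "laplace q M \<eta> b \<le> laplace q M \<eta> a"
  using assms(4)
proof (induction b rule: dec_induct)
  case (step b)
  have "laplace q M \<eta> (Suc b) \<le> laplace q M \<eta> b"
    unfolding laplace_Suc[OF assms(1)] using spine_prob_bounds[OF assms(1), of M "Suc b"] assms
    by (intro mult_left_le_one_le laplace_nonneg) (auto intro!: mult_le_one)
  with step show ?case by linarith
qed simp

lemma power_le_half:
  fixes q :: real
  assumes "0 \<le> q" "q < 1" "1 / (1 - q) \<le> real n"
  shows "q ^ n \<le> 1 / 2"
proof -
  have "q \<le> exp (- (1 - q))" using exp_ge_add_one_self[of "- (1 - q)"] by simp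
  then have "q ^ n \<le> exp (- (1 - q)) ^ n" using assms by (intro power_mono) auto
  also have "\<dots> = exp (- (real n * (1 - q)))" by (simp add: algebra_simps flip: exp_of_nat_mult)
  also have "\<dots> \<le> exp (- 1)" using assms by (simp add: field_simps)
  also have "\<dots> \<le> 1 / 2" using exp_ge_add_one_self[of 1] by (simp add: exp_minus field_simps)
  finally show ?thesis .
qed

text \<open>
  Above \<open>M \<ge> 1 / (1 - q)\<close> a spine step is made with probability at most \<open>2 (1 - q)\<close> per unit of size.
  The extra factor \<open>\<eta>\<close> accounts for the certain step at \<open>M + 1\<close>.
\<close>

lemma laplace_ratio:
  assumes q: "0 \<le> q" "q < 1" and M: "1 / (1 - q) \<le> real M"
    and \<eta>: "15 / 16 \<le> \<eta>" "\<eta> \<le> 1" and ab: "a \<le> b"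
  shows "\<eta> * (1 - (1 - q) / 8) ^ (b - a) * laplace q M \<eta> a \<le> laplace q M \<eta> b"
proof -
  define c where "c b = (if a \<le> M \<and> M < b then \<eta> else 1)" for b
  let ?w = "1 - (1 - q) / 8"
  have w: "0 \<le> ?w" "?w \<le> 1" using q by auto
  have one_step: "(if j = M then \<eta> else ?w) * laplace q M \<eta> j \<le> laplace q M \<eta> (Suc j)" for j
  proof -
    have "(if j = M then \<eta> else ?w) \<le> 1 - spine_prob q M (Suc j) * (1 - \<eta>)"
    proof (cases "M < j")
      case True
      have "1 / (1 - q) \<le> real (Suc j)" using M True by linarith
      then have "q ^ Suc j \<le> 1 / 2" by (rule power_le_half[OF q])
      then have "1 / 2 \<le> (1 - q) * q_number q (Suc j)" unfolding one_minus_q_times_q_number by simp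
      then have "1 / q_number q (Suc j) \<le> 2 * (1 - q)"
        using q_number_pos[OF q(1), of "Suc j"] by (simp add: field_simps)
      then have "1 / q_number q (Suc j) * (1 - \<eta>) \<le> 2 * (1 - q) * (1 / 16)"
        using q \<eta> by (intro mult_mono) auto
      then have "1 - 1 / q_number q (Suc j) * (1 - \<eta>) \<ge> ?w" by linarith
      then show ?thesis using True by (simp add: spine_prob_def)
    next
      case False
      then show ?thesis using q by (auto simp: spine_prob_def)
    qed
    then show ?thesis unfolding laplace_Suc[OF q(1)]
      using \<eta> by (intro mult_right_mono laplace_nonneg) auto
  qed
  have "c b * ?w ^ (b - a) * laplace q M \<eta> a \<le> laplace q M \<eta> b"
    using ab
  proof (induction b rule: dec_induct)
    case base
    then show ?case by (simp add: c_def)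
  next
    case (step b)
    let ?s = "if b = M then \<eta> else ?w"
    have L: "0 \<le> laplace q M \<eta> a" using \<eta> by (intro laplace_nonneg) auto
    have "c (Suc b) * ?w \<le> ?s * c b" using w \<eta> step(1) by (auto simp: c_def)
    then have "(c (Suc b) * ?w) * (?w ^ (b - a) * laplace q M \<eta> a) \<le> (?s * c b) * (?w ^ (b - a) * laplace q M \<eta> a)"
      using w L by (intro mult_right_mono) auto
    also have "\<dots> = ?s * (c b * ?w ^ (b - a) * laplace q M \<eta> a)" by simp
    also have "\<dots> \<le> ?s * laplace q M \<eta> b" using step.IH w \<eta> by (intro mult_left_mono) auto
    also have "\<dots> \<le> laplace q M \<eta> (Suc b)" by (rule one_step)
    finally show ?case using step(1) by (simp add: Suc_diff_le mult_ac)
  qed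
  moreover have "\<eta> * (?w ^ (b - a) * laplace q M \<eta> a) \<le> c b * (?w ^ (b - a) * laplace q M \<eta> a)"
    using w \<eta> by (intro mult_right_mono) (auto simp: c_def intro!: mult_nonneg_nonneg laplace_nonneg)
  ultimately show ?thesis by (simp add: mult_ac)
qed

text \<open>
  With the exponent \<open>1 / 16\<close> the power of \<open>i\<close> is at most linear, and the geometric growth in \<open>i\<close> is
  slow enough to be beaten by the weights \<open>q ^ i\<close>.
\<close>

lemma rooted_growth_le:
  fixes y s :: real
  assumes y: "0 < y" "y \<le> 1" and s: "1 \<le> s" "s \<le> 5"
  shows "(binom_growth s i * (1 + 6 * y) ^ i) powr (1 / 16)
    \<le> (1 / y) powr (s / 16) * (1 + (real i + 1) * y) * (1 + 3 * y / 8) ^ i"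
proof -
  have g: "0 < binom_growth s i" using s by (intro binom_growth_pos) auto
  have "binom_growth s i powr (1 / 16) \<le> ((real i + 1) powr s) powr (1 / 16)"
    using g by (intro powr_mono2 binom_growth_le_powr s) auto
  also have "\<dots> = (1 / y * ((real i + 1) * y)) powr (s / 16)"
    using y by (simp add: powr_powr)
  also have "\<dots> = (1 / y) powr (s / 16) * ((real i + 1) * y) powr (s / 16)"
    by (rule powr_mult)
  also have "\<dots> \<le> (1 / y) powr (s / 16) * (1 + (real i + 1) * y)"
  proof (intro mult_left_mono)
    have "((real i + 1) * y) powr (s / 16) \<le> (1 + (real i + 1) * y) powr (s / 16)"
      using y s by (intro powr_mono2) auto
    also have "\<dots> \<le> 1 + s / 16 * ((real i + 1) * y)"
      using y s by (intro one_plus_powr_le) auto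
    also have "\<dots> \<le> 1 + 1 * ((real i + 1) * y)"
      using y s by (intro add_left_mono mult_right_mono) auto
    finally show "((real i + 1) * y) powr (s / 16) \<le> 1 + (real i + 1) * y" by simp
  qed auto
  finally have 1: "binom_growth s i powr (1 / 16) \<le> (1 / y) powr (s / 16) * (1 + (real i + 1) * y)" .
  have "((1 + 6 * y) ^ i) powr (1 / 16) = ((1 + 6 * y) powr (1 / 16)) ^ i"
    using y by (simp add: powr_realpow[symmetric] powr_powr mult.commute)
  also have "\<dots> \<le> (1 + 3 * y / 8) ^ i"
    using one_plus_powr_le[of "6 * y" "1 / 16"] y by (intro power_mono) auto
  finally have "((1 + 6 * y) ^ i) powr (1 / 16) \<le> (1 + 3 * y / 8) ^ i" .
  with 1 have "binom_growth s i powr (1 / 16) * ((1 + 6 * y) ^ i) powr (1 / 16)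
      \<le> ((1 / y) powr (s / 16) * (1 + (real i + 1) * y)) * (1 + 3 * y / 8) ^ i"
    using y by (intro mult_mono) auto
  then show ?thesis using g y by (simp add: powr_mult)
qed

lemma sum_power_linear_le:
  fixes y :: real
  assumes "0 < y" "y \<le> 1"
  shows "(\<Sum>i<n. (1 - y / 2) ^ i * (1 + (real i + 1) * y)) \<le> 6 / y"
proof -
  let ?\<kappa> = "1 - y / 2"
  have \<kappa>: "norm ?\<kappa> < 1" "0 \<le> ?\<kappa>" using assms by auto
  have "(\<Sum>i<n. ?\<kappa> ^ i) \<le> (\<Sum>i. ?\<kappa> ^ i)"
    using \<kappa> by (intro sum_le_suminf) (auto simp: summable_geometric)
  also have "\<dots> = 2 / y" using \<kappa> by (simp add: suminf_geometric)
  finally have 1: "(\<Sum>i<n. ?\<kappa> ^ i) \<le> 2 / y" .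
  have "(\<Sum>i<n. real (Suc i) * ?\<kappa> ^ i) \<le> (\<Sum>i. real (Suc i) * ?\<kappa> ^ i)"
    using geometric_deriv_sums[OF \<kappa>(1)] \<kappa>(2) by (intro sum_le_suminf) (auto simp: sums_iff)
  also have "\<dots> = 1 / (1 - ?\<kappa>)\<^sup>2"
    using geometric_deriv_sums[OF \<kappa>(1)] by (simp add: sums_iff)
  finally have "y * (\<Sum>i<n. real (Suc i) * ?\<kappa> ^ i) \<le> y * (1 / (1 - ?\<kappa>)\<^sup>2)"
    using assms by (intro mult_left_mono) auto
  also have "\<dots> = 4 / y" using assms by (simp add: power2_eq_square field_simps)
  finally have 2: "y * (\<Sum>i<n. real (Suc i) * ?\<kappa> ^ i) \<le> 4 / y" .
  have "(\<Sum>i<n. ?\<kappa> ^ i * (1 + (real i + 1) * y)) = (\<Sum>i<n. ?\<kappa> ^ i) + y * (\<Sum>i<n. real (Suc i) * ?\<kappa> ^ i)"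
    unfolding sum_distrib_left sum.distrib[symmetric] by (intro sum.cong) (auto simp: algebra_simps)
  with 1 2 show ?thesis by simp
qed

text \<open>
  The left-hand side is the contribution of the left subtree at the current spine node. Its size has
  mean about \<open>1 / (1 - q)\<close> and a geometric tail. The three geometric rates \<open>q\<close>, \<open>1 + 3 (1 - q) / 8\<close>
  and \<open>1 / (1 - (1 - q) / 8)\<close> multiply to at most \<open>1 - (1 - q) / 2\<close>, so that the sum is governed by
  the sizes \<open>i\<close> of order \<open>1 / (1 - q)\<close>.
\<close>

lemma weighted_growth_le:
  fixes q s \<eta> :: real
  assumes q: "0 \<le> q" "q < 1" and M: "1 / (1 - q) \<le> real M" and s: "1 \<le> s" "s \<le> 5"
    and \<eta>: "15 / 16 \<le> \<eta>" "\<eta> \<le> 1" and n: "M < n"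
  shows "(\<Sum>i<n. q ^ i * (binom_growth s i * (1 + 6 * (1 - q)) ^ i) powr (1 / 16) * laplace q M \<eta> (n - 1 - i))
    \<le> 16 * (1 / (1 - q)) powr (s / 16) * (\<Sum>i<n. q ^ i * laplace q M \<eta> (n - 1 - i))"
proof -
  define y where "y = 1 - q"
  have y: "0 < y" "y \<le> 1" using q by (auto simp: y_def)
  define A where "A = (1 / y) powr (s / 16)"
  have A: "0 \<le> A" by (simp add: A_def)
  let ?L = "laplace q M \<eta>"
  have L: "0 \<le> ?L j" for j using \<eta> by (intro laplace_nonneg) auto
  let ?w = "1 - y / 8"
  have w: "0 < ?w" using y by auto
  have "(\<Sum>i<n. q ^ i * (binom_growth s i * (1 + 6 * y) ^ i) powr (1 / 16) * ?L (n - 1 - i))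
    \<le> (\<Sum>i<n. A / \<eta> * ?L (n - 1) * ((1 - y / 2) ^ i * (1 + (real i + 1) * y)))"
  proof (intro sum_mono)
    fix i assume i: "i \<in> {..<n}"
    have "\<eta> * ?w ^ (n - 1 - (n - 1 - i)) * ?L (n - 1 - i) \<le> ?L (n - 1)"
      unfolding y_def by (rule laplace_ratio[OF q M \<eta>]) simp
    moreover have "n - 1 - (n - 1 - i) = i" using i by auto
    ultimately have ratio: "?w ^ i * ?L (n - 1 - i) \<le> ?L (n - 1) / \<eta>"
      using \<eta> by (simp add: field_simps)
    have q_eq: "q = 1 - y" by (simp add: y_def)
    have "(1 - y / 2) * ?w - q * (1 + 3 * y / 8) = 7 / 16 * y\<^sup>2"
      unfolding q_eq by (simp add: field_simps power2_eq_square)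
    then have "q * (1 + 3 * y / 8) \<le> (1 - y / 2) * ?w"
      using zero_le_power2[of y] by linarith
    then have "(q * (1 + 3 * y / 8)) ^ i \<le> ((1 - y / 2) * ?w) ^ i"
      using q y by (intro power_mono) auto
    then have pw: "q ^ i * (1 + 3 * y / 8) ^ i \<le> (1 - y / 2) ^ i * ?w ^ i"
      by (simp add: power_mult_distrib)
    have "q ^ i * (binom_growth s i * (1 + 6 * y) ^ i) powr (1 / 16) * ?L (n - 1 - i)
      \<le> q ^ i * (A * (1 + (real i + 1) * y) * (1 + 3 * y / 8) ^ i) * ?L (n - 1 - i)"
      unfolding A_def using q by (intro mult_right_mono mult_left_mono rooted_growth_le y s L) auto
    also have "\<dots> = A * (1 + (real i + 1) * y) * ?L (n - 1 - i) * (q ^ i * (1 + 3 * y / 8) ^ i)"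
      by (simp only: mult_ac)
    also have "\<dots> \<le> A * (1 + (real i + 1) * y) * ?L (n - 1 - i) * ((1 - y / 2) ^ i * ?w ^ i)"
      using A L y by (intro mult_left_mono pw) auto
    also have "\<dots> = A * (1 + (real i + 1) * y) * (1 - y / 2) ^ i * (?w ^ i * ?L (n - 1 - i))"
      by (simp only: mult_ac)
    also have "\<dots> \<le> A * (1 + (real i + 1) * y) * (1 - y / 2) ^ i * (?L (n - 1) / \<eta>)"
      using A y by (intro mult_left_mono ratio) auto
    finally show "q ^ i * (binom_growth s i * (1 + 6 * y) ^ i) powr (1 / 16) * ?L (n - 1 - i)
      \<le> A / \<eta> * ?L (n - 1) * ((1 - y / 2) ^ i * (1 + (real i + 1) * y))"
      by (simp add: mult_ac)
  qed
  also have "\<dots> = A / \<eta> * ?L (n - 1) * (\<Sum>i<n. (1 - y / 2) ^ i * (1 + (real i + 1) * y))"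
    by (simp add: sum_distrib_left)
  also have "\<dots> \<le> A / \<eta> * ?L (n - 1) * (6 / y)"
    using A L \<eta> by (intro mult_left_mono sum_power_linear_le y) auto
  also have "\<dots> \<le> 16 * A * (?L (n - 1) * (1 / (2 * y)))"
  proof -
    have "1 / \<eta> \<le> 16 / 15" using \<eta> by (simp add: field_simps)
    then have "6 / \<eta> \<le> 8" by simp
    then have "(6 / \<eta>) * (A * ?L (n - 1) / y) \<le> 8 * (A * ?L (n - 1) / y)"
      using A L y by (intro mult_right_mono) auto
    then show ?thesis using y by (simp add: field_simps)
  qed
  also have "\<dots> \<le> 16 * A * (?L (n - 1) * q_number q n)"
  proof (intro mult_left_mono L)
    have "1 / (1 - q) \<le> real n" using M n by linarith
    then have "q ^ n \<le> 1 / 2" by (rule power_le_half[OF q])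
    then have "1 / 2 \<le> y * q_number q n" unfolding y_def one_minus_q_times_q_number by simp
    then show "1 / (2 * y) \<le> q_number q n" using y by (simp add: field_simps)
  qed (use A in auto)
  also have "?L (n - 1) * q_number q n \<le> (\<Sum>i<n. q ^ i * ?L (n - 1 - i))"
    unfolding q_number_def sum_distrib_left
  proof (intro sum_mono)
    fix i
    have "?L (n - 1) \<le> ?L (n - 1 - i)" using q \<eta> by (intro laplace_antimono) auto
    then have "q ^ i * ?L (n - 1) \<le> q ^ i * ?L (n - 1 - i)" using q by (intro mult_left_mono) auto
    then show "?L (n - 1) * q ^ i \<le> q ^ i * ?L (n - 1 - i)" by (simp add: mult.commute)
  qed
  finally show ?thesis using A by (simp add: A_def y_def mult_left_mono)
qed

text \<open>
  A probability is at most its own 16th root. Passing to the root keeps the threshold \<open>c* ln n\<close> and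
  makes the bound grow so slowly in \<open>n\<close> that it can be averaged over the geometric sizes of the left
  subtrees.
\<close>

lemma level_tail_rooted:
  fixes q s :: real
  assumes q: "0 \<le> q" "q \<le> 1" and s: "0 \<le> s" "s \<le> 5"
  shows "1 - level_cdf q k n \<le>
    (binom_growth s n * (1 + 6 * (1 - q)) ^ n) powr (1 / 16) * ((2 / (s + 1)) powr (1 / 16)) ^ k"
proof -
  let ?G = "1 - level_cdf q k n" and ?a = "binom_growth s n * (1 + 6 * (1 - q)) ^ n"
  have a: "0 \<le> ?a" using binom_growth_pos[of s n] s q by simp
  have G: "0 \<le> ?G" "?G \<le> 1" using level_cdf_bounds[OF q(1), of k n] by auto
  have "?G \<le> ?G powr (1 / 16)"
    using G powr_mono'[of "1 / 16" 1 ?G] by (cases "?G = 0") auto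
  also have "\<dots> \<le> (?a * (2 / (s + 1)) ^ k) powr (1 / 16)"
  proof (rule powr_mono2)
    have "(s + 1) * (1 - q) \<le> 6 * (1 - q)" using s q by (intro mult_right_mono) auto
    then show "?G \<le> ?a * (2 / (s + 1)) ^ k" using s q by (intro level_tail_le_growth) auto
  qed (use G in auto)
  also have "\<dots> = ?a powr (1 / 16) * ((2 / (s + 1)) ^ k) powr (1 / 16)"
    by (rule powr_mult)
  also have "((2 / (s + 1)) ^ k) powr (1 / 16) = ((2 / (s + 1)) powr (1 / 16)) ^ k"
    using s by (simp add: powr_realpow[symmetric] powr_powr mult.commute)
  finally show ?thesis .
qed

text \<open>
  The induction follows the spine. A left subtree counts only if it has more than \<open>k'\<close> levels while
  the rest of the spine is at most \<open>k' - U\<close>; by the tail bound and Markov's inequality for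
  \<open>\<eta> ^ (t + U - k')\<close> this has probability at most \<open>b i * \<eta> ^ U\<close> times the Laplace transform of the
  rest of the spine. The potential \<open>1 - laplace\<close> increases by a fixed multiple of that transform in
  every step, so it pays for all left subtrees together, however long the spine is.
\<close>

lemma level_tail_le_spine:
  fixes q s :: real and U :: nat
  assumes q: "0 \<le> q" "q < 1" and M: "1 / (1 - q) \<le> real M" "real M \<le> 1 / (1 - q) + 1" and s: "1 \<le> s" "s \<le> 5"
    and \<eta>: "\<eta> = (2 / (s + 1)) powr (1 / 16)" "15 / 16 \<le> \<eta>" "\<eta> < 1"
  defines "A \<equiv> 16 * (1 / (1 - q)) powr (s / 16) * \<eta> ^ U"
  shows "1 - level_cdf q k n \<le> spine_exp q M n (\<lambda>t. of_bool (k < t + U)) + (A + A / (1 - \<eta>) * (1 - laplace q M \<eta> n))"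
proof (induction n arbitrary: k rule: less_induct)
  case (less n)
  define y where "y = 1 - q"
  have y: "0 < y" "y \<le> 1" using q by (auto simp: y_def)
  have A: "0 \<le> A" using \<eta> by (simp add: A_def)
  \<comment> \<open>The rate 6 is admissible because \<open>s + 1 \<le> 6\<close>.\<close>
  define b where "b i = (binom_growth s i * (1 + 6 * (1 - q)) ^ i) powr (1 / 16)" for i
  have tail: "1 - level_cdf q k i \<le> b i * \<eta> ^ k" for k i
    unfolding b_def \<eta>(1) using q s by (intro level_tail_rooted) auto
  let ?L = "laplace q M \<eta>"
  have L: "0 \<le> ?L j" "?L j \<le> 1" for j
    using \<eta> q by (auto intro!: laplace_nonneg laplace_le_1)
  define v where "v n = A + A / (1 - \<eta>) * (1 - ?L n)" for n
  have v: "0 \<le> v j" for j unfolding v_def using A L[of j] \<eta> by (intro add_nonneg_nonneg mult_nonneg_nonneg) auto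
  let ?P = "\<lambda>k n. spine_exp q M n (\<lambda>t. of_bool (k < t + U)) :: real"
  have "0 \<le> ?P k n" for k n by (rule Bochner_Integration.integral_nonneg) simp
  moreover have "?P k n \<le> 1" for k n by (rule measure_pmf.integral_le_const) auto
  ultimately have P: "0 \<le> ?P k n" "?P k n \<le> 1" for k n by blast+
  show ?case
  proof (cases "M < n")
    case False
    show ?thesis
    proof (cases "k < U")
      case True
      have "?P k n = 1" using False q True by (simp add: spine_exp_small)
      then show ?thesis using level_cdf_nonneg[OF q(1), of k n] v[of n] by (simp add: v_def)
    next
      case k: False
      have n: "real n * y \<le> 1 + y"
      proof -
        have "real n \<le> 1 / y + 1" using M False by (simp add: y_def)
        then have "real n * y \<le> (1 / y + 1) * y" using y by (intro mult_right_mono) auto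
        then show ?thesis using y by (simp add: algebra_simps)
      qed
      have "1 - level_cdf q k n \<le> b n * \<eta> ^ U"
      proof -
        have "b n * \<eta> ^ k \<le> b n * \<eta> ^ U"
          using k \<eta> by (intro mult_left_mono power_decreasing) (auto simp: b_def)
        then show ?thesis using tail[of k n] by linarith
      qed
      also have "b n \<le> (1 / y) powr (s / 16) * (1 + (real n + 1) * y) * (1 + 3 * y / 8) ^ n"
        unfolding b_def y_def[symmetric] by (rule rooted_growth_le[OF y s])
      also have "\<dots> \<le> (1 / y) powr (s / 16) * 4 * 4"
      proof (intro mult_mono order_refl)
        show "1 + (real n + 1) * y \<le> 4" using n y by (simp add: algebra_simps)
        have "(1 + 3 * y / 8) ^ n \<le> exp (3 * y / 8) ^ n"
          using y exp_ge_add_one_self[of "3 * y / 8"] by (intro power_mono) auto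
        also have "\<dots> = exp (3 / 8 * (real n * y))" by (simp add: algebra_simps flip: exp_of_nat_mult)
        also have "\<dots> \<le> exp 1" using n y by simp
        also have "\<dots> \<le> 4" using exp_le by simp
        finally show "(1 + 3 * y / 8) ^ n \<le> 4" .
      qed (use y in auto)
      finally have "1 - level_cdf q k n \<le> A" using \<eta> by (simp add: A_def y_def mult_right_mono)
      moreover have "?P k n = 0" using False q k by (simp add: spine_exp_small)
      moreover have "0 \<le> A / (1 - \<eta>) * (1 - ?L n)" using A L[of n] \<eta> by simp
      ultimately show ?thesis by simp
    qed
  next
    case n: True
    have Qpos: "0 < q_number q n" using n q by (intro q_number_pos) auto
    show ?thesis
    proof (cases k)
      case 0
      have "q_number q n * ?P 0 n = q_number q n * 1"
        by (subst spine_exp_step[OF q(1) n]) (simp add: q_number_def)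
      then have "?P 0 n = 1" using Qpos by simp
      then show ?thesis using 0 level_cdf_nonneg[OF q(1), of k n] v[of n] by (simp add: v_def)
    next
      case (Suc k')
      have point: "1 - level_cdf q k' i * level_cdf q k' j \<le> ?P k' j + v j + b i * \<eta> ^ U * ?L j"
        if "j < n" for i j
      proof -
        let ?F = "level_cdf q k' i" and ?F' = "level_cdf q k' j"
        have F: "0 \<le> ?F" "?F \<le> 1" by (rule level_cdf_nonneg[OF q(1)] level_cdf_le_1[OF q(1)])+
        have IH: "1 - ?F' \<le> ?P k' j + v j" using less[OF that] by (simp add: v_def)
        have "1 - ?F * ?F' = (1 - ?F) + ?F * (1 - ?F')" by (simp add: algebra_simps)
        also have "\<dots> \<le> (1 - ?F) + ?F * (?P k' j + v j)"
          by (intro add_left_mono mult_left_mono IH F)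
        also have "\<dots> = ?P k' j + (1 - ?F) * (1 - ?P k' j) + ?F * v j" by (simp add: algebra_simps)
        also have "\<dots> \<le> ?P k' j + (1 - ?F) * (1 - ?P k' j) + v j"
          using F v[of j] by (simp add: mult_left_le_one_le)
        also have "(1 - ?F) * (1 - ?P k' j) \<le> b i * (\<eta> ^ k' * (1 - ?P k' j))"
          using tail[of k' i] P[of j k'] mult_right_mono[of "1 - ?F" "b i * \<eta> ^ k'" "1 - ?P k' j"]
          by (simp add: mult.assoc)
        also have "\<eta> ^ k' * (1 - ?P k' j) \<le> \<eta> ^ U * ?L j"
        proof -
          have "1 - ?P k' j = spine_exp q M j (\<lambda>t. 1 - of_bool (k' < t + U))"
            by (subst Bochner_Integration.integral_diff) auto
          then have "\<eta> ^ k' * (1 - ?P k' j) = spine_exp q M j (\<lambda>t. \<eta> ^ k' * (1 - of_bool (k' < t + U)))"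
            by simp
          also have "\<dots> \<le> spine_exp q M j (\<lambda>t. \<eta> ^ U * \<eta> ^ t)"
          proof (intro integral_mono)
            fix t
            show "\<eta> ^ k' * (1 - of_bool (k' < t + U)) \<le> \<eta> ^ U * \<eta> ^ t"
              using \<eta> power_decreasing[of "U + t" k' \<eta>] by (auto simp: power_add)
          qed auto
          finally show ?thesis by simp
        qed
        finally show ?thesis by (simp add: mult_left_mono b_def mult.assoc)
      qed
      have "q_number q n * (1 - level_cdf q k n)
          = (\<Sum>i<n. q ^ i * (1 - level_cdf q k' i * level_cdf q k' (n - 1 - i)))"
        unfolding Suc using level_cdf_Suc[of q n k'] n q
        by (simp add: right_diff_distrib sum_subtractf q_number_def)
      also have "\<dots> \<le> (\<Sum>i<n. q ^ i * (?P k' (n - 1 - i) + v (n - 1 - i) + b i * \<eta> ^ U * ?L (n - 1 - i)))"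
        using q by (intro sum_mono mult_left_mono point) auto
      also have "\<dots> = (\<Sum>i<n. q ^ i * ?P k' (n - 1 - i)) + (\<Sum>i<n. q ^ i * v (n - 1 - i))
          + \<eta> ^ U * (\<Sum>i<n. q ^ i * b i * ?L (n - 1 - i))"
        by (simp add: sum.distrib[symmetric] sum_distrib_left algebra_simps)
      also have "(\<Sum>i<n. q ^ i * ?P k' (n - 1 - i)) = q_number q n * ?P k n"
        unfolding Suc by (subst spine_exp_step[OF q(1) n]) simp
      also have "(\<Sum>i<n. q ^ i * v (n - 1 - i)) =
          A * q_number q n + A / (1 - \<eta>) * (q_number q n - (\<Sum>i<n. q ^ i * ?L (n - 1 - i)))"
        by (simp add: v_def q_number_def sum_distrib_left sum_subtractf sum.distrib sum_divide_distrib algebra_simps)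
      also have "(\<Sum>i<n. q ^ i * ?L (n - 1 - i)) = q_number q n * ?L n / \<eta>"
        using \<eta>(2) by (subst spine_exp_step[OF q(1) n]) (simp add: sum_divide_distrib)
      also have "\<eta> ^ U * (\<Sum>i<n. q ^ i * b i * ?L (n - 1 - i)) \<le> \<eta> ^ U * (16 * (1 / (1 - q)) powr (s / 16) * (q_number q n * ?L n / \<eta>))"
      proof (intro mult_left_mono)
        have "(\<Sum>i<n. q ^ i * ?L (n - 1 - i)) = q_number q n * ?L n / \<eta>"
          using \<eta>(2) by (subst spine_exp_step[OF q(1) n]) (simp add: sum_divide_distrib)
        then show "(\<Sum>i<n. q ^ i * b i * ?L (n - 1 - i)) \<le> 16 * (1 / (1 - q)) powr (s / 16) * (q_number q n * ?L n / \<eta>)"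
          unfolding b_def using weighted_growth_le[OF q M(1) s \<eta>(2) _ n] \<eta>(3) by simp
      qed (use \<eta> in auto)
      also have "\<eta> ^ U * (16 * (1 / (1 - q)) powr (s / 16) * (q_number q n * ?L n / \<eta>)) = q_number q n * (A * ?L n / \<eta>)"
        by (simp add: A_def)
      also have "q_number q n * ?P k n + (A * q_number q n + A / (1 - \<eta>) * (q_number q n - q_number q n * ?L n / \<eta>))
          + q_number q n * (A * ?L n / \<eta>) = q_number q n * (?P k n + v n)"
      proof -
        have "1 - \<eta> \<noteq> 0" "\<eta> \<noteq> 0" using \<eta> by auto
        then show ?thesis unfolding v_def by (simp add: field_simps)
      qed
      finally show ?thesis using Qpos unfolding v_def by simp
    qed
  qed
qed

theorem level_tail_upper:
  "\<exists>C>0. \<exists>\<theta>>0. \<forall>q\<in>{0..<1}. \<forall>M U k n :: nat. 1 / (1 - q) \<le> real M \<longrightarrow> real M \<le> 1 / (1 - q) + 1 \<longrightarrow>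
     1 - level_cdf q k n \<le> spine_exp q M n (\<lambda>t. of_bool (k < t + U))
       + C * exp (- \<theta> * (real U - c_star * ln (1 / (1 - q))))"
proof -
  define s where "s = c_star - 1"
  have s: "1 \<le> s" "s \<le> 5" using c_star_ge_2 c_star_le_6 by (auto simp: s_def)
  define \<theta> where "\<theta> = s / c_star / 16"
  have \<theta>: "0 < \<theta>" "\<theta> \<le> 1 / 16" using s c_star_ge_2 by (auto simp: \<theta>_def s_def field_simps)
  define \<eta> where "\<eta> = exp (- \<theta>)"
  have \<eta>_eq: "\<eta> = (2 / (s + 1)) powr (1 / 16)"
  proof -
    have "ln (2 / (s + 1)) = - (s / c_star)"
      using ln_half_c_star c_star_ge_2 by (simp add: s_def ln_div)
    then show ?thesis using s by (simp add: powr_def \<eta>_def \<theta>_def)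
  qed
  have \<eta>: "15 / 16 \<le> \<eta>" "\<eta> < 1"
    using \<theta> exp_ge_add_one_self[of "- \<theta>"] by (auto simp: \<eta>_def)
  define C where "C = 16 * (1 + 1 / (1 - \<eta>))"
  have C: "0 < C" using \<eta> by (simp add: C_def add_pos_pos)
  show ?thesis
  proof (rule exI[of _ C], rule conjI[OF C], rule exI[of _ \<theta>], rule conjI[OF \<theta>(1)],
      intro ballI allI impI)
    fix q :: real and M U k n :: nat
    assume q: "q \<in> {0..<1}" and M: "1 / (1 - q) \<le> real M" "real M \<le> 1 / (1 - q) + 1"
    define A where "A = 16 * (1 / (1 - q)) powr (s / 16) * \<eta> ^ U"
    have A: "0 \<le> A" using \<eta> by (simp add: A_def)
    have "1 - level_cdf q k n \<le> spine_exp q M n (\<lambda>t. of_bool (k < t + U)) + (A + A / (1 - \<eta>) * (1 - laplace q M \<eta> n))"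
      unfolding A_def using level_tail_le_spine[OF _ _ M s \<eta>_eq \<eta>, of k n U] q by simp
    also have "A / (1 - \<eta>) * (1 - laplace q M \<eta> n) \<le> A / (1 - \<eta>) * 1"
      using A \<eta> by (intro mult_left_mono) (auto intro!: laplace_nonneg)
    also have "A + A / (1 - \<eta>) * 1 = C * (A / 16)" by (simp add: C_def algebra_simps)
    also have "A / 16 = exp (- \<theta> * (real U - c_star * ln (1 / (1 - q))))"
    proof -
      have "\<eta> ^ U = exp (- \<theta> * real U)" by (simp add: \<eta>_def mult.commute flip: exp_of_nat_mult)
      moreover have "(1 / (1 - q)) powr (s / 16) = exp (\<theta> * (c_star * ln (1 / (1 - q))))"
        using q c_star_ge_2 by (simp add: powr_def \<theta>_def)
      ultimately show ?thesis by (simp add: A_def algebra_simps flip: exp_add)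
    qed
    finally show "1 - level_cdf q k n \<le> spine_exp q M n (\<lambda>t. of_bool (k < t + U))
       + C * exp (- \<theta> * (real U - c_star * ln (1 / (1 - q))))" by simp
  qed
qed

section \<open>A lower bound below the spine: critical subsolutions\<close>

lemma level_cdf_mono: "0 \<le> q \<Longrightarrow> j \<le> k \<Longrightarrow> level_cdf q j n \<le> level_cdf q k n"
  by (rule lift_Suc_mono_le[of "\<lambda>k. level_cdf q k n"]) (auto intro: level_cdf_mono_Suc)

lemma power_ge_one_minus: "0 \<le> q \<Longrightarrow> q \<le> 1 \<Longrightarrow> 1 - real n * (1 - q) \<le> q ^ n"
  using Bernoulli_inequality[of "q - 1" n] by (simp add: algebra_simps)

text \<open>
  A multiple \<open>\<delta> a\<close> of a bounded subsolution of the linear recursion is almost a subsolution of the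
  nonlinear one: the discrepancy is the product of the two subtrees' terms, and
  \<open>\<delta> a i * \<delta> a j \<le> \<delta> A * \<delta> a j\<close>. The loss per level is thus a factor \<open>1 - \<delta> A\<close>, together
  with \<open>1 - N (1 - q)\<close> for replacing the true split by a uniform one on sizes up to \<open>N\<close>.
\<close>

lemma level_tail_ge_subsolution:
  fixes a :: "nat \<Rightarrow> nat \<Rightarrow> real"
  assumes q: "0 \<le> q" "q \<le> 1"
    and a: "\<And>k n. 0 \<le> a k n" "\<And>k n. a k n \<le> A" "\<And>k. a k 0 = 0"
    and lin: "\<And>k n. real n * a (Suc k) n \<le> 2 * (\<Sum>i<n. a k i)"
    and \<delta>: "0 \<le> \<delta>" "\<delta> * A + real N * (1 - q) \<le> \<epsilon>" "\<epsilon> \<le> 1" and n: "n \<le> N"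
  shows "\<delta> * (1 - \<epsilon>) ^ k * a k n \<le> 1 - level_cdf q k n"
  using n
proof (induction k arbitrary: n)
  have A: "0 \<le> A" using a(1)[of 0 0] a(2)[of 0 0] by linarith
  have \<delta>A: "0 \<le> \<delta> * A" "\<delta> * A \<le> 1" "0 \<le> real N * (1 - q)" "real N * (1 - q) \<le> 1"
  proof -
    show "0 \<le> \<delta> * A" "0 \<le> real N * (1 - q)" using \<delta> A q by auto
    then show "\<delta> * A \<le> 1" "real N * (1 - q) \<le> 1" using \<delta> by linarith+
  qed
  {
    case 0
    have "\<delta> * a 0 n \<le> \<delta> * A" using a \<delta> by (intro mult_left_mono) auto
    then show ?case using \<delta>A a by auto
  next
    case (Suc k)
    show ?case
    proof (cases "n = 0")
      case True
      then show ?thesis using a by simp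
    next
      case False
      define d where "d = \<delta> * (1 - \<epsilon>) ^ k"
      have "0 \<le> \<epsilon>" using \<delta> \<delta>A by linarith
      then have d: "0 \<le> d" "d \<le> \<delta>" using \<delta> by (auto simp: d_def intro!: mult_right_le_one_le power_le_one)
      have Q: "0 < q_number q n" using False q by (intro q_number_pos) auto
      have dA: "d * a k i \<le> \<delta> * A" for i using d a A by (intro mult_mono) auto
      have pair: "d * (1 - \<delta> * A) * (a k i + a k j) \<le> 1 - level_cdf q k i * level_cdf q k j"
        if "i < n" "j < n" for i j
      proof -
        have "level_cdf q k i \<le> 1 - d * a k i" "level_cdf q k j \<le> 1 - d * a k j"
          using Suc.IH[of i] Suc.IH[of j] Suc.prems that by (auto simp: d_def)
        then have "level_cdf q k i * level_cdf q k j \<le> (1 - d * a k i) * (1 - d * a k j)"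
          using level_cdf_nonneg[OF q(1)] dA[of i] \<delta>A by (intro mult_mono) auto
        also have "\<dots> = 1 - d * (a k i + a k j) + (d * a k i) * (d * a k j)" by (simp add: algebra_simps)
        also have "(d * a k i) * (d * a k j) \<le> (\<delta> * A) * (d * a k j)"
          using dA a d by (intro mult_right_mono) auto
        also have "\<dots> \<le> (\<delta> * A) * (d * (a k i + a k j))"
          using \<delta>A a d by (intro mult_left_mono) auto
        finally show ?thesis by (simp add: algebra_simps)
      qed
      have "real n * (d * (1 - \<delta> * A) * q ^ n * a (Suc k) n) = d * (1 - \<delta> * A) * q ^ n * (real n * a (Suc k) n)"
        by simp
      also have "\<dots> \<le> d * (1 - \<delta> * A) * q ^ n * (2 * (\<Sum>i<n. a k i))"
        using d \<delta>A q by (intro mult_left_mono lin) auto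
      also have "2 * (\<Sum>i<n. a k i) = (\<Sum>i<n. a k i + a k (n - 1 - i))"
      proof -
        have "(\<Sum>i<n. a k i) = (\<Sum>i<n. a k (n - 1 - i))"
          by (subst sum.nat_diff_reindex[symmetric]) simp
        then show ?thesis by (simp add: sum.distrib)
      qed
      also have "d * (1 - \<delta> * A) * q ^ n * \<dots> = (\<Sum>i<n. q ^ n * (d * (1 - \<delta> * A) * (a k i + a k (n - 1 - i))))"
        by (simp add: sum_distrib_left mult_ac)
      also have "\<dots> \<le> (\<Sum>i<n. q ^ i * (1 - level_cdf q k i * level_cdf q k (n - 1 - i)))"
        using q d \<delta>A a by (intro sum_mono mult_mono pair power_decreasing) auto
      also have "\<dots> = q_number q n * (1 - level_cdf q (Suc k) n)"
        using level_cdf_Suc[of q n k] False q by (simp add: right_diff_distrib sum_subtractf q_number_def)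
      also have "\<dots> \<le> real n * (1 - level_cdf q (Suc k) n)"
        using level_cdf_le_1[OF q(1)] by (intro mult_right_mono q_number_le q) auto
      finally have main: "d * (1 - \<delta> * A) * q ^ n * a (Suc k) n \<le> 1 - level_cdf q (Suc k) n"
        using False by simp
      have "real n * (1 - q) \<le> real N * (1 - q)" using Suc.prems q by (intro mult_right_mono) auto
      then have "1 - real N * (1 - q) \<le> q ^ n" using power_ge_one_minus[OF q, of n] by linarith
      then have "(1 - \<delta> * A) * (1 - real N * (1 - q)) \<le> (1 - \<delta> * A) * q ^ n"
        using \<delta>A by (intro mult_left_mono) auto
      moreover have "1 - \<delta> * A - real N * (1 - q) \<le> (1 - \<delta> * A) * (1 - real N * (1 - q))"
      proof -
        have "1 - u - v \<le> (1 - u) * (1 - v)" if "0 \<le> u * v" for u v :: real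
          using that by (simp add: algebra_simps)
        then show ?thesis using \<delta>A by simp
      qed
      ultimately have "1 - \<epsilon> \<le> (1 - \<delta> * A) * q ^ n" using \<delta> by linarith
      then have "d * a (Suc k) n * (1 - \<epsilon>) \<le> d * a (Suc k) n * ((1 - \<delta> * A) * q ^ n)"
        using d a by (intro mult_left_mono) auto
      then show ?thesis using main by (simp add: d_def mult_ac)
    qed
  }
qed

text \<open>
  The substitute for \<open>ln n\<close> for which the ratios \<open>binom_growth (s + h) n / binom_growth s n\<close> have
  simple exponential bounds.
\<close>

primrec shifted_harmonic :: "real \<Rightarrow> nat \<Rightarrow> real" where
  "shifted_harmonic s 0 = 0"
| "shifted_harmonic s (Suc n) = shifted_harmonic s n + 1 / (real (Suc n) + s)"

lemma shifted_harmonic_le_ln: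
  assumes "1 \<le> s"
  shows "shifted_harmonic s n \<le> ln (real n + 1)"
proof (induction n)
  case (Suc n)
  let ?x = "real n + 2"
  have "ln ((real n + 1) / ?x) \<le> (real n + 1) / ?x - 1" by (rule ln_le_minus_one) auto
  also have "\<dots> = - (1 / ?x)" by (simp add: field_simps)
  finally have "1 / ?x \<le> ln ?x - ln (real n + 1)" by (simp add: ln_div)
  moreover have "1 / (real (Suc n) + s) \<le> 1 / ?x" using assms by (intro divide_left_mono) auto
  ultimately show ?case using Suc by (simp add: add.commute)
qed simp

lemma shifted_harmonic_ge_ln:
  assumes "0 \<le> s"
  shows "ln (real n + 1) - s \<le> shifted_harmonic s n"
proof -
  have "ln (real n + 1 + s) - ln (1 + s) \<le> shifted_harmonic s n"
  proof (induction n)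
    case (Suc n)
    let ?x = "real n + 1 + s"
    have x: "0 < ?x" using assms by simp
    have "ln ((?x + 1) / ?x) \<le> (?x + 1) / ?x - 1" using x by (intro ln_le_minus_one) auto
    also have "\<dots> = 1 / ?x" using x by (simp add: field_simps)
    finally have "ln (?x + 1) - ln ?x \<le> 1 / ?x" using x by (simp add: ln_div)
    then show ?case using Suc by (simp add: algebra_simps)
  qed simp
  moreover have "ln (real n + 1) \<le> ln (real n + 1 + s)" using assms by simp
  moreover have "ln (1 + s) \<le> s" using ln_le_minus_one[of "1 + s"] assms by simp
  ultimately show ?thesis by linarith
qed

lemma shift_factor:
  fixes a s h :: real
  assumes "0 < a" "0 < a + s"
  shows "1 + (s + h) / a = (1 + s / a) * (1 + h / (a + s))"
proof -
  have "1 + s / a = (a + s) / a" "1 + h / (a + s) = (a + s + h) / (a + s)"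
    using assms by (simp_all add: add_divide_distrib)
  moreover have "1 + (s + h) / a = (a + s + h) / a"
    using assms by (simp add: add_divide_distrib)
  ultimately show ?thesis using assms by simp
qed

lemma ratio_factor:
  fixes c h :: real
  assumes "0 < c"
  shows "2 / (c + h) = 2 / c * (1 / (1 + h / c))"
proof -
  have "1 + h / c = (c + h) / c" using assms by (simp add: add_divide_distrib)
  then show ?thesis using assms by simp
qed

text \<open>
  The second order terms in the bounds below telescope.
\<close>

lemma inverse_shift_square_le:
  assumes "1 \<le> s"
  shows "1 / ((real (Suc n) + s) * real (Suc n)) \<le> 1 / (real n + 1) - 1 / (real n + 2)"
proof -
  have "1 / (real n + 1) - 1 / (real n + 2) = 1 / ((real n + 2) * real (Suc n))" by (simp add: field_simps)
  moreover have "(real n + 2) * real (Suc n) \<le> (real (Suc n) + s) * real (Suc n)"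
    using assms by (intro mult_right_mono) auto
  ultimately show ?thesis by (auto intro!: divide_left_mono mult_pos_pos)
qed

lemma binom_growth_ge_exp:
  assumes "0 \<le> s"
  shows "exp (s * shifted_harmonic s n) \<le> binom_growth s n"
proof (induction n)
  case (Suc n)
  let ?x = "s / (real (Suc n) + s)"
  have "1 - ?x \<le> exp (- ?x)" using exp_ge_add_one_self[of "- ?x"] by simp
  then have "exp ?x * (1 - ?x) \<le> exp ?x * exp (- ?x)" by (intro mult_left_mono) auto
  also have "\<dots> = 1" by (simp flip: exp_add)
  also have "1 - ?x = real (Suc n) / (real (Suc n) + s)"
    using assms by (simp add: diff_divide_eq_iff)
  finally have "exp ?x \<le> 1 / (real (Suc n) / (real (Suc n) + s))"
    using assms by (subst pos_le_divide_eq) auto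
  also have "\<dots> = 1 + s / real (Suc n)"
  proof -
    have "1 / (a / (a + s)) = 1 + s / a" if "0 < a" for a :: real
      using that by (simp add: add_divide_distrib)
    from this[of "real (Suc n)"] show ?thesis by simp
  qed
  finally have "exp (s * shifted_harmonic s n) * exp ?x \<le> binom_growth s n * (1 + s / real (Suc n))"
    using Suc assms by (intro mult_mono) (auto intro: order_trans[OF _ Suc])
  then show ?case by (simp add: distrib_left flip: exp_add)
qed simp

lemma binom_growth_le_exp:
  assumes "1 \<le> s"
  shows "binom_growth s n \<le> exp (s * shifted_harmonic s n + s\<^sup>2 * (1 - 1 / (real n + 1)))"
proof (induction n)
  case (Suc n)
  have pos: "0 < binom_growth s n" using assms by (intro binom_growth_pos) auto
  have "s / real (Suc n) = s / (real (Suc n) + s) + s\<^sup>2 * (1 / ((real (Suc n) + s) * real (Suc n)))"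
  proof -
    have "s / a = s / (a + s) + s\<^sup>2 * (1 / ((a + s) * a))" if "0 < a" "0 < a + s" for a :: real
    proof -
      have "s / a = s * (a + s) / ((a + s) * a)" using that by simp
      also have "\<dots> = s * a / ((a + s) * a) + s\<^sup>2 / ((a + s) * a)"
        by (simp add: distrib_left add_divide_distrib power2_eq_square)
      finally show ?thesis using that by simp
    qed
    from this[of "real (Suc n)"] show ?thesis using assms by simp
  qed
  also have "\<dots> \<le> s / (real (Suc n) + s) + s\<^sup>2 * (1 / (real n + 1) - 1 / (real n + 2))"
    by (intro add_left_mono mult_left_mono inverse_shift_square_le assms) auto
  finally have "s / real (Suc n) \<le> \<dots>" .
  then have "1 + s / real (Suc n) \<le> exp (s / (real (Suc n) + s) + s\<^sup>2 * (1 / (real n + 1) - 1 / (real n + 2)))"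
    using exp_ge_add_one_self[of "s / real (Suc n)"] by (meson exp_le_cancel_iff order_trans)
  then have "binom_growth s (Suc n) \<le> exp (s * shifted_harmonic s n + s\<^sup>2 * (1 - 1 / (real n + 1))) *
      exp (s / (real (Suc n) + s) + s\<^sup>2 * (1 / (real n + 1) - 1 / (real n + 2)))"
    unfolding binom_growth.simps using Suc pos assms by (intro mult_mono) auto
  also have "\<dots> = exp (s * shifted_harmonic s (Suc n) + s\<^sup>2 * (1 - 1 / (real (Suc n) + 1)))"
    by (simp add: algebra_simps flip: exp_add)
  finally show ?case .
qed simp

lemma growth_ratio_up:
  assumes s: "1 \<le> s" and h: "0 \<le> h" "h \<le> 1"
  shows "binom_growth s n * exp (h * shifted_harmonic s n - h\<^sup>2 * (1 - 1 / (real n + 1))) \<le> binom_growth (s + h) n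
    \<and> binom_growth (s + h) n \<le> binom_growth s n * exp (h * shifted_harmonic s n)"
proof (induction n)
  case (Suc n)
  let ?x = "h / (real (Suc n) + s)" and ?f = "1 + s / real (Suc n)"
  have f: "0 < ?f" using s by (simp add: add_pos_nonneg)
  have g: "0 < binom_growth s n" "0 < binom_growth (s + h) n" using s h by (auto intro!: binom_growth_pos)
  have fac: "1 + (s + h) / real (Suc n) = ?f * (1 + ?x)" using s by (intro shift_factor) auto
  have x: "0 \<le> ?x" "?x \<le> 1" using s h by (auto simp: field_simps)
  have "?x\<^sup>2 \<le> h\<^sup>2 * (1 / ((real (Suc n) + s) * real (Suc n)))"
    using s h by (simp add: power_divide power2_eq_square) (intro divide_left_mono mult_left_mono mult_pos_pos; simp)
  also have "\<dots> \<le> h\<^sup>2 * (1 / (real n + 1) - 1 / (real n + 2))"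
    by (intro mult_left_mono inverse_shift_square_le s) auto
  finally have sq: "?x\<^sup>2 \<le> \<dots>" .
  have "?x - ?x\<^sup>2 \<le> ln (1 + ?x)" using x by (rule ln_one_plus_pos_lower_bound)
  then have "exp (?x - h\<^sup>2 * (1 / (real n + 1) - 1 / (real n + 2))) \<le> exp (ln (1 + ?x))"
    using sq by simp
  also have "exp (ln (1 + ?x)) = 1 + ?x" by (rule exp_ln) (use x in linarith)
  finally have lo: "exp (?x - h\<^sup>2 * (1 / (real n + 1) - 1 / (real n + 2))) \<le> 1 + ?x" .
  have up: "1 + ?x \<le> exp ?x" by (rule exp_ge_add_one_self)
  have "binom_growth s (Suc n) * exp (h * shifted_harmonic s (Suc n) - h\<^sup>2 * (1 - 1 / (real (Suc n) + 1)))
     = (binom_growth s n * exp (h * shifted_harmonic s n - h\<^sup>2 * (1 - 1 / (real n + 1)))) *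
       (?f * exp (?x - h\<^sup>2 * (1 / (real n + 1) - 1 / (real n + 2))))"
    by (simp add: algebra_simps flip: exp_add)
  also have "\<dots> \<le> binom_growth (s + h) n * (?f * (1 + ?x))"
    using Suc f g lo by (intro mult_mono) auto
  finally have 1: "binom_growth s (Suc n) * exp (h * shifted_harmonic s (Suc n) - h\<^sup>2 * (1 - 1 / (real (Suc n) + 1)))
    \<le> binom_growth (s + h) (Suc n)" unfolding binom_growth.simps fac .
  have "binom_growth (s + h) (Suc n) = binom_growth (s + h) n * (?f * (1 + ?x))"
    unfolding binom_growth.simps fac ..
  also have "\<dots> \<le> (binom_growth s n * exp (h * shifted_harmonic s n)) * (?f * exp ?x)"
    using Suc f g up x by (intro mult_mono) auto
  also have "\<dots> = binom_growth s (Suc n) * exp (h * shifted_harmonic s (Suc n))"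
    by (simp add: algebra_simps flip: exp_add)
  finally show ?case using 1 by blast
qed simp

lemma growth_ratio_down:
  assumes s: "1 \<le> s" and h: "0 \<le> h" "h \<le> 1"
  shows "binom_growth (s - h) n \<le> binom_growth s n * exp (- (h * shifted_harmonic s n))"
proof (induction n)
  case (Suc n)
  let ?x = "h / (real (Suc n) + s)" and ?f = "1 + s / real (Suc n)"
  have f: "0 < ?f" using s by (simp add: add_pos_nonneg)
  have g: "0 < binom_growth s n" "0 < binom_growth (s - h) n" using s h by (auto intro!: binom_growth_pos)
  have fac: "1 + (s - h) / real (Suc n) = ?f * (1 - ?x)"
    using shift_factor[of "real (Suc n)" s "- h"] s by simp
  have x: "0 \<le> ?x" "?x \<le> 1" using s h by (auto simp: field_simps)
  have "binom_growth (s - h) (Suc n) = binom_growth (s - h) n * (?f * (1 - ?x))"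
    unfolding binom_growth.simps fac ..
  also have "\<dots> \<le> (binom_growth s n * exp (- (h * shifted_harmonic s n))) * (?f * exp (- ?x))"
    using Suc f g x exp_ge_add_one_self[of "- ?x"] by (intro mult_mono) auto
  also have "\<dots> = binom_growth s (Suc n) * exp (- (h * shifted_harmonic s (Suc n)))"
    by (simp add: algebra_simps flip: exp_add)
  finally show ?case .
qed simp

text \<open>
  The exponent at which the solution \<open>level_weight\<close> of the linear recursion is stationary along a ray
  \<open>ln n = k / v\<close>: for this exponent \<open>v\<close> is \<open>c*\<close>, and the derivative of \<open>v\<close> with respect to
  the exponent vanishes.
\<close>

definition critical_exponent :: real where "critical_exponent = c_star - 1"

abbreviation (input) "sc \<equiv> critical_exponent"

lemma sc_bounds: "1 \<le> sc" "sc \<le> 5" "sc + 1 = c_star"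
  using c_star_ge_2 c_star_le_6 by (auto simp: critical_exponent_def)

text \<open>
  For every exponent \<open>t\<close> an exact solution of the linearised recursion for uniform splits.
\<close>

definition level_weight :: "real \<Rightarrow> nat \<Rightarrow> nat \<Rightarrow> real" where
  "level_weight t k n = binom_growth t n * (2 / (t + 1)) ^ k"

lemma level_weight_step:
  assumes "-1 < t"
  shows "real n * level_weight t (Suc k) n = 2 * (\<Sum>i<n. level_weight t k i)"
proof -
  have "real n * level_weight t (Suc k) n = (real n * binom_growth t n) * (2 / (t + 1)) * (2 / (t + 1)) ^ k"
    by (simp add: level_weight_def)
  also have "real n * binom_growth t n = (t + 1) * (\<Sum>i<n. binom_growth t i)"
    by (rule sum_binom_growth[symmetric])
  also have "(t + 1) * (\<Sum>i<n. binom_growth t i) * (2 / (t + 1)) = 2 * (\<Sum>i<n. binom_growth t i)"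
    using assms by simp
  finally show ?thesis by (simp add: level_weight_def sum_distrib_right mult.assoc)
qed

lemma level_weight_pos: "-1 < t \<Longrightarrow> 0 < level_weight t k n"
  by (auto simp: level_weight_def intro!: mult_pos_pos binom_growth_pos)

text \<open>
  How far the logarithm of the size \<open>n\<close> lies above the critical ray when \<open>k\<close> levels are still wanted.
\<close>

definition excess :: "nat \<Rightarrow> nat \<Rightarrow> real" where
  "excess k n = shifted_harmonic sc n - real k / c_star"

lemma critical_ratio_power: "(2 / (sc + 1)) ^ k = exp (- (sc * (real k / c_star)))"
proof -
  have "2 / (sc + 1) = exp (- (sc / c_star))"
    unfolding sc_bounds(3) critical_exponent_def ln_half_c_star[symmetric]
    using c_star_ge_2 by (simp add: exp_minus)
  then show ?thesis by (simp add: mult.commute flip: exp_of_nat_mult)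
qed

lemma critical_weight_bounds:
  "exp (sc * excess k n) \<le> level_weight sc k n" "level_weight sc k n \<le> exp (sc * excess k n + sc\<^sup>2)"
proof -
  have "exp (sc * excess k n) = exp (sc * shifted_harmonic sc n) * exp (- (sc * (real k / c_star)))"
    by (simp add: excess_def algebra_simps flip: exp_add)
  also have "\<dots> \<le> level_weight sc k n"
    unfolding level_weight_def critical_ratio_power using sc_bounds
    by (intro mult_right_mono binom_growth_ge_exp) auto
  finally show "exp (sc * excess k n) \<le> level_weight sc k n" .
  have "level_weight sc k n \<le> exp (sc * shifted_harmonic sc n + sc\<^sup>2 * (1 - 1 / (real n + 1))) * exp (- (sc * (real k / c_star)))"
    unfolding level_weight_def critical_ratio_power using sc_bounds
    by (intro mult_right_mono binom_growth_le_exp) auto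
  also have "\<dots> \<le> exp (sc * shifted_harmonic sc n + sc\<^sup>2 * 1) * exp (- (sc * (real k / c_star)))"
    by (intro mult_right_mono) (auto intro!: mult_left_le)
  also have "\<dots> = exp (sc * excess k n + sc\<^sup>2)"
    by (simp add: excess_def algebra_simps flip: exp_add)
  finally show "level_weight sc k n \<le> exp (sc * excess k n + sc\<^sup>2)" .
qed

text \<open>
  Changing the exponent by \<open>h\<close> multiplies the solution by \<open>exp (h * excess)\<close> up to second order terms;
  there is no first order drift in \<open>k\<close> because the exponent is critical. The same holds downwards.
\<close>

lemma level_weight_up:
  assumes h: "0 \<le> h" "h \<le> 1"
  shows "level_weight sc k n * exp (h * excess k n - h\<^sup>2) \<le> level_weight (sc + h) k n"
    "level_weight (sc + h) k n \<le> level_weight sc k n * exp (h * excess k n + real k * h\<^sup>2)"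
proof -
  let ?x = "h / c_star"
  have x: "0 \<le> ?x" "?x \<le> 1" using h c_star_ge_2 by auto
  have r: "2 / (sc + h + 1) = 2 / (sc + 1) * (1 / (1 + ?x))"
    using ratio_factor[of c_star h] c_star_ge_2 unfolding critical_exponent_def by (simp add: algebra_simps)
  have up: "(1 / (1 + ?x)) ^ k \<le> exp (- (h * (real k / c_star)) + real k * h\<^sup>2)"
  proof -
    have "?x - ?x\<^sup>2 \<le> ln (1 + ?x)" using x by (rule ln_one_plus_pos_lower_bound)
    then have "exp (?x - ?x\<^sup>2) \<le> exp (ln (1 + ?x))" by simp
    then have "1 / (1 + ?x) \<le> 1 / exp (?x - ?x\<^sup>2)" using x by (intro divide_left_mono) auto
    also have "\<dots> = exp (?x\<^sup>2 - ?x)" by (simp add: exp_diff)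
    finally have "(1 / (1 + ?x)) ^ k \<le> exp (?x\<^sup>2 - ?x) ^ k" using x by (intro power_mono) auto
    also have "\<dots> = exp (- (h * (real k / c_star)) + real k * ?x\<^sup>2)" by (simp add: algebra_simps flip: exp_of_nat_mult)
    also have "?x\<^sup>2 \<le> h\<^sup>2" using h c_star_ge_2 divide_left_mono[of 1 c_star h] by (intro power_mono) auto
    finally show ?thesis by (simp add: mult_left_mono)
  qed
  have lo: "exp (- (h * (real k / c_star))) \<le> (1 / (1 + ?x)) ^ k"
  proof -
    have "exp (- ?x) \<le> 1 / (1 + ?x)"
      using x exp_ge_add_one_self[of ?x] by (simp add: exp_minus field_simps)
    then have "exp (- ?x) ^ k \<le> (1 / (1 + ?x)) ^ k" by (intro power_mono) auto
    then show ?thesis by (simp add: algebra_simps flip: exp_of_nat_mult)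
  qed
  have g: "0 < binom_growth sc n" using sc_bounds by (intro binom_growth_pos) auto
  have W: "level_weight (sc + h) k n = binom_growth (sc + h) n * (1 / (1 + ?x)) ^ k * (2 / (sc + 1)) ^ k"
    unfolding level_weight_def r power_mult_distrib by simp
  have rat: "binom_growth sc n * exp (h * shifted_harmonic sc n - h\<^sup>2) \<le> binom_growth (sc + h) n"
  proof -
    have "h\<^sup>2 * (1 - 1 / (real n + 1)) \<le> h\<^sup>2" by (intro mult_right_le_one_le) auto
    then have "binom_growth sc n * exp (h * shifted_harmonic sc n - h\<^sup>2) \<le>
      binom_growth sc n * exp (h * shifted_harmonic sc n - h\<^sup>2 * (1 - 1 / (real n + 1)))"
      using g by (intro mult_left_mono) auto
    then show ?thesis using growth_ratio_up[OF sc_bounds(1) h, of n] by linarith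
  qed
  have "level_weight sc k n * exp (h * excess k n - h\<^sup>2) =
    (binom_growth sc n * exp (h * shifted_harmonic sc n - h\<^sup>2)) * exp (- (h * (real k / c_star))) * (2 / (sc + 1)) ^ k"
    by (simp add: level_weight_def excess_def algebra_simps flip: exp_add)
  also have "\<dots> \<le> binom_growth (sc + h) n * (1 / (1 + ?x)) ^ k * (2 / (sc + 1)) ^ k"
    using rat lo less_imp_le[OF binom_growth_pos[of "sc + h" n]] h sc_bounds
    by (intro mult_right_mono mult_mono) auto
  finally show "level_weight sc k n * exp (h * excess k n - h\<^sup>2) \<le> level_weight (sc + h) k n" unfolding W .
  have "level_weight (sc + h) k n \<le> (binom_growth sc n * exp (h * shifted_harmonic sc n)) *
      exp (- (h * (real k / c_star)) + real k * h\<^sup>2) * (2 / (sc + 1)) ^ k"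
    unfolding W using growth_ratio_up[OF sc_bounds(1) h, of n] up g x sc_bounds
    by (intro mult_right_mono mult_mono) auto
  also have "\<dots> = level_weight sc k n * exp (h * excess k n + real k * h\<^sup>2)"
    by (simp add: level_weight_def excess_def algebra_simps flip: exp_add)
  finally show "level_weight (sc + h) k n \<le> level_weight sc k n * exp (h * excess k n + real k * h\<^sup>2)" .
qed

lemma level_weight_down:
  assumes h: "0 \<le> h" "h \<le> 1"
  shows "level_weight (sc - h) k n \<le> level_weight sc k n * exp (- (h * excess k n) + real k * h\<^sup>2)"
proof -
  let ?x = "h / c_star"
  have x: "0 \<le> ?x" "?x \<le> 1 / 2" using h c_star_ge_2 by (auto simp: field_simps)
  have r: "2 / (sc - h + 1) = 2 / (sc + 1) * (1 / (1 - ?x))"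
    using ratio_factor[of c_star "- h"] c_star_ge_2 unfolding critical_exponent_def by (simp add: algebra_simps)
  have up: "(1 / (1 - ?x)) ^ k \<le> exp (h * (real k / c_star) + real k * h\<^sup>2)"
  proof -
    have "- ?x - 2 * ?x\<^sup>2 \<le> ln (1 - ?x)" using x by (rule ln_one_minus_pos_lower_bound)
    then have "exp (- ?x - 2 * ?x\<^sup>2) \<le> exp (ln (1 - ?x))" by simp
    also have "exp (ln (1 - ?x)) = 1 - ?x" by (rule exp_ln) (use x in linarith)
    finally have "1 / (1 - ?x) \<le> 1 / exp (- ?x - 2 * ?x\<^sup>2)"
      using x by (intro divide_left_mono mult_pos_pos) (linarith | simp)+
    also have "\<dots> = exp (- (- ?x - 2 * ?x\<^sup>2))" by (simp only: exp_minus inverse_eq_divide)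
    also have "- (- ?x - 2 * ?x\<^sup>2) = ?x + 2 * ?x\<^sup>2" by simp
    finally have "1 / (1 - ?x) \<le> exp (?x + 2 * ?x\<^sup>2)" .
    moreover have "0 \<le> 1 / (1 - ?x)" by (rule divide_nonneg_nonneg) (use x in linarith)+
    ultimately have "(1 / (1 - ?x)) ^ k \<le> exp (?x + 2 * ?x\<^sup>2) ^ k" by (rule power_mono)
    also have "\<dots> = exp (h * (real k / c_star) + real k * (2 * ?x\<^sup>2))" by (simp add: algebra_simps flip: exp_of_nat_mult)
    also have "2 * ?x\<^sup>2 \<le> h\<^sup>2"
    proof -
      have "?x\<^sup>2 \<le> (h / 2)\<^sup>2"
        using h c_star_ge_2 by (intro power_mono divide_left_mono) auto
      also have "(h / 2)\<^sup>2 = h\<^sup>2 / 4" by (simp add: power_divide)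
      finally show ?thesis using zero_le_power2[of h] by linarith
    qed
    finally show ?thesis by (simp add: mult_left_mono)
  qed
  have g: "0 < binom_growth sc n" using sc_bounds by (intro binom_growth_pos) auto
  have "level_weight (sc - h) k n = binom_growth (sc - h) n * (1 / (1 - ?x)) ^ k * (2 / (sc + 1)) ^ k"
    unfolding level_weight_def r power_mult_distrib by simp
  also have "\<dots> \<le> (binom_growth sc n * exp (- (h * shifted_harmonic sc n))) *
      exp (h * (real k / c_star) + real k * h\<^sup>2) * (2 / (sc + 1)) ^ k"
    using growth_ratio_down[OF sc_bounds(1) h, of n] up g x sc_bounds
    by (intro mult_right_mono mult_mono) auto
  also have "\<dots> = level_weight sc k n * exp (- (h * excess k n) + real k * h\<^sup>2)"
    by (simp add: level_weight_def excess_def algebra_simps flip: exp_add)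
  finally show ?thesis .
qed

text \<open>
  In terms of \<open>y = excess k n\<close> the difference is roughly the critical solution times
  \<open>200 - exp (h y) - 200 exp (- h y)\<close>. It is positive only for \<open>y\<close> in a window of width \<open>O (1 / h)\<close>,
  so the positive part is bounded; and the positive part of a solution of a linear recursion with
  nonnegative coefficients is a subsolution. The factor 200 leaves room for \<open>exp 4 + 200 exp (- 1)\<close>
  on the range \<open>2 \<le> h y \<le> 3\<close>. Having the same factor at the third term makes
  the difference nonpositive at \<open>n = 0\<close>.
\<close>

definition windowed_weight :: "real \<Rightarrow> nat \<Rightarrow> nat \<Rightarrow> real" where
  "windowed_weight h k n =
     max 0 (200 * level_weight sc k n - level_weight (sc + h) k n - 200 * level_weight (sc - h) k n)"

lemma windowed_weight_nonneg: "0 \<le> windowed_weight h k n"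
  by (simp add: windowed_weight_def)

lemma windowed_weight_empty:
  assumes "0 \<le> h" "h \<le> 1"
  shows "windowed_weight h k 0 = 0"
proof -
  have "(2 / (sc + 1)) ^ k \<le> (2 / (sc - h + 1)) ^ k"
    using assms sc_bounds by (intro power_mono divide_left_mono) (auto intro!: mult_pos_pos)
  moreover have "0 \<le> (2 / (sc + h + 1)) ^ k" using assms sc_bounds by simp
  ultimately show ?thesis by (simp add: windowed_weight_def level_weight_def)
qed

lemma windowed_weight_step:
  assumes "0 \<le> h" "h \<le> 1"
  shows "real n * windowed_weight h (Suc k) n \<le> 2 * (\<Sum>i<n. windowed_weight h k i)"
proof -
  let ?D = "\<lambda>k n. 200 * level_weight sc k n - level_weight (sc + h) k n - 200 * level_weight (sc - h) k n"
  have "-1 < sc" "-1 < sc + h" "-1 < sc - h" using sc_bounds assms by auto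
  note st = this[THEN level_weight_step, of n k]
  have "real n * ?D (Suc k) n = 200 * (real n * level_weight sc (Suc k) n) -
      real n * level_weight (sc + h) (Suc k) n - 200 * (real n * level_weight (sc - h) (Suc k) n)"
    by (simp add: algebra_simps)
  also have "\<dots> = 2 * (\<Sum>i<n. ?D k i)"
    unfolding st by (simp add: sum_subtractf sum_distrib_left)
  also have "\<dots> \<le> 2 * (\<Sum>i<n. windowed_weight h k i)"
    by (intro mult_left_mono sum_mono) (auto simp: windowed_weight_def)
  finally have "real n * ?D (Suc k) n \<le> 2 * (\<Sum>i<n. windowed_weight h k i)" .
  moreover have "0 \<le> 2 * (\<Sum>i<n. windowed_weight h k i)" by (simp add: sum_nonneg windowed_weight_nonneg)
  moreover have "real n * windowed_weight h (Suc k) n = max 0 (real n * ?D (Suc k) n)"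
    unfolding windowed_weight_def by (simp add: max_mult_distrib_left)
  ultimately show ?thesis by simp
qed

lemma ln_200_le: "ln (200 :: real) \<le> 8"
proof -
  have "ln (200 :: real) \<le> ln (2 ^ 8)" by (subst ln_le_cancel_iff) auto
  also have "\<dots> = 8 * ln 2" by (subst ln_realpow) auto
  also have "ln (2 :: real) \<le> 1" using ln_le_minus_one[of 2] by simp
  finally show ?thesis by simp
qed

text \<open>
  Positivity forces \<open>level_weight (sc + h) k n \<le> 200 * level_weight sc k n\<close>, hence
  \<open>h * excess k n \<le> ln 200 + 1\<close>, and there the critical solution is at most \<open>exp (O (1 / h))\<close>.
\<close>

lemma windowed_weight_le:
  assumes h: "0 < h" "h \<le> 1"
  shows "windowed_weight h k n \<le> exp (78 / h)"
proof (cases "windowed_weight h k n = 0")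
  case False
  let ?u = "level_weight sc k n"
  have u: "0 < ?u" using sc_bounds by (intro level_weight_pos) auto
  have d: "0 < level_weight (sc - h) k n" using sc_bounds h by (intro level_weight_pos) auto
  have up: "0 < level_weight (sc + h) k n" using sc_bounds h by (intro level_weight_pos) auto
  have "0 < 200 * ?u - level_weight (sc + h) k n - 200 * level_weight (sc - h) k n"
    using False by (auto simp: windowed_weight_def max_def split: if_splits)
  then have "?u * exp (h * excess k n - h\<^sup>2) \<le> ?u * 200"
    using level_weight_up(1)[of h k n] h d by (simp add: mult.commute)
  then have "exp (h * excess k n - h\<^sup>2) \<le> 200" using u by simp
  then have "ln (exp (h * excess k n - h\<^sup>2)) \<le> ln 200" by (subst ln_le_cancel_iff) auto
  then have "h * excess k n \<le> 9" using ln_200_le h power_le_one[of h 2] by simp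
  then have y: "excess k n \<le> 9 / h" using h by (simp add: field_simps)
  have "windowed_weight h k n \<le> 200 * ?u"
    using u d up by (auto simp: windowed_weight_def)
  also have "\<dots> \<le> exp (ln 200) * exp (sc * excess k n + sc\<^sup>2)"
    using critical_weight_bounds(2)[of k n] by simp
  also have "\<dots> = exp (ln 200 + sc * excess k n + sc\<^sup>2)" by (simp add: exp_add)
  also have "\<dots> \<le> exp (78 / h)"
  proof -
    have "sc * excess k n \<le> sc * (9 / h)" using y sc_bounds by (intro mult_left_mono) auto
    also have "\<dots> \<le> 5 * (9 / h)" using sc_bounds h by (intro mult_right_mono) auto
    finally have 1: "sc * excess k n \<le> 45 / h" by simp
    have 2: "sc\<^sup>2 \<le> 5\<^sup>2" using sc_bounds by (intro power_mono) auto
    have "33 \<le> 33 / h" using h by (simp add: field_simps)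
    then have "33 + 45 / h \<le> 78 / h" by (simp flip: add_divide_distrib)
    then show ?thesis using 1 2 ln_200_le by simp
  qed
  finally show ?thesis .
qed auto

lemma windowed_weight_ge_1:
  assumes h: "0 < h" "h \<le> 1" and k: "real k * h\<^sup>2 \<le> 1" and y: "2 \<le> h * excess k n" "h * excess k n \<le> 3"
  shows "1 \<le> windowed_weight h k n"
proof -
  let ?u = "level_weight sc k n"
  have "0 \<le> h * excess k n" using y by linarith
  then have "0 \<le> excess k n" using h by (simp add: zero_le_mult_iff)
  then have "1 \<le> exp (sc * excess k n)" using sc_bounds by simp
  then have u: "1 \<le> ?u" using critical_weight_bounds(1)[of k n] by linarith
  have "level_weight (sc + h) k n \<le> ?u * exp (h * excess k n + real k * h\<^sup>2)"
    using level_weight_up(2)[of h k n] h by simp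
  also have "\<dots> \<le> ?u * exp 4" using u k y by (intro mult_left_mono) auto
  also have "exp 4 = (exp 1 :: real) ^ 4" by (simp flip: exp_of_nat_mult)
  also have "\<dots> \<le> 3 ^ 4" using exp_le by (intro power_mono) auto
  finally have 1: "level_weight (sc + h) k n \<le> ?u * 81" using u by simp
  have "level_weight (sc - h) k n \<le> ?u * exp (- (h * excess k n) + real k * h\<^sup>2)"
    using level_weight_down[of h k n] h by simp
  also have "\<dots> \<le> ?u * exp (- 1)" using u k y by (intro mult_left_mono) auto
  also have "\<dots> \<le> ?u * (1 / 2)"
    using u exp_ge_add_one_self[of 1] by (intro mult_left_mono) (auto simp: exp_minus field_simps)
  finally have "level_weight (sc - h) k n \<le> ?u * (1 / 2)" by simp
  then show ?thesis using 1 u by (simp add: windowed_weight_def)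
qed

text \<open>
  With \<open>h\<close> of order \<open>1 / sqrt k\<close> the second order terms \<open>k h\<^sup>2\<close> and the loss \<open>k \<epsilon>\<close> over \<open>k\<close> levels
  are bounded, while \<open>excess k n \<le> 3 / h\<close> costs only \<open>O (sqrt k)\<close> levels compared with the critical ray.
\<close>

lemma level_tail_ge_exp:
  assumes q: "0 \<le> q" "q \<le> 1" and h: "0 < h" "h \<le> 1" and N: "real N * (1 - q) \<le> h\<^sup>2 / 4" and n: "n \<le> N"
    and k: "real k * h\<^sup>2 \<le> 1" and y: "2 \<le> h * excess k n" "h * excess k n \<le> 3"
  shows "exp (- 83 / h) \<le> 1 - level_cdf q k n"
proof -
  \<comment> \<open>This makes \<open>\<delta> * A = h\<^sup>2 / 4\<close> for the bound \<open>A = exp (78 / h)\<close> of \<open>windowed_weight_le\<close>.\<close>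
  define \<delta> where "\<delta> = h\<^sup>2 / 4 / exp (78 / h)"
  define \<epsilon> where "\<epsilon> = h\<^sup>2 / 2"
  have h2: "0 < h\<^sup>2" "h\<^sup>2 \<le> 1" using h by (auto simp: power_le_one)
  have \<delta>: "0 < \<delta>" using h2 by (simp add: \<delta>_def)
  have "\<delta> * exp (78 / h) = h\<^sup>2 / 4" by (simp add: \<delta>_def)
  then have "\<delta> * exp (78 / h) + real N * (1 - q) \<le> \<epsilon>" using N by (simp add: \<epsilon>_def)
  then have "\<delta> * (1 - \<epsilon>) ^ k * windowed_weight h k n \<le> 1 - level_cdf q k n"
    using q h h2 \<delta> n
    by (intro level_tail_ge_subsolution[where a = "windowed_weight h" and A = "exp (78 / h)"])
       (auto simp: windowed_weight_nonneg windowed_weight_empty windowed_weight_step windowed_weight_le \<epsilon>_def)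
  moreover have "\<delta> * (1 / 2) * 1 \<le> \<delta> * (1 - \<epsilon>) ^ k * windowed_weight h k n"
  proof -
    have "1 / 2 \<le> 1 - real k * \<epsilon>" using k by (simp add: \<epsilon>_def)
    also have "\<dots> \<le> (1 - \<epsilon>) ^ k"
      using power_ge_one_minus[of "1 - \<epsilon>" k] h2 by (simp add: \<epsilon>_def)
    finally show ?thesis
      using \<delta> windowed_weight_ge_1[OF h k y] by (intro mult_mono mult_left_mono) auto
  qed
  moreover have "exp (- 83 / h) \<le> \<delta> * (1 / 2) * 1"
  proof -
    have "8 \<le> exp (3 / h)"
    proof -
      have "(2 :: real) ^ 3 \<le> exp 1 ^ 3" using exp_ge_add_one_self[of 1] by (intro power_mono) auto
      also have "\<dots> = exp 3" by (simp flip: exp_of_nat_mult)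
      also have "\<dots> \<le> exp (3 / h)" using h by (simp add: field_simps)
      finally show ?thesis by simp
    qed
    moreover have "1 / h \<le> exp (1 / h)" using exp_ge_add_one_self[of "1 / h"] by linarith
    ultimately have "8 * (1 / h * (1 / h)) \<le> exp (3 / h) * (exp (1 / h) * exp (1 / h))"
      using h by (intro mult_mono) auto
    also have "\<dots> = exp (5 / h)" by (simp add: add_divide_distrib[symmetric] flip: exp_add)
    finally have "8 / h\<^sup>2 \<le> exp (5 / h)" by (simp add: power2_eq_square)
    then have "1 / exp (5 / h) \<le> h\<^sup>2 / 8" using h2 by (simp add: field_simps)
    then have "1 / exp (5 / h) / exp (78 / h) \<le> h\<^sup>2 / 8 / exp (78 / h)" by (intro divide_right_mono) auto
    moreover have "1 / exp (5 / h) / exp (78 / h) = exp (- 83 / h)"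
      by (simp add: exp_minus inverse_eq_divide add_divide_distrib[symmetric] flip: exp_add)
    ultimately show ?thesis by (simp add: \<delta>_def)
  qed
  ultimately show ?thesis by linarith
qed

text \<open>
  For a given size the number of levels can be chosen such that the excess falls into the required
  range. Since the distribution function increases with the number of levels, the bound extends to
  all smaller \<open>L\<close>, so that it is uniform over all large sizes.
\<close>

lemma level_cdf_le_all_large:
  assumes q: "0 \<le> q" "q \<le> 1" and h: "0 < h" "h \<le> 1" and N: "real N * (1 - q) \<le> h\<^sup>2 / 4" and n: "n \<le> N"
    and c: "c_star * shifted_harmonic sc N * h\<^sup>2 \<le> 1"
    and L: "real L \<le> c_star * (shifted_harmonic sc n - 2 / h)"
  shows "level_cdf q L n \<le> 1 - exp (- 83 / h)"
proof -
  let ?z = "c_star * (shifted_harmonic sc n - 2 / h)"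
  define k where "k = nat \<lfloor>?z\<rfloor>"
  have z: "0 \<le> ?z" using L by linarith
  have k: "real k \<le> ?z" "?z < real k + 1" using z by (auto simp: k_def)
  have Lk: "L \<le> k" using L by (simp add: k_def le_nat_floor)
  have c0: "0 < c_star" using c_star_ge_2 by simp
  have "real k / c_star \<le> shifted_harmonic sc n - 2 / h" "shifted_harmonic sc n - 2 / h < (real k + 1) / c_star"
    using k c0 by (simp_all add: divide_le_eq less_divide_eq mult.commute)
  then have e: "2 / h \<le> excess k n" "excess k n \<le> 2 / h + 1 / c_star"
    using c0 by (auto simp: excess_def add_divide_distrib)
  have "h * (2 / h) \<le> h * excess k n" "h * excess k n \<le> h * (2 / h + 1 / c_star)"
    using e h by (intro mult_left_mono; simp)+
  moreover have "h * (1 / c_star) \<le> 1 * (1 / 2)"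
    using h c_star_ge_2 by (intro mult_mono divide_left_mono) auto
  moreover have "h * (2 / h) = 2" "h * (2 / h + 1 / c_star) = 2 + h * (1 / c_star)"
    using h by (simp_all add: distrib_left)
  ultimately have y: "2 \<le> h * excess k n" "h * excess k n \<le> 3" by linarith+
  have mono: "shifted_harmonic sc n \<le> shifted_harmonic sc N"
    by (rule lift_Suc_mono_le[of "shifted_harmonic sc"]) (use n sc_bounds in auto)
  have "?z \<le> c_star * shifted_harmonic sc N"
  proof (rule mult_left_mono)
    have "0 \<le> 2 / h" using h by simp
    then show "shifted_harmonic sc n - 2 / h \<le> shifted_harmonic sc N" using mono by linarith
  qed (use c0 in simp)
  then have "real k * h\<^sup>2 \<le> c_star * shifted_harmonic sc N * h\<^sup>2"
    using k by (intro mult_right_mono) auto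
  then have "real k * h\<^sup>2 \<le> 1" using c by linarith
  from level_tail_ge_exp[OF q h N n this y] level_cdf_mono[OF q(1) Lk, of n] show ?thesis by linarith
qed

section \<open>A lower bound below the spine: amplification\<close>

text \<open>
  If \<open>f\<close> bounds the distribution function on sizes above some threshold, consider sizes above 8 times
  that threshold. With probability at least 1/4 both subtrees are large, which gives \<open>f\<^sup>2\<close>, and
  otherwise at least one of them is, which gives \<open>f\<close>. The map \<open>f \<mapsto> f - f (1 - f) / 4\<close> multiplies
  \<open>(1 - f) / f\<close> by at least 5/4, so that a tiny success probability becomes a success
  probability close to 1 after logarithmically many steps.
\<close>

lemma level_cdf_amplify:
  assumes q: "0 \<le> q" "q \<le> 1" and N: "real N * (1 - q) \<le> 1 / 4" and X: "1 \<le> X" and p: "0 \<le> p"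
    and base: "\<And>n. X \<le> n \<Longrightarrow> n \<le> N \<Longrightarrow> level_cdf q L n \<le> 1 - p"
  shows "X * 8 ^ j \<le> n \<Longrightarrow> n \<le> N \<Longrightarrow> level_cdf q (L + j) n \<le> 1 / (1 + p * (5 / 4) ^ j)"
proof (induction j arbitrary: n)
  case 0
  then have "level_cdf q L n \<le> 1 - p" using base by simp
  also have "\<dots> \<le> 1 / (1 + p)"
    using p by (subst pos_le_divide_eq) (auto simp: algebra_simps)
  finally show ?case by simp
next
  case (Suc j)
  define g where "g = p * (5 / 4) ^ j"
  define x where "x = 1 / (1 + g)"
  have g: "0 \<le> g" using p by (simp add: g_def)
  have x: "0 \<le> x" "x \<le> 1" using g by (auto simp: x_def)
  let ?F = "level_cdf q (L + j)"
  have F: "0 \<le> ?F i" "?F i \<le> 1" for i by (rule level_cdf_nonneg[OF q(1)] level_cdf_le_1[OF q(1)])+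
  have IH: "?F i \<le> x" if "X * 8 ^ j \<le> i" "i < n" for i
    using Suc.IH[of i] that Suc.prems by (simp add: x_def g_def)
  have "1 * 8 \<le> X * 8 ^ Suc j" using X by (intro mult_mono) auto
  then have n8: "8 \<le> n" using Suc.prems by linarith
  \<comment> \<open>For \<open>i\<close> in \<open>{d..<n - d}\<close> both subtrees have at least \<open>n / 8\<close> nodes.\<close>
  define d where "d = (n + 7) div 8"
  have d: "n \<le> 8 * d" "2 * (2 * d) \<le> n" using n8 by (auto simp: d_def)
  have big: "X * 8 ^ j \<le> i" if "n \<le> 8 * i" for i using that Suc.prems by simp
  have pair: "?F i * ?F (n - 1 - i) \<le> x - of_bool (i \<in> {d..<n - d}) * (x - x * x)" if i: "i < n" for i
  proof (cases "i \<in> {d..<n - d}")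
    case True
    then have "n \<le> 8 * i" "n \<le> 8 * (n - 1 - i)" using d by auto
    then have "?F i * ?F (n - 1 - i) \<le> x * x" using i F x by (intro mult_mono IH big) auto
    then show ?thesis using True by simp
  next
    case False
    have "n \<le> 8 * i \<or> n \<le> 8 * (n - 1 - i)" using i n8 by auto
    then have "?F i * ?F (n - 1 - i) \<le> x"
    proof
      assume "n \<le> 8 * i"
      then have "?F i * ?F (n - 1 - i) \<le> x * 1" using i F x by (intro mult_mono IH big) auto
      then show ?thesis by simp
    next
      assume "n \<le> 8 * (n - 1 - i)"
      then have "?F i * ?F (n - 1 - i) \<le> 1 * x" using i F x by (intro mult_mono IH big) auto
      then show ?thesis by simp
    qed
    then show ?thesis using False by (simp del: atLeastLessThan_iff)
  qed
  have n0: "0 < n" using n8 by simp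
  have Q: "0 < q_number q n" using q n0 by (intro q_number_pos) auto
  have w: "q_number q n / 4 \<le> (\<Sum>i<n. q ^ i * of_bool (i \<in> {d..<n - d}))"
  proof -
    have "3 / 4 \<le> q ^ n"
    proof -
      have "real n * (1 - q) \<le> real N * (1 - q)" using Suc.prems q by (intro mult_right_mono) auto
      then show ?thesis using power_ge_one_minus[OF q, of n] N by linarith
    qed
    have "q_number q n / 4 \<le> real n / 4" using q_number_le[OF q, of n] by simp
    also have "\<dots> \<le> 3 / 4 * (real n / 2)" by simp
    also have "\<dots> \<le> q ^ n * real (n - d - d)"
    proof (rule mult_mono)
      have "n \<le> 2 * (n - d - d)" using d by auto
      then show "real n / 2 \<le> real (n - d - d)" by linarith
    qed (use \<open>3 / 4 \<le> q ^ n\<close> in auto)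
    also have "\<dots> = (\<Sum>i\<in>{d..<n - d}. q ^ n)" by simp
    also have "\<dots> \<le> (\<Sum>i\<in>{d..<n - d}. q ^ i)"
      using q by (intro sum_mono power_decreasing) auto
    also have "\<dots> = (\<Sum>i<n. q ^ i * of_bool (i \<in> {d..<n - d}))"
      by (rule sum.mono_neutral_cong_left) auto
    finally show ?thesis .
  qed
  have "q_number q n * level_cdf q (Suc (L + j)) n \<le> (\<Sum>i<n. q ^ i * (x - of_bool (i \<in> {d..<n - d}) * (x - x * x)))"
    unfolding level_cdf_Suc[OF q(1) n0] using q by (intro sum_mono mult_left_mono pair) auto
  also have "\<dots> = q_number q n * x - (\<Sum>i<n. q ^ i * of_bool (i \<in> {d..<n - d})) * (x - x * x)"
  proof -
    have "(\<Sum>i<n. q ^ i * (x - I i * z)) = q_number q n * x - (\<Sum>i<n. q ^ i * I i) * z" for I z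
      by (simp add: q_number_def sum_distrib_right right_diff_distrib sum_subtractf mult.assoc)
    then show ?thesis .
  qed
  also have "\<dots> \<le> q_number q n * x - q_number q n / 4 * (x - x * x)"
    using w x by (intro diff_left_mono mult_right_mono) (auto simp: mult_left_le)
  also have "\<dots> = q_number q n * (x - (x - x * x) / 4)" by (simp add: algebra_simps)
  finally have "level_cdf q (Suc (L + j)) n \<le> x - (x - x * x) / 4" using Q by simp
  also have "x - (x - x * x) / 4 \<le> 1 / (1 + 5 / 4 * g)"
  proof (subst pos_le_divide_eq)
    have "1 / w - (1 / w - 1 / w * (1 / w)) / 4 = (1 + 3 / 4 * (w - 1)) / w\<^sup>2" if "0 < w" for w :: real
      using that by (simp add: field_simps power2_eq_square)
    from this[of "1 + g"] have "x - (x - x * x) / 4 = (1 + 3 / 4 * g) / (1 + g)\<^sup>2"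
      using g by (simp add: x_def)
    then have "(x - (x - x * x) / 4) * (1 + 5 / 4 * g) = (1 + 3 / 4 * g) * (1 + 5 / 4 * g) / (1 + g)\<^sup>2"
      by simp
    also have "\<dots> \<le> 1"
    proof -
      have "0 < (1 + g)\<^sup>2" using g by (intro zero_less_power) simp
      moreover have "(1 + 3 / 4 * g) * (1 + 5 / 4 * g) \<le> (1 + g)\<^sup>2"
        by (simp add: power2_eq_square algebra_simps)
      ultimately show ?thesis by (simp only: divide_le_eq_1_pos)
    qed
    finally show "(x - (x - x * x) / 4) * (1 + 5 / 4 * g) \<le> 1" .
  qed (use g in auto)
  finally show ?case by (simp add: g_def mult.left_commute)
qed

text \<open>
  Here \<open>b = sqrt (ln m)\<close> with \<open>m = 1 / (1 - q)\<close>. On sizes up to \<open>m * exp (- b)\<close> splits are uniform up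
  to a relative error that is negligible over \<open>O (ln m)\<close> levels. The bound for single trees is applied
  with \<open>h\<close> of order \<open>1 / b\<close> and the amplification with \<open>O(b)\<close> steps; each of these operations costs a
  factor \<open>exp (O(b))\<close> in size, that is \<open>O(b)\<close> levels.
\<close>

lemma level_cdf_mesoscopic:
  "\<exists>D. \<forall>\<^sub>F b in at_top. \<forall>q\<in>{0..<1}. 1 - q = exp (- b\<^sup>2) \<longrightarrow>
     (\<forall>n L :: nat. exp (b\<^sup>2 - 3 * b) \<le> real n \<longrightarrow> real n \<le> exp (b\<^sup>2 - b) \<longrightarrow>
        real L \<le> c_star * b\<^sup>2 - D * b \<longrightarrow> level_cdf q L n \<le> exp (- b))"
proof -
  \<comment> \<open>Losses in the logarithm of the size: 5001 b for going down to \<open>X\<close> below, 8 b for the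
    term \<open>2 / h\<close>, and 5 for replacing the harmonic sum by the logarithm. The factor 6
    is an upper bound of \<open>c*\<close>, the number of levels per unit of the logarithm.\<close>
  define D :: real where "D = 6 * 5014"
  have "\<forall>\<^sub>F b::real in at_top. 5014 \<le> b" by (rule eventually_ge_at_top)
  moreover have "\<forall>\<^sub>F b::real in at_top. exp (- b) \<le> (1 / (4 * b))\<^sup>2 / 4" by real_asymp
  moreover have "\<forall>\<^sub>F b::real in at_top. exp (b\<^sup>2 - b) + 1 \<le> exp (b\<^sup>2)" by real_asymp
  ultimately have "\<forall>\<^sub>F b in at_top. \<forall>q\<in>{0..<1}. 1 - q = exp (- b\<^sup>2) \<longrightarrow>
     (\<forall>n L :: nat. exp (b\<^sup>2 - 3 * b) \<le> real n \<longrightarrow> real n \<le> exp (b\<^sup>2 - b) \<longrightarrow>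
        real L \<le> c_star * b\<^sup>2 - D * b \<longrightarrow> level_cdf q L n \<le> exp (- b))"
  proof (eventually_elim, intro ballI impI allI)
    fix b q :: real and n L :: nat
    assume b: "5014 \<le> b" and small: "exp (- b) \<le> (1 / (4 * b))\<^sup>2 / 4" and big: "exp (b\<^sup>2 - b) + 1 \<le> exp (b\<^sup>2)"
      and q: "q \<in> {0..<1}" "1 - q = exp (- b\<^sup>2)"
      and n: "exp (b\<^sup>2 - 3 * b) \<le> real n" "real n \<le> exp (b\<^sup>2 - b)" and L: "real L \<le> c_star * b\<^sup>2 - D * b"
    have q01: "0 \<le> q" "q \<le> 1" using q by auto
    define h where "h = 1 / (4 * b)"
    have h: "0 < h" "h \<le> 1" using b by (auto simp: h_def)
    define N where "N = nat \<lfloor>exp (b\<^sup>2 - b)\<rfloor>"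
    \<comment> \<open>As \<open>5 / 4 \<ge> exp (1 / 5)\<close>, this many steps amplify the odds by \<open>exp (333 * b)\<close>, which
      beats the initial success probability \<open>exp (- 332 * b)\<close>.\<close>
    define J where "J = nat \<lceil>1665 * b\<rceil>"
    define X where "X = nat \<lfloor>exp (b\<^sup>2 - 5001 * b)\<rfloor>"
    have N: "real N \<le> exp (b\<^sup>2 - b)" by (simp add: N_def)
    have J: "1665 * b \<le> real J" "real J \<le> 1665 * b + 1"
      using b ceiling_correct[of "1665 * b"] by (simp_all add: J_def)
    have X: "real X \<le> exp (b\<^sup>2 - 5001 * b)" "exp (b\<^sup>2 - 5001 * b) \<le> real X + 1"
      using floor_correct[of "exp (b\<^sup>2 - 5001 * b)"] by (simp_all add: X_def)
    have bb: "5014 * b \<le> b\<^sup>2" using b by (simp add: power2_eq_square mult_right_mono)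
    have X1: "1 \<le> X"
    proof -
      have "1 \<le> exp (b\<^sup>2 - 5001 * b)" using bb b by simp
      then show ?thesis by (simp add: X_def le_nat_floor le_floor_iff)
    qed
    have nN: "n \<le> N" using n by (simp add: N_def le_nat_floor)
    have Nq: "real N * (1 - q) \<le> h\<^sup>2 / 4"
    proof -
      have "real N * (1 - q) \<le> exp (b\<^sup>2 - b) * exp (- b\<^sup>2)" unfolding q(2) using N by (intro mult_right_mono) auto
      also have "\<dots> = exp (- b)" by (simp flip: exp_add)
      finally show ?thesis using small by (simp add: h_def)
    qed
    have c: "c_star * shifted_harmonic sc N * h\<^sup>2 \<le> 1"
    proof -
      have "shifted_harmonic sc N \<le> ln (real N + 1)" using sc_bounds by (intro shifted_harmonic_le_ln) auto
      also have "\<dots> \<le> ln (exp (b\<^sup>2))" using N big by (subst ln_le_cancel_iff) auto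
      finally have "shifted_harmonic sc N \<le> b\<^sup>2" by simp
      then have "c_star * shifted_harmonic sc N \<le> 6 * b\<^sup>2"
        using c_star_le_6 c_star_ge_2 by (meson mult_mono mult_left_mono order_trans zero_le_power2 mult_right_mono zero_le_numeral)
      then have "c_star * shifted_harmonic sc N * h\<^sup>2 \<le> 6 * b\<^sup>2 * h\<^sup>2" by (intro mult_right_mono) auto
      also have "\<dots> = 6 / 16" using b by (simp add: h_def power_divide power_mult_distrib)
      finally show ?thesis by simp
    qed
    define L' where "L' = L - J"
    have base: "level_cdf q L' i \<le> 1 - exp (- 332 * b)" if i: "X \<le> i" "i \<le> N" for i
    proof -
      have "b\<^sup>2 - 5001 * b = ln (exp (b\<^sup>2 - 5001 * b))" by simp
      also have "\<dots> \<le> ln (real i + 1)" using X i by (subst ln_le_cancel_iff) auto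
      also have "\<dots> \<le> shifted_harmonic sc i + sc" using shifted_harmonic_ge_ln[of sc i] sc_bounds by simp
      finally have sh: "b\<^sup>2 - 5001 * b - 5 \<le> shifted_harmonic sc i" using sc_bounds by linarith
      have h2: "2 / h = 8 * b" by (simp add: h_def)
      have "real L' \<le> c_star * (b\<^sup>2 - 5014 * b)"
      proof (cases "L \<le> J")
        case True
        then show ?thesis using bb c_star_ge_2 by (simp add: L'_def)
      next
        case False
        have "c_star * (5014 * b) \<le> 6 * (5014 * b)" using c_star_le_6 b by (intro mult_right_mono) auto
        then have "real L \<le> c_star * (b\<^sup>2 - 5014 * b)" using L by (simp add: D_def algebra_simps)
        then show ?thesis using False by (simp add: L'_def)
      qed
      also have "\<dots> \<le> c_star * (shifted_harmonic sc i - 2 / h)"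
        unfolding h2 using sh b c_star_ge_2 by (intro mult_left_mono) auto
      finally have "level_cdf q L' i \<le> 1 - exp (- 83 / h)"
        by (rule level_cdf_le_all_large[OF q01 h Nq i(2) c])
      then show ?thesis by (simp add: h_def)
    qed
    have "X * 8 ^ J \<le> n"
    proof -
      have "(8 :: real) ^ J \<le> exp 3 ^ J"
      proof (intro power_mono)
        have "(2 :: real) ^ 3 \<le> exp 1 ^ 3" using exp_ge_add_one_self[of 1] by (intro power_mono) auto
        then show "(8 :: real) \<le> exp 3" by (simp flip: exp_of_nat_mult)
      qed auto
      also have "\<dots> = exp (3 * real J)" by (simp add: mult.commute flip: exp_of_nat_mult)
      finally have "real X * 8 ^ J \<le> exp (b\<^sup>2 - 5001 * b) * exp (3 * real J)"
        using X by (intro mult_mono) auto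
      also have "\<dots> = exp (b\<^sup>2 - 5001 * b + 3 * real J)" by (simp add: exp_add)
      also have "\<dots> \<le> exp (b\<^sup>2 - 3 * b)" using J b by simp
      finally have "real (X * 8 ^ J) \<le> real n" using n by simp
      then show ?thesis by linarith
    qed
    moreover have "h\<^sup>2 / 4 \<le> 1 / 4" using h by (simp add: power_le_one)
    then have "real N * (1 - q) \<le> 1 / 4" using Nq by linarith
    ultimately have "level_cdf q (L' + J) n \<le> 1 / (1 + exp (- 332 * b) * (5 / 4) ^ J)"
      by (intro level_cdf_amplify[OF q01 _ X1 _ base _ nN]) auto
    moreover have "level_cdf q L n \<le> level_cdf q (L' + J) n"
      by (rule level_cdf_mono[OF q01(1)]) (simp add: L'_def)
    moreover have "1 / (1 + exp (- 332 * b) * (5 / 4) ^ J) \<le> exp (- b)"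
    proof -
      have "exp (1 / 5) \<le> (5 / 4 :: real)"
        using exp_ge_add_one_self[of "- (1 / 5)"] by (simp add: exp_minus field_simps)
      then have "exp (1 / 5) ^ J \<le> (5 / 4 :: real) ^ J" by (intro power_mono) auto
      moreover have "exp (1 / 5) ^ J = exp (real J / 5)" by (simp add: mult.commute flip: exp_of_nat_mult)
      moreover have "exp (333 * b) \<le> exp (real J / 5)" using J by simp
      ultimately have "exp (333 * b) \<le> (5 / 4 :: real) ^ J" by linarith
      then have "exp (- 332 * b) * exp (333 * b) \<le> exp (- 332 * b) * (5 / 4) ^ J"
        by (intro mult_left_mono) auto
      then have "exp b \<le> 1 + exp (- 332 * b) * (5 / 4) ^ J" by (simp flip: exp_add)
      then have "1 / (1 + exp (- 332 * b) * (5 / 4) ^ J) \<le> 1 / exp b"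
        by (intro divide_left_mono) (auto intro!: mult_pos_pos add_pos_pos)
      then show ?thesis by (simp add: exp_minus inverse_eq_divide)
    qed
    ultimately show "level_cdf q L n \<le> exp (- b)" by linarith
  qed
  then show ?thesis by blast
qed

section \<open>The height is at least the spine plus a critical tree\<close>

text \<open>
  Keep only the tree found where the spine first has at most \<open>M\<close> nodes left. It has at least \<open>B\<close> nodes
  except with probability at most \<open>B / (M + 1)\<close>: the step into sizes at most \<open>M\<close> ends at size \<open>j\<close> with a
  weight proportional to \<open>q ^ (n - 1 - j)\<close>, which increases with \<open>j\<close>, so small sizes are no more likely than under
  the uniform distribution on \<open>{0..M}\<close>.
\<close>

lemma level_cdf_le_spine:
  assumes q: "0 \<le> q" "q \<le> 1" and \<epsilon>: "0 \<le> \<epsilon>"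
    and B: "B \<le> Suc M" and mid: "\<And>n. B \<le> n \<Longrightarrow> n \<le> M \<Longrightarrow> 0 < L \<Longrightarrow> level_cdf q L n \<le> \<epsilon>"
  shows "M < n \<Longrightarrow> level_cdf q k n \<le> spine_exp q M n (\<lambda>t. of_bool (t + L \<le> k)) + \<epsilon> + real B / (real M + 1)"
proof -
  define e where "e = real B / (real M + 1)"
  \<comment> \<open>Bounds the probability that the spine enters sizes at most \<open>M\<close> below size \<open>B\<close>.\<close>
  define E where "E n = (if n \<le> M then of_bool (n < B) else e)" for n
  let ?P = "\<lambda>k n. spine_exp q M n (\<lambda>t. of_bool (t + L \<le> k)) :: real"
  have P: "0 \<le> ?P k n" for k n by (rule Bochner_Integration.integral_nonneg) simp
  have e: "0 \<le> e" and e1: "e \<le> 1" using B by (simp_all add: e_def)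
  have avg: "(\<Sum>i<n. q ^ i * E (n - 1 - i)) \<le> q_number q n * e" if n: "M < n" for n
  proof -
    have "(\<Sum>i<n. q ^ i * E (n - 1 - i)) - q_number q n * e = (\<Sum>i<n. q ^ i * (E (n - 1 - i) - e))"
      by (simp add: q_number_def sum_distrib_right right_diff_distrib sum_subtractf)
    also have "\<dots> = (\<Sum>j<n. q ^ (n - 1 - j) * (E j - e))"
      by (subst sum.nat_diff_reindex[symmetric]) (auto intro!: sum.cong)
    also have "\<dots> \<le> (\<Sum>j<n. q ^ (n - B) * (of_bool (j \<le> M) * (of_bool (j < B) - e)))"
    proof (intro sum_mono)
      fix j assume j: "j \<in> {..<n}"
      show "q ^ (n - 1 - j) * (E j - e) \<le> q ^ (n - B) * (of_bool (j \<le> M) * (of_bool (j < B) - e))"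
      proof (cases "j \<le> M")
        case jM: True
        show ?thesis
        proof (cases "j < B")
          case True
          have "q ^ (n - 1 - j) \<le> q ^ (n - B)" using q True j by (intro power_decreasing) auto
          then have "q ^ (n - 1 - j) * (1 - e) \<le> q ^ (n - B) * (1 - e)" using e1 by (intro mult_right_mono) auto
          then show ?thesis using True jM by (simp add: E_def)
        next
          case False
          have "q ^ (n - B) \<le> q ^ (n - 1 - j)" using q False j by (intro power_decreasing) auto
          then have "q ^ (n - B) * e \<le> q ^ (n - 1 - j) * e" using e by (rule mult_right_mono)
          then show ?thesis using False jM by (simp add: E_def)
        qed
      qed (simp add: E_def)
    qed
    also have "\<dots> = q ^ (n - B) * (\<Sum>j\<in>{..M}. of_bool (j < B) - e)"
      unfolding sum_distrib_left[symmetric] using n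
      by (intro arg_cong2[where f = "(*)"] refl sum.mono_neutral_cong_right) auto
    also have "(\<Sum>j\<in>{..M}. of_bool (j < B) - e) = (\<Sum>j\<in>{..M}. of_bool (j < B)) - real B"
    proof -
      have "(1 + real M) * e = real B" unfolding e_def by (simp add: field_simps)
      then show ?thesis by (simp add: sum_subtractf)
    qed
    also have "(\<Sum>j\<in>{..M}. of_bool (j < B)) = real (card {j\<in>{..M}. j < B})"
      by (simp add: of_bool_def sum.If_cases Int_def)
    also have "q ^ (n - B) * (real (card {j\<in>{..M}. j < B}) - real B) \<le> 0"
    proof -
      have "card {j\<in>{..M}. j < B} \<le> card {..<B}" by (intro card_mono) auto
      then show ?thesis using q by (intro mult_nonneg_nonpos) auto
    qed
    finally show ?thesis by simp
  qed
  have "level_cdf q k n \<le> ?P k n + \<epsilon> + E n" for n k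
  proof (induction n arbitrary: k rule: less_induct)
    case (less n)
    show ?case
    proof (cases "M < n")
      case False
      then have P_eq: "?P k n = of_bool (L \<le> k)" using q by (simp add: spine_exp_small)
      show ?thesis
      proof (cases "L \<le> k \<or> n < B")
        case True
        then show ?thesis using False P_eq \<epsilon> level_cdf_le_1[OF q(1), of k n] by (auto simp: E_def)
      next
        case c: False
        then have "level_cdf q k n \<le> level_cdf q L n" using q by (intro level_cdf_mono) auto
        also have "\<dots> \<le> \<epsilon>" using c False by (intro mid) auto
        finally show ?thesis using False P_eq by (auto simp: E_def)
      qed
    next
      case n: True
      have Q: "0 < q_number q n" using n q by (intro q_number_pos) auto
      show ?thesis
      proof (cases k)
        case 0
        then show ?thesis using n P[of n k] \<epsilon> e by (auto simp: E_def)
      next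
        case (Suc k')
        have "q_number q n * level_cdf q k n \<le> (\<Sum>i<n. q ^ i * (?P k' (n - 1 - i) + \<epsilon> + E (n - 1 - i)))"
        proof -
          have "0 < n" using n by simp
          show ?thesis unfolding Suc level_cdf_Suc[OF q(1) \<open>0 < n\<close>]
          proof (intro sum_mono mult_left_mono)
            fix i assume i: "i \<in> {..<n}"
            have "level_cdf q k' i * level_cdf q k' (n - 1 - i) \<le> 1 * level_cdf q k' (n - 1 - i)"
              using level_cdf_nonneg[OF q(1)] level_cdf_le_1[OF q(1)] by (intro mult_right_mono) auto
            also have "\<dots> \<le> ?P k' (n - 1 - i) + \<epsilon> + E (n - 1 - i)" using less[of "n - 1 - i" k'] i by simp
            finally show "level_cdf q k' i * level_cdf q k' (n - 1 - i) \<le> ?P k' (n - 1 - i) + \<epsilon> + E (n - 1 - i)" .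
          qed (use q in auto)
        qed
        also have "\<dots> = (\<Sum>i<n. q ^ i * ?P k' (n - 1 - i)) + q_number q n * \<epsilon> + (\<Sum>i<n. q ^ i * E (n - 1 - i))"
          by (simp add: distrib_left sum.distrib q_number_def sum_distrib_right)
        also have "(\<Sum>i<n. q ^ i * ?P k' (n - 1 - i)) = q_number q n * ?P k n"
          unfolding Suc by (subst spine_exp_step[OF q(1) n]) simp
        also have "(\<Sum>i<n. q ^ i * E (n - 1 - i)) \<le> q_number q n * e" by (rule avg[OF n])
        also have "q_number q n * ?P k n + q_number q n * \<epsilon> + q_number q n * e = q_number q n * (?P k n + \<epsilon> + E n)"
          using n by (simp add: E_def algebra_simps)
        finally show ?thesis using Q by simp
      qed
    qed
  qed
  then show "M < n \<Longrightarrow> level_cdf q k n \<le> ?P k n + \<epsilon> + real B / (real M + 1)"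
    by (metis E_def e_def not_less)
qed

text \<open>
  With \<open>m = 1 / (1 - q)\<close> this is \<open>m * exp (- sqrt (ln m))\<close>: so much smaller than \<open>m\<close> that splits are
  practically uniform, at a price of only \<open>O (sqrt (ln m))\<close> levels.
\<close>

definition core_size :: "real \<Rightarrow> nat" where
  "core_size q = nat \<lfloor>exp (ln (1 / (1 - q)) - sqrt (ln (1 / (1 - q))))\<rfloor>"

text \<open>
  For \<open>q\<close> bounded away from 1 the claim only compares the height with the length of the spine, since
  a large constant \<open>C\<close> makes \<open>L = 0\<close>.
\<close>

theorem level_tail_lower:
  assumes \<epsilon>: "0 < \<epsilon>"
  shows "\<exists>C. \<forall>q\<in>{0..<1}. \<forall>n k L :: nat. core_size q < n \<longrightarrow>
    real L \<le> max 0 (c_star * ln (1 / (1 - q)) - C * (sqrt (ln (1 / (1 - q))) + 1)) \<longrightarrow>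
    level_cdf q k n \<le> spine_exp q (core_size q) n (\<lambda>t. of_bool (t + L \<le> k)) + \<epsilon>"
proof -
  obtain D where "\<forall>\<^sub>F b in at_top. \<forall>q\<in>{0..<1}. 1 - q = exp (- b\<^sup>2) \<longrightarrow>
     (\<forall>n L :: nat. exp (b\<^sup>2 - 3 * b) \<le> real n \<longrightarrow> real n \<le> exp (b\<^sup>2 - b) \<longrightarrow>
        real L \<le> c_star * b\<^sup>2 - D * b \<longrightarrow> level_cdf q L n \<le> exp (- b))"
    using level_cdf_mesoscopic by blast
  moreover have "\<forall>\<^sub>F b::real in at_top. exp (- b) + (exp (b\<^sup>2 - 3 * b) + 1) / exp (b\<^sup>2 - b) < \<epsilon>"
  proof -
    have "((\<lambda>b::real. exp (- b) + (exp (b\<^sup>2 - 3 * b) + 1) / exp (b\<^sup>2 - b)) \<longlongrightarrow> 0) at_top" by real_asymp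
    then show ?thesis using \<epsilon> by (rule order_tendstoD)
  qed
  moreover have "\<forall>\<^sub>F b::real in at_top. exp (b\<^sup>2 - 3 * b) + 1 \<le> exp (b\<^sup>2 - b)" by real_asymp
  ultimately have "\<forall>\<^sub>F b in at_top. (\<forall>q\<in>{0..<1}. 1 - q = exp (- b\<^sup>2) \<longrightarrow>
     (\<forall>n L :: nat. exp (b\<^sup>2 - 3 * b) \<le> real n \<longrightarrow> real n \<le> exp (b\<^sup>2 - b) \<longrightarrow>
        real L \<le> c_star * b\<^sup>2 - D * b \<longrightarrow> level_cdf q L n \<le> exp (- b))) \<and>
      exp (- b) + (exp (b\<^sup>2 - 3 * b) + 1) / exp (b\<^sup>2 - b) < \<epsilon> \<and> exp (b\<^sup>2 - 3 * b) + 1 \<le> exp (b\<^sup>2 - b)"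
    by eventually_elim blast
  then obtain b0 where b0: "\<And>b. b0 \<le> b \<Longrightarrow> (\<forall>q\<in>{0..<1}. 1 - q = exp (- b\<^sup>2) \<longrightarrow>
     (\<forall>n L :: nat. exp (b\<^sup>2 - 3 * b) \<le> real n \<longrightarrow> real n \<le> exp (b\<^sup>2 - b) \<longrightarrow>
        real L \<le> c_star * b\<^sup>2 - D * b \<longrightarrow> level_cdf q L n \<le> exp (- b))) \<and>
      exp (- b) + (exp (b\<^sup>2 - 3 * b) + 1) / exp (b\<^sup>2 - b) < \<epsilon> \<and> exp (b\<^sup>2 - 3 * b) + 1 \<le> exp (b\<^sup>2 - b)"
    unfolding eventually_at_top_linorder by blast
  \<comment> \<open>The second term makes the bound on \<open>L\<close> vanish for \<open>b < b0\<close>, where the asymptotic estimates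
    are not available.\<close>
  define C where "C = max (max D 0) (6 * b0\<^sup>2)"
  show ?thesis
  proof (intro exI[of _ C] ballI allI impI)
    fix q :: real and n k L :: nat
    assume q: "q \<in> {0..<1}" and n: "core_size q < n"
      and L: "real L \<le> max 0 (c_star * ln (1 / (1 - q)) - C * (sqrt (ln (1 / (1 - q))) + 1))"
    define b where "b = sqrt (ln (1 / (1 - q)))"
    have l0: "0 \<le> ln (1 / (1 - q))" using q by simp
    have b: "0 \<le> b" "b\<^sup>2 = ln (1 / (1 - q))" using l0 by (auto simp: b_def)
    have qb: "1 - q = exp (- b\<^sup>2)" using q by (simp add: b(2) exp_minus)
    have M: "core_size q = nat \<lfloor>exp (b\<^sup>2 - b)\<rfloor>" unfolding core_size_def by (simp only: b(2) b_def[symmetric])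
    have M_bounds: "real (core_size q) \<le> exp (b\<^sup>2 - b)" "exp (b\<^sup>2 - b) \<le> real (core_size q) + 1"
      using floor_correct[of "exp (b\<^sup>2 - b)"] unfolding M by simp_all
    show "level_cdf q k n \<le> spine_exp q (core_size q) n (\<lambda>t. of_bool (t + L \<le> k)) + \<epsilon>"
    proof (cases "L = 0")
      case True
      have "level_cdf q k n \<le> spine_exp q (core_size q) n (\<lambda>t. of_bool (t + L \<le> k)) + 0 + real 0 / (real (core_size q) + 1)"
        by (rule level_cdf_le_spine) (use q n True in auto)
      then show ?thesis using \<epsilon> by simp
    next
      case False
      then have L': "real L \<le> c_star * b\<^sup>2 - C * (b + 1)" unfolding b(2) using L by (auto simp: b_def max_def split: if_splits)
      have "b0 \<le> b"
      proof (rule ccontr)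
        assume "\<not> b0 \<le> b"
        then have "b\<^sup>2 \<le> b0\<^sup>2" using b by (intro power_mono) auto
        then have "c_star * b\<^sup>2 \<le> 6 * b0\<^sup>2" using c_star_le_6 by (intro mult_mono) auto
        also have "\<dots> \<le> C * 1" by (simp add: C_def)
        also have "\<dots> \<le> C * (b + 1)" using b by (intro mult_left_mono) (auto simp: C_def)
        finally show False using L' False by simp
      qed
      note big = b0[OF this]
      define B where "B = nat \<lceil>exp (b\<^sup>2 - 3 * b)\<rceil>"
      have B: "exp (b\<^sup>2 - 3 * b) \<le> real B" "real B \<le> exp (b\<^sup>2 - 3 * b) + 1"
        using ceiling_correct[of "exp (b\<^sup>2 - 3 * b)"] by (simp_all add: B_def)
      have "level_cdf q k n \<le> spine_exp q (core_size q) n (\<lambda>t. of_bool (t + L \<le> k)) + exp (- b) + real B / (real (core_size q) + 1)"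
      proof (rule level_cdf_le_spine)
        have "real B \<le> real (Suc (core_size q))" using B M_bounds big by simp
        then show "B \<le> Suc (core_size q)" by linarith
        fix j assume j: "B \<le> j" "j \<le> core_size q"
        have "D * b \<le> C * b" using b by (intro mult_right_mono) (auto simp: C_def)
        also have "\<dots> \<le> C * (b + 1)" by (intro mult_left_mono) (auto simp: C_def)
        finally have "real L \<le> c_star * b\<^sup>2 - D * b" using L' by simp
        moreover have "exp (b\<^sup>2 - 3 * b) \<le> real j" using j B by simp
        moreover have "real j \<le> exp (b\<^sup>2 - b)" using j M_bounds by simp
        ultimately show "level_cdf q L j \<le> exp (- b)" using big q qb by blast
      qed (use q n in auto)
      also have "real B / (real (core_size q) + 1) \<le> (exp (b\<^sup>2 - 3 * b) + 1) / exp (b\<^sup>2 - b)"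
        using B M_bounds by (intro frac_le) auto
      finally show ?thesis using big by linarith
    qed
  qed
qed

section \<open>The central limit theorem for the spine walk\<close>

definition spine_mean :: "real \<Rightarrow> nat \<Rightarrow> nat \<Rightarrow> real" where
  "spine_mean q M n = (\<Sum>i<n. spine_prob q M (Suc i))"

definition spine_var :: "real \<Rightarrow> nat \<Rightarrow> nat \<Rightarrow> real" where
  "spine_var q M n = (\<Sum>i<n. spine_prob q M (Suc i) * (1 - spine_prob q M (Suc i)))"

definition spine_error :: "real \<Rightarrow> nat \<Rightarrow> real" where
  "spine_error q M = 1 + real (Suc M) * (1 - q) + ln (1 / (1 - q ^ Suc M))"

text \<open>
  The deviation of \<open>1 / [i]\<close> from its limit \<open>1 - q\<close> is at most
  \<open>ln (1 - q ^ i) - ln (1 - q ^ (i - 1))\<close>, which telescopes.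
\<close>

lemma spine_mean_var_approx:
  assumes q: "0 < q" "q < 1" and n: "M < n"
  shows "\<bar>spine_mean q M n - real n * (1 - q)\<bar> \<le> spine_error q M"
    and "\<bar>spine_var q M n - real n * ((1 - q) * q)\<bar> \<le> spine_error q M"
proof -
  let ?E = "\<lambda>n. 1 + real (Suc M) * (1 - q) + (ln (1 - q ^ n) - ln (1 - q ^ Suc M))"
  have "Suc M \<le> n" using n by simp
  then have "\<bar>spine_mean q M n - real n * (1 - q)\<bar> \<le> ?E n \<and> \<bar>spine_var q M n - real n * ((1 - q) * q)\<bar> \<le> ?E n"
  proof (induction n rule: dec_induct)
    case base
    have zero: "spine_mean q M M = 0" "spine_var q M M = 0"
      by (simp_all add: spine_mean_def spine_var_def spine_prob_def)
    have "spine_mean q M (Suc M) = 1" "spine_var q M (Suc M) = 0"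
      using zero by (simp_all add: spine_mean_def spine_var_def spine_prob_def)
    moreover have "0 \<le> real (Suc M) * (1 - q)" using q by simp
    moreover have "real (Suc M) * ((1 - q) * q) \<le> real (Suc M) * (1 - q)"
      using q by (intro mult_left_mono mult_right_le_one_le) auto
    moreover have "0 \<le> real (Suc M) * ((1 - q) * q)" using q by simp
    ultimately show ?case by (simp only:) linarith
  next
    case (step n)
    define p where "p = spine_prob q M (Suc n)"
    define e where "e = p - (1 - q)"
    have pow: "0 < 1 - q ^ n" "0 < 1 - q ^ Suc n"
    proof -
      have "0 < n" using step by simp
      then show "0 < 1 - q ^ n" using q by (simp add: power_less_one_iff)
      show "0 < 1 - q ^ Suc n" using q by (simp add: power_less_one_iff del: power_Suc)
    qed
    have "p = 1 / q_number q (Suc n)" using step by (simp add: p_def spine_prob_def)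
    also have "q_number q (Suc n) = (1 - q ^ Suc n) / (1 - q)"
      using one_minus_q_times_q_number[of q "Suc n"] q by (simp add: field_simps)
    finally have p: "p = (1 - q) / (1 - q ^ Suc n)" by simp
    have e: "e = (1 - q) * q ^ Suc n / (1 - q ^ Suc n)"
      unfolding e_def p using pow(2) by (simp add: field_simps del: power_Suc)
    have e0: "0 \<le> e" unfolding e using pow q by simp
    have p01: "0 \<le> p" "p \<le> 1" using spine_prob_bounds[of q M "Suc n"] q by (auto simp: p_def)
    have incr: "e \<le> ln (1 - q ^ Suc n) - ln (1 - q ^ n)"
    proof -
      have "ln ((1 - q ^ n) / (1 - q ^ Suc n)) \<le> (1 - q ^ n) / (1 - q ^ Suc n) - 1"
        using pow by (intro ln_le_minus_one) simp
      also have "\<dots> = - ((1 - q) * q ^ n / (1 - q ^ Suc n))"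
        using pow(2) by (simp add: field_simps)
      also have "(1 - q) * q ^ n / (1 - q ^ Suc n) \<ge> e"
        unfolding e using q pow by (intro divide_right_mono mult_left_mono power_decreasing) auto
      then have "- ((1 - q) * q ^ n / (1 - q ^ Suc n)) \<le> - e" by simp
      finally show ?thesis using pow by (simp add: ln_div)
    qed
    have mean: "spine_mean q M (Suc n) = spine_mean q M n + p"
      and var: "spine_var q M (Suc n) = spine_var q M n + p * (1 - p)"
      by (simp_all add: spine_mean_def spine_var_def p_def)
    have "spine_mean q M (Suc n) - real (Suc n) * (1 - q) = (spine_mean q M n - real n * (1 - q)) + e"
      unfolding mean e_def by (simp add: algebra_simps)
    then have 1: "\<bar>spine_mean q M (Suc n) - real (Suc n) * (1 - q)\<bar> \<le> ?E (Suc n)"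
      using conjunct1[OF step.IH] incr e0 by linarith
    have v: "p * (1 - p) - (1 - q) * q = e * (q - p)" unfolding e_def by (simp add: algebra_simps)
    have "\<bar>e * (q - p)\<bar> \<le> e * 1"
      unfolding abs_mult using e0 p01 q by (intro mult_mono) auto
    then have "\<bar>p * (1 - p) - (1 - q) * q\<bar> \<le> e" unfolding v by simp
    moreover have "spine_var q M (Suc n) - real (Suc n) * ((1 - q) * q) =
        (spine_var q M n - real n * ((1 - q) * q)) + (p * (1 - p) - (1 - q) * q)"
      unfolding var by (simp add: algebra_simps)
    ultimately have "\<bar>spine_var q M (Suc n) - real (Suc n) * ((1 - q) * q)\<bar> \<le> ?E (Suc n)"
      using conjunct2[OF step.IH] incr by linarith
    with 1 show ?case by blast
  qed
  moreover have "?E n \<le> spine_error q M"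
  proof -
    have "0 < 1 - q ^ n" "0 < 1 - q ^ Suc M"
      using q n by (auto simp: power_less_one_iff simp del: power_Suc)
    moreover have "0 \<le> q ^ n" using q by simp
    ultimately show ?thesis by (simp add: spine_error_def ln_div del: power_Suc)
  qed
  ultimately show "\<bar>spine_mean q M n - real n * (1 - q)\<bar> \<le> spine_error q M"
    "\<bar>spine_var q M n - real n * ((1 - q) * q)\<bar> \<le> spine_error q M" by linarith+
qed

lemma spine_exp_iexp:
  assumes "0 \<le> q"
  shows "spine_exp q M n (\<lambda>t. iexp (a * real t)) =
    (\<Prod>i<n. (1 - of_real (spine_prob q M (Suc i))) + of_real (spine_prob q M (Suc i)) * iexp a)"
proof (induction n)
  case (Suc n)
  let ?p = "spine_prob q M (Suc n)"
  have "spine_exp q M (Suc n) (\<lambda>t. iexp (a * real t)) =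
     ?p *\<^sub>R spine_exp q M n (\<lambda>t. iexp a * iexp (a * real t)) + (1 - ?p) *\<^sub>R spine_exp q M n (\<lambda>t. iexp (a * real t))"
    unfolding spine_exp_Suc[OF assms] by (simp add: algebra_simps exp_add)
  also have "spine_exp q M n (\<lambda>t. iexp a * iexp (a * real t)) = iexp a * spine_exp q M n (\<lambda>t. iexp (a * real t))"
    by simp
  finally show ?case unfolding prod.lessThan_Suc Suc[symmetric] by (simp add: scaleR_conv_of_real algebra_simps)
qed simp

text \<open>
  Second order expansion of the characteristic function of a centred Bernoulli variable. Its variance
  \<open>p (1 - p)\<close> is a factor of the error, so that the errors add up to a multiple of the total variance.
\<close>

lemma bernoulli_factor_approx:
  fixes p a :: real
  assumes p: "0 \<le> p" "p \<le> 1"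
  shows "cmod (((1 - of_real p) + of_real p * iexp a) * iexp (- (a * p)) - of_real (exp (- (p * (1 - p) * a\<^sup>2 / 2))))
    \<le> p * (1 - p) * (\<bar>a\<bar> ^ 3 + a ^ 4)"
proof -
  define v where "v = p * (1 - p)"
  have v: "0 \<le> v" "v \<le> 1" using p by (auto simp: v_def intro: mult_le_one)
  \<comment> \<open>The linear terms of the two exponentials cancel because the variable is centred.\<close>
  define r where "r x = iexp x - (1 + \<i> * of_real x - of_real (x\<^sup>2 / 2))" for x :: real
  have r: "cmod (r x) \<le> \<bar>x\<bar> ^ 3 / 6" for x
    using iexp_approx1[of x 2]
    by (simp add: r_def numeral_eq_Suc atMost_Suc field_simps)
  have iexp_eq: "iexp x = 1 + \<i> * of_real x - of_real (x\<^sup>2 / 2) + r x" for x by (simp add: r_def)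
  have split: "((1 - of_real p) + of_real p * iexp a) * iexp (- (a * p)) =
      (1 - of_real p) * iexp (- (a * p)) + of_real p * iexp (a * (1 - p))"
    by (simp add: algebra_simps flip: exp_add)
  have z: "((1 - of_real p) + of_real p * iexp a) * iexp (- (a * p)) =
      of_real (1 - v * a\<^sup>2 / 2) + ((1 - of_real p) * r (- (a * p)) + of_real p * r (a * (1 - p)))"
  proof -
    define R where "R = r (- (a * p))"
    define R' where "R' = r (a * (1 - p))"
    have "((1 - of_real p) + of_real p * iexp a) * iexp (- (a * p)) =
      (1 - of_real p) * (1 + \<i> * of_real (- (a * p)) - of_real ((- (a * p))\<^sup>2 / 2) + R)
      + of_real p * (1 + \<i> * of_real (a * (1 - p)) - of_real ((a * (1 - p))\<^sup>2 / 2) + R')"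
      unfolding R_def R'_def iexp_eq[symmetric] by (rule split)
    also have "\<dots> = of_real (1 - v * a\<^sup>2 / 2) + ((1 - of_real p) * R + of_real p * R')"
      by (simp add: v_def field_simps power2_eq_square)
    finally show ?thesis by (simp only: R_def R'_def)
  qed
  have "cmod ((1 - of_real p) * r (- (a * p)) + of_real p * r (a * (1 - p)))
      \<le> (1 - p) * (\<bar>a * p\<bar> ^ 3 / 6) + p * (\<bar>a * (1 - p)\<bar> ^ 3 / 6)"
  proof (rule order_trans[OF norm_triangle_ineq add_mono])
    have "cmod (1 - of_real p) = 1 - p" using p by (metis abs_of_nonneg diff_ge_0_iff_ge norm_of_real of_real_1 of_real_diff)
    then show "cmod ((1 - of_real p) * r (- (a * p))) \<le> (1 - p) * (\<bar>a * p\<bar> ^ 3 / 6)"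
      using mult_left_mono[OF r[of "- (a * p)"], of "1 - p"] p by (simp add: norm_mult)
    show "cmod (of_real p * r (a * (1 - p))) \<le> p * (\<bar>a * (1 - p)\<bar> ^ 3 / 6)"
      using mult_left_mono[OF r[of "a * (1 - p)"], of p] p by (simp add: norm_mult)
  qed
  also have "\<dots> = v * \<bar>a\<bar> ^ 3 * ((p\<^sup>2 + (1 - p)\<^sup>2) / 6)"
    using p by (simp add: v_def abs_mult power_mult_distrib) (simp add: power3_eq_cube power2_eq_square algebra_simps add_divide_distrib)
  also have "\<dots> \<le> v * \<bar>a\<bar> ^ 3 * (1 / 2)"
  proof (intro mult_left_mono)
    have "p\<^sup>2 \<le> 1" "(1 - p)\<^sup>2 \<le> 1" using p by (auto simp: power_le_one)
    then show "(p\<^sup>2 + (1 - p)\<^sup>2) / 6 \<le> 1 / 2" by simp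
  qed (use v in auto)
  finally have 1: "cmod ((1 - of_real p) * r (- (a * p)) + of_real p * r (a * (1 - p))) \<le> v * \<bar>a\<bar> ^ 3 * (1 / 2)" .
  define w where "w = v * a\<^sup>2 / 2"
  have w: "0 \<le> w" using v by (simp add: w_def)
  have "\<bar>exp (- w) - (1 - w)\<bar> \<le> w\<^sup>2"
  proof -
    have lo: "1 - w \<le> exp (- w)" using exp_ge_add_one_self[of "- w"] by simp
    have "exp (- w) \<le> 1 / (1 + w)" using exp_ge_add_one_self[of w] w
      by (simp add: exp_minus inverse_eq_divide) (intro divide_left_mono, auto)
    also have "\<dots> \<le> 1 - w + w\<^sup>2"
      using w by (subst pos_divide_le_eq) (auto simp: algebra_simps power2_eq_square)
    finally show ?thesis using lo by simp
  qed
  also have "w\<^sup>2 = v * (v * a ^ 4 / 4)" by (simp add: w_def power2_eq_square power4_eq_xxxx)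
  also have "\<dots> \<le> v * (1 * a ^ 4 / 4)" using v by (intro mult_left_mono divide_right_mono mult_right_mono) auto
  finally have 2: "\<bar>exp (- w) - (1 - w)\<bar> \<le> v * (a ^ 4 / 4)" by simp
  have "((1 - of_real p) + of_real p * iexp a) * iexp (- (a * p)) - of_real (exp (- (p * (1 - p) * a\<^sup>2 / 2))) =
     ((1 - of_real p) * r (- (a * p)) + of_real p * r (a * (1 - p))) - of_real (exp (- w) - (1 - w))"
    unfolding z by (simp add: w_def v_def)
  also have "cmod \<dots> \<le> v * \<bar>a\<bar> ^ 3 * (1 / 2) + v * (a ^ 4 / 4)"
    by (rule order_trans[OF norm_triangle_ineq4 add_mono[OF 1]]) (use 2 in \<open>simp only: norm_of_real\<close>)
  also have "\<dots> \<le> v * (\<bar>a\<bar> ^ 3 + a ^ 4)"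
  proof -
    have "0 \<le> v * \<bar>a\<bar> ^ 3" "0 \<le> v * a ^ 4" using v by auto
    then show ?thesis unfolding distrib_left by linarith
  qed
  finally show ?thesis by (simp add: v_def)
qed

lemma spine_char_approx:
  assumes q: "0 \<le> q"
  shows "cmod (spine_exp q M n (\<lambda>t. iexp (a * real t)) * iexp (- (a * spine_mean q M n)) - of_real (exp (- (spine_var q M n * a\<^sup>2 / 2))))
    \<le> spine_var q M n * (\<bar>a\<bar> ^ 3 + a ^ 4)"
proof -
  let ?p = "\<lambda>i. spine_prob q M (Suc i)"
  let ?z = "\<lambda>i. ((1 - of_real (?p i)) + of_real (?p i) * iexp a) * iexp (- (a * ?p i))"
  let ?w = "\<lambda>i. of_real (exp (- (?p i * (1 - ?p i) * a\<^sup>2 / 2))) :: complex"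
  have p: "0 \<le> ?p i" "?p i \<le> 1" for i using spine_prob_bounds[OF q] by auto
  have "iexp (- (a * spine_mean q M n)) = (\<Prod>i<n. iexp (- (a * ?p i)))"
    by (simp add: spine_mean_def sum_distrib_left exp_sum flip: sum_negf)
  then have Z: "spine_exp q M n (\<lambda>t. iexp (a * real t)) * iexp (- (a * spine_mean q M n)) = (\<Prod>i<n. ?z i)"
    by (simp only: spine_exp_iexp[OF q] prod.distrib)
  have W: "of_real (exp (- (spine_var q M n * a\<^sup>2 / 2))) = (\<Prod>i<n. ?w i)"
    by (simp add: spine_var_def sum_distrib_right sum_divide_distrib exp_sum flip: sum_negf of_real_prod)
  have "cmod ((\<Prod>i<n. ?z i) - (\<Prod>i<n. ?w i)) \<le> (\<Sum>i<n. cmod (?z i - ?w i))"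
  proof (rule norm_prod_diff)
    fix i
    have "cmod (1 - of_real (?p i)) = 1 - ?p i"
      using p[of i] by (metis abs_of_nonneg diff_ge_0_iff_ge norm_of_real of_real_1 of_real_diff)
    moreover have "cmod ((1 - of_real (?p i)) + of_real (?p i) * iexp a) \<le> cmod (1 - of_real (?p i)) + cmod (of_real (?p i) * iexp a)"
      by (rule norm_triangle_ineq)
    ultimately show "cmod (?z i) \<le> 1" using p[of i] by (simp add: norm_mult)
    show "cmod (?w i) \<le> 1" using p[of i] by (simp add: norm_of_real)
  qed
  also have "\<dots> \<le> (\<Sum>i<n. ?p i * (1 - ?p i) * (\<bar>a\<bar> ^ 3 + a ^ 4))"
    by (intro sum_mono bernoulli_factor_approx p)
  finally show ?thesis unfolding Z W by (simp add: spine_var_def sum_distrib_right)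
qed

lemma isCont_cdf_std_normal: "isCont (cdf std_normal_distribution) x"
proof -
  interpret real_distribution std_normal_distribution by (rule real_dist_normal_dist)
  have "emeasure std_normal_distribution {x} = (\<integral>\<^sup>+y. ennreal (std_normal_density y) * indicator {x} y \<partial>lborel)"
    by (rule emeasure_density) auto
  also have "\<dots> = 0"
    by (subst nn_integral_0_iff_AE) (auto intro!: AE_I[where N = "{x}"] simp: indicator_def)
  finally show ?thesis by (simp add: isCont_cdf measure_def)
qed

text \<open>
  By Levy's continuity theorem. The walk may be centred at \<open>n (1 - q)\<close> and scaled by
  \<open>sqrt (n (1 - q) q)\<close> because \<open>spine_error\<close> bounds the deviation of both its mean and its variance
  from these values.
\<close>

lemma spine_clt:
  fixes q :: "nat \<Rightarrow> real" and M :: "nat \<Rightarrow> nat"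
  defines "s \<equiv> \<lambda>n. sqrt (real n * (1 - q n) * q n)"
  assumes q: "\<And>n. q n \<in> {0..1}" "\<forall>\<^sub>F n in sequentially. 0 < q n \<and> q n < 1"
    and s: "filterlim s at_top sequentially"
    and M: "\<forall>\<^sub>F n in sequentially. M n < n" and err: "(\<lambda>n. spine_error (q n) (M n) / s n) \<longlonglongrightarrow> 0"
  shows "(\<lambda>n. spine_exp (q n) (M n) n (\<lambda>t. of_bool ((real t - real n * (1 - q n)) / s n \<le> x)))
    \<longlonglongrightarrow> cdf std_normal_distribution x"
proof -
  let ?f = "\<lambda>n t. (real t - real n * (1 - q n)) / s n"
  let ?D = "\<lambda>n. distr (measure_pmf (spine_pmf (q n) (M n) n)) borel (?f n)"
  let ?\<mu> = "\<lambda>n. spine_mean (q n) (M n) n" and ?V = "\<lambda>n. spine_var (q n) (M n) n"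
  have spos: "\<forall>\<^sub>F n in sequentially. 1 \<le> s n"
    using s by (simp add: filterlim_at_top)
  have s_inf: "(\<lambda>n. 1 / s n) \<longlonglongrightarrow> 0"
    using s by (intro tendsto_divide_0[OF tendsto_const] filterlim_at_top_imp_at_infinity)
  have mean_lim: "(\<lambda>n. (?\<mu> n - real n * (1 - q n)) / s n) \<longlonglongrightarrow> 0"
  proof (rule Lim_null_comparison[OF _ err])
    show "\<forall>\<^sub>F n in sequentially. norm ((?\<mu> n - real n * (1 - q n)) / s n) \<le> spine_error (q n) (M n) / s n"
      using q(2) M spos
    proof eventually_elim
      case (elim n)
      then show ?case using spine_mean_var_approx(1)[of "q n" "M n" n]
        by (simp add: divide_right_mono)
    qed
  qed
  have var_lim: "(\<lambda>n. ?V n / (s n)\<^sup>2) \<longlonglongrightarrow> 1"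
  proof -
    have "(\<lambda>n. (?V n - (s n)\<^sup>2) / (s n)\<^sup>2) \<longlonglongrightarrow> 0"
    proof (rule Lim_null_comparison)
      show "\<forall>\<^sub>F n in sequentially. norm ((?V n - (s n)\<^sup>2) / (s n)\<^sup>2) \<le> spine_error (q n) (M n) / s n * (1 / s n)"
        using q(2) M spos
      proof eventually_elim
        case (elim n)
        have "(s n)\<^sup>2 = real n * ((1 - q n) * q n)" using elim by (simp add: s_def)
        then have "\<bar>?V n - (s n)\<^sup>2\<bar> \<le> spine_error (q n) (M n)"
          using spine_mean_var_approx(2)[of "q n" "M n" n] elim by simp
        then show ?case using elim by (simp add: power2_eq_square divide_right_mono)
      qed
      show "(\<lambda>n. spine_error (q n) (M n) / s n * (1 / s n)) \<longlonglongrightarrow> 0"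
        using tendsto_mult[OF err s_inf] by simp
    qed
    then have "(\<lambda>n. (?V n - (s n)\<^sup>2) / (s n)\<^sup>2 + 1) \<longlonglongrightarrow> 0 + 1" by (intro tendsto_intros)
    moreover have "\<forall>\<^sub>F n in sequentially. (?V n - (s n)\<^sup>2) / (s n)\<^sup>2 + 1 = ?V n / (s n)\<^sup>2"
      using spos by eventually_elim (simp add: field_simps)
    ultimately show ?thesis by (simp add: tendsto_cong)
  qed
  have "weak_conv_m ?D std_normal_distribution"
  proof (rule levy_continuity)
    show "real_distribution (?D n)" for n
      by (intro prob_space.real_distribution_distr[OF prob_space_measure_pmf]) simp
    show "real_distribution std_normal_distribution" by (rule real_dist_normal_dist)
    fix u :: real
    let ?a = "\<lambda>n. u / s n"
    let ?T = "\<lambda>n. spine_exp (q n) (M n) n (\<lambda>t. iexp (?a n * real t)) * iexp (- (?a n * ?\<mu> n))"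
    have diff: "(\<lambda>n. ?T n - of_real (exp (- (?V n * (?a n)\<^sup>2 / 2)))) \<longlonglongrightarrow> 0"
    proof (rule Lim_null_comparison)
      show "\<forall>\<^sub>F n in sequentially. norm (?T n - of_real (exp (- (?V n * (?a n)\<^sup>2 / 2)))) \<le>
         (?V n / (s n)\<^sup>2) * (\<bar>u\<bar> ^ 3 * (1 / s n) + u ^ 4 * (1 / s n)\<^sup>2)"
        using spos
      proof eventually_elim
        case (elim n)
        have "norm (?T n - of_real (exp (- (?V n * (?a n)\<^sup>2 / 2)))) \<le> ?V n * (\<bar>?a n\<bar> ^ 3 + (?a n) ^ 4)"
          by (rule spine_char_approx) (use q(1)[of n] in simp)
        also have "\<dots> = (?V n / (s n)\<^sup>2) * (\<bar>u\<bar> ^ 3 * (1 / s n) + u ^ 4 * (1 / s n)\<^sup>2)"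
          using elim by (simp add: power_divide field_simps power2_eq_square power3_eq_cube power4_eq_xxxx)
        finally show ?case .
      qed
      have "(\<lambda>n. (?V n / (s n)\<^sup>2) * (\<bar>u\<bar> ^ 3 * (1 / s n) + u ^ 4 * (1 / s n)\<^sup>2)) \<longlonglongrightarrow> 1 * (\<bar>u\<bar> ^ 3 * 0 + u ^ 4 * 0\<^sup>2)"
        by (intro tendsto_intros var_lim s_inf)
      then show "(\<lambda>n. (?V n / (s n)\<^sup>2) * (\<bar>u\<bar> ^ 3 * (1 / s n) + u ^ 4 * (1 / s n)\<^sup>2)) \<longlonglongrightarrow> 0" by simp
    qed
    have gauss: "(\<lambda>n. complex_of_real (exp (- (?V n * (?a n)\<^sup>2 / 2)))) \<longlonglongrightarrow> of_real (exp (- (1 * u\<^sup>2 / 2)))"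
    proof -
      have "?V n * (?a n)\<^sup>2 / 2 = (?V n / (s n)\<^sup>2) * u\<^sup>2 / 2" for n by (simp add: power_divide)
      then show ?thesis by (simp only:) (intro tendsto_intros var_lim, simp)
    qed
    have T: "?T \<longlonglongrightarrow> of_real (exp (- (1 * u\<^sup>2 / 2)))"
      by (rule Lim_transform[OF gauss diff])
    have shift: "(\<lambda>n. iexp (u * ((?\<mu> n - real n * (1 - q n)) / s n))) \<longlonglongrightarrow> iexp (u * 0)"
      by (intro tendsto_intros mean_lim)
    have iexp_add: "iexp (x + y) = iexp x * iexp y" for x y
      by (simp add: distrib_left exp_add)
    have eq: "char (?D n) u = ?T n * iexp (u * ((?\<mu> n - real n * (1 - q n)) / s n))" for n
    proof -
      let ?E = "\<lambda>f. spine_exp (q n) (M n) n f :: complex"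
      have "char (?D n) u = ?E (\<lambda>t. iexp (u * ?f n t))"
        by (simp add: char_def integral_distr)
      also have "(\<lambda>t. iexp (u * ?f n t)) = (\<lambda>t. iexp (?a n * real t) * iexp (- (?a n * (real n * (1 - q n)))))"
      proof -
        have "u * ?f n t = ?a n * real t + - (?a n * (real n * (1 - q n)))" for t
          by (simp add: diff_divide_distrib right_diff_distrib)
        then show ?thesis by (simp only: iexp_add)
      qed
      also have "?E \<dots> = ?E (\<lambda>t. iexp (?a n * real t)) * iexp (- (?a n * (real n * (1 - q n))))" by simp
      also have "iexp (- (?a n * (real n * (1 - q n)))) = iexp (- (?a n * ?\<mu> n)) * iexp (u * ((?\<mu> n - real n * (1 - q n)) / s n))"
        unfolding iexp_add[symmetric] by (simp only: diff_divide_distrib right_diff_distrib) simp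
      finally show ?thesis by (simp only: mult.assoc)
    qed
    show "(\<lambda>n. char (?D n) u) \<longlonglongrightarrow> char std_normal_distribution u"
      unfolding eq using tendsto_mult[OF T shift] by (simp add: char_std_normal_distribution)
  qed
  then have "(\<lambda>n. cdf (?D n) x) \<longlonglongrightarrow> cdf std_normal_distribution x"
    by (simp add: weak_conv_m_def weak_conv_def isCont_cdf_std_normal)
  moreover have "cdf (?D n) x = spine_exp (q n) (M n) n (\<lambda>t. of_bool (?f n t \<le> x))" for n
  proof -
    have "cdf (?D n) x = measure (measure_pmf (spine_pmf (q n) (M n) n)) {t. ?f n t \<le> x}"
      by (simp add: cdf_def measure_distr vimage_def)
    also have "\<dots> = spine_exp (q n) (M n) n (indicator {t. ?f n t \<le> x})" by simp
    also have "indicator {t. ?f n t \<le> x} = (\<lambda>t. of_bool (?f n t \<le> x) :: real)" by (auto simp: indicator_def)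
    finally show ?thesis .
  qed
  ultimately show ?thesis by simp
qed

section \<open>The fluctuations of the height\<close>

lemma spine_error_core_le:
  assumes q: "0 < q" "q < 1"
  shows "0 \<le> spine_error q (core_size q)" "spine_error q (core_size q) \<le> 4 + sqrt (ln (1 / (1 - q)))"
proof -
  define b where "b = sqrt (ln (1 / (1 - q)))"
  have l0: "0 \<le> ln (1 / (1 - q))" using q by simp
  have b: "0 \<le> b" "b\<^sup>2 = ln (1 / (1 - q))" using l0 by (auto simp: b_def)
  have qb: "1 - q = exp (- b\<^sup>2)" using q by (simp add: b(2) exp_minus)
  have M: "core_size q = nat \<lfloor>exp (b\<^sup>2 - b)\<rfloor>" unfolding core_size_def by (simp only: b(2) b_def[symmetric])
  let ?M = "real (Suc (core_size q))"
  have M_bounds: "?M \<le> exp (b\<^sup>2 - b) + 1" "exp (b\<^sup>2 - b) \<le> ?M"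
    using of_int_floor_le[of "exp (b\<^sup>2 - b)"] real_of_int_floor_add_one_ge[of "exp (b\<^sup>2 - b)"]
    unfolding M by (simp_all add: add.commute)
  have "?M * (1 - q) \<le> (exp (b\<^sup>2 - b) + 1) * exp (- b\<^sup>2)" unfolding qb using M_bounds by (intro mult_right_mono) auto
  also have "\<dots> = exp (- b) + exp (- b\<^sup>2)" by (simp add: distrib_right flip: exp_add)
  also have "\<dots> \<le> 1 + 1" using b(1) by (intro add_mono) simp_all
  finally have 1: "?M * (1 - q) \<le> 2" by simp
  have "exp (- b) = exp (b\<^sup>2 - b) * exp (- b\<^sup>2)" by (simp flip: exp_add)
  also have "\<dots> \<le> ?M * (1 - q)" unfolding qb using M_bounds by (intro mult_right_mono) auto
  finally have x: "exp (- b) \<le> ?M * (1 - q)" .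
  have pow: "0 \<le> q ^ Suc (core_size q)" "q ^ Suc (core_size q) < 1"
    using q by (auto simp: power_less_one_iff simp del: power_Suc)
  have "q ^ Suc (core_size q) \<le> exp (- (1 - q)) ^ Suc (core_size q)"
    using q exp_ge_add_one_self[of "- (1 - q)"] by (intro power_mono) auto
  also have "\<dots> = exp (- (?M * (1 - q)))" by (simp add: algebra_simps flip: exp_of_nat_mult del: power_Suc of_nat_Suc)
  also have "\<dots> \<le> exp (- exp (- b))" using x by simp
  also have "\<dots> \<le> 1 - exp (- b) / 2"
  proof -
    define w where "w = exp (- b)"
    have w: "0 \<le> w" "w \<le> 1" using b by (auto simp: w_def)
    have "exp (- w) \<le> 1 / (1 + w)" using exp_ge_add_one_self[of w] w
      by (simp add: exp_minus inverse_eq_divide) (intro divide_left_mono, auto)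
    also have "\<dots> \<le> 1 - w / 2"
    proof -
      have "w * w \<le> w * 1" using w by (intro mult_left_mono) auto
      then show ?thesis using w by (subst pos_divide_le_eq) (auto simp: algebra_simps)
    qed
    finally show ?thesis by (simp add: w_def)
  qed
  finally have "exp (- b) / 2 \<le> 1 - q ^ Suc (core_size q)" by simp
  then have "ln (exp (- b) / 2) \<le> ln (1 - q ^ Suc (core_size q))" using pow by (subst ln_le_cancel_iff) auto
  moreover have "ln (exp (- b) / 2) = - b - ln 2" by (simp add: ln_div)
  moreover have "ln (2 :: real) \<le> 1" using ln_le_minus_one[of 2] by simp
  ultimately have 2: "ln (1 / (1 - q ^ Suc (core_size q))) \<le> b + 1" using pow by (simp add: ln_div del: power_Suc)
  show "spine_error q (core_size q) \<le> 4 + sqrt (ln (1 / (1 - q)))"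
    using 1 2 unfolding spine_error_def b_def by linarith
  have "0 \<le> ln (1 / (1 - q ^ Suc (core_size q)))" using pow by (simp add: ln_div del: power_Suc)
  moreover have "0 \<le> ?M * (1 - q)" using q by simp
  ultimately show "0 \<le> spine_error q (core_size q)" unfolding spine_error_def by linarith
qed

lemma spine_error_ceiling_le:
  assumes q: "0 < q" "q < 1"
  shows "0 \<le> spine_error q (nat \<lceil>1 / (1 - q)\<rceil>)" "spine_error q (nat \<lceil>1 / (1 - q)\<rceil>) \<le> 5"
proof -
  define M where "M = nat \<lceil>1 / (1 - q)\<rceil>"
  have M: "1 / (1 - q) \<le> real M" "real M \<le> 1 / (1 - q) + 1"
    using q ceiling_correct[of "1 / (1 - q)"] by (simp_all add: M_def)
  have "real (Suc M) * (1 - q) \<le> (1 / (1 - q) + 2) * (1 - q)" using M q by (intro mult_right_mono) auto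
  also have "\<dots> \<le> 3" using q by (simp add: distrib_right)
  finally have 1: "real (Suc M) * (1 - q) \<le> 3" .
  have "q ^ Suc M \<le> 1 / 2" by (rule power_le_half) (use q M in auto)
  then have "ln (1 / 2) \<le> ln (1 - q ^ Suc M)" by (subst ln_le_cancel_iff) auto
  moreover have "ln (2 :: real) \<le> 1" using ln_le_minus_one[of 2] by simp
  moreover have pow: "0 \<le> q ^ Suc M" "q ^ Suc M < 1" using q by (auto simp: power_less_one_iff simp del: power_Suc)
  ultimately have 2: "ln (1 / (1 - q ^ Suc M)) \<le> 1" by (simp add: ln_div del: power_Suc)
  have 3: "0 \<le> ln (1 / (1 - q ^ Suc M))" using pow by (simp add: ln_div del: power_Suc)
  have "0 \<le> real (Suc M) * (1 - q)" using q by simp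
  then show "0 \<le> spine_error q (nat \<lceil>1 / (1 - q)\<rceil>)" "spine_error q (nat \<lceil>1 / (1 - q)\<rceil>) \<le> 5"
    using 1 2 3 unfolding spine_error_def M_def[symmetric] by linarith+
qed

text \<open>
  For \<open>q \<ge> 1 / 2\<close> the scale is at least \<open>sqrt (n (1 - q) / 2)\<close>, which dominates
  \<open>sqrt (ln n) \<ge> sqrt (ln (1 / (1 - q)))\<close>; for \<open>q < 1 / 2\<close> the logarithm is bounded.
\<close>

lemma ln_gap_over_scale:
  fixes q :: "nat \<Rightarrow> real"
  defines "s \<equiv> \<lambda>n. sqrt (real n * (1 - q n) * q n)"
  assumes q: "\<And>n. q n \<in> {0..1}"
    and sub: "filterlim (\<lambda>n. real n * (1 - q n) / ln (real n)) at_top sequentially"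
    and nq: "filterlim (\<lambda>n. real n * q n) at_top sequentially"
  shows "filterlim (\<lambda>n. real n * (1 - q n)) at_top sequentially"
    and "filterlim s at_top sequentially"
    and "(\<lambda>n. sqrt (ln (1 / (1 - q n))) / s n) \<longlonglongrightarrow> 0"
proof -
  have ln_top: "filterlim (\<lambda>n. ln (real n)) at_top sequentially"
    by (rule filterlim_compose[OF ln_at_top filterlim_real_sequentially])
  have "filterlim (\<lambda>n. real n * (1 - q n) / ln (real n) * ln (real n)) at_top sequentially"
    by (rule filterlim_at_top_mult_at_top[OF sub ln_top])
  moreover have "\<forall>\<^sub>F n in sequentially. real n * (1 - q n) / ln (real n) * ln (real n) = real n * (1 - q n)"
    using eventually_ge_at_top[of 2] by eventually_elim simp
  ultimately show top: "filterlim (\<lambda>n. real n * (1 - q n)) at_top sequentially"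
    by (subst (asm) filterlim_cong[OF refl refl])
  have half: "min (real n * (1 - q n)) (real n * q n) \<le> 2 * (real n * (1 - q n) * q n)" for n
  proof (cases "1 / 2 \<le> q n")
    case True
    then have "real n * (1 - q n) * (1 / 2) \<le> real n * (1 - q n) * q n" using q[of n] by (intro mult_left_mono) auto
    then show ?thesis by linarith
  next
    case False
    then have "real n * q n * (1 / 2) \<le> real n * q n * (1 - q n)" using q[of n] by (intro mult_left_mono) auto
    then show ?thesis by (simp add: mult_ac min_le_iff_disj)
  qed
  show s_top: "filterlim s at_top sequentially"
    unfolding filterlim_at_top
  proof
    fix Z :: real
    have "\<forall>\<^sub>F n in sequentially. 2 * Z\<^sup>2 \<le> real n * (1 - q n)" "\<forall>\<^sub>F n in sequentially. 2 * Z\<^sup>2 \<le> real n * q n"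
      using top nq by (auto simp: filterlim_at_top)
    then show "\<forall>\<^sub>F n in sequentially. Z \<le> s n"
    proof eventually_elim
      case (elim n)
      then have "Z\<^sup>2 \<le> real n * (1 - q n) * q n" using half[of n] by linarith
      then show ?case unfolding s_def by (rule real_le_rsqrt)
    qed
  qed
  have "(\<lambda>n. (sqrt (ln (1 / (1 - q n))) / s n)\<^sup>2) \<longlonglongrightarrow> 0"
  proof (rule Lim_null_comparison)
    have e1: "\<forall>\<^sub>F n in sequentially. 1 \<le> real n * (1 - q n)" "\<forall>\<^sub>F n in sequentially. 1 \<le> s n"
      using top s_top by (auto simp: filterlim_at_top)
    show "\<forall>\<^sub>F n in sequentially. norm ((sqrt (ln (1 / (1 - q n))) / s n)\<^sup>2) \<le>
       2 * inverse (real n * (1 - q n) / ln (real n)) + (inverse (s n))\<^sup>2"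
      using e1 eventually_ge_at_top[of 2]
    proof eventually_elim
      case (elim n)
      have q1: "q n < 1" using elim q[of n] by (cases "q n = 1") auto
      have l0: "0 \<le> ln (1 / (1 - q n))" using q1 q[of n] by simp
      have ln0: "0 \<le> ln (real n)" using elim by simp
      have s2: "(s n)\<^sup>2 = real n * (1 - q n) * q n" using q[of n] by (simp add: s_def)
      have s2pos: "1 \<le> (s n)\<^sup>2" using elim by (simp add: one_le_power)
      have eq: "norm ((sqrt (ln (1 / (1 - q n))) / s n)\<^sup>2) = ln (1 / (1 - q n)) / (s n)\<^sup>2"
        using l0 by (simp add: power_divide)
      show ?case
      proof (cases "1 / 2 \<le> q n")
        case True
        have "real n * (1 - q n) * (1 / 2) \<le> (s n)\<^sup>2"
          unfolding s2 using True q[of n] by (intro mult_left_mono) auto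
        moreover have "ln (1 / (1 - q n)) \<le> ln (real n)"
          using q1 elim by (subst ln_le_cancel_iff) (auto simp: field_simps)
        ultimately have "ln (1 / (1 - q n)) / (s n)\<^sup>2 \<le> ln (real n) / (real n * (1 - q n) * (1 / 2))"
          using elim ln0 by (intro frac_le) auto
        also have "\<dots> = 2 * inverse (real n * (1 - q n) / ln (real n))" by simp
        finally show ?thesis unfolding eq using zero_le_power2[of "inverse (s n)"] by linarith
      next
        case False
        have "ln (1 / (1 - q n)) \<le> ln 2" using False q1 by (subst ln_le_cancel_iff) (auto simp: field_simps)
        also have "ln (2 :: real) \<le> 1" using ln_le_minus_one[of 2] by simp
        finally have "ln (1 / (1 - q n)) / (s n)\<^sup>2 \<le> 1 / (s n)\<^sup>2" by (intro divide_right_mono) auto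
        moreover have "0 \<le> 2 * inverse (real n * (1 - q n) / ln (real n))" using elim ln0 by simp
        ultimately show ?thesis unfolding eq by (simp add: power_inverse inverse_eq_divide power_divide)
      qed
    qed
    have "(\<lambda>n. 2 * inverse (real n * (1 - q n) / ln (real n)) + (inverse (s n))\<^sup>2) \<longlonglongrightarrow> 2 * 0 + 0\<^sup>2"
      by (intro tendsto_intros tendsto_inverse_0_at_top sub s_top)
    then show "(\<lambda>n. 2 * inverse (real n * (1 - q n) / ln (real n)) + (inverse (s n))\<^sup>2) \<longlonglongrightarrow> 0" by simp
  qed
  then have "(\<lambda>n. sqrt ((sqrt (ln (1 / (1 - q n))) / s n)\<^sup>2)) \<longlonglongrightarrow> sqrt 0" by (rule tendsto_real_sqrt)
  then show "(\<lambda>n. sqrt (ln (1 / (1 - q n))) / s n) \<longlonglongrightarrow> 0"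
    unfolding real_sqrt_abs real_sqrt_zero by (rule tendsto_rabs_zero_cancel)
qed

lemma spine_exp_of_bool_mono:
  assumes "\<And>t. P t \<Longrightarrow> Q t"
  shows "spine_exp q M n (\<lambda>t. of_bool (P t) :: real) \<le> spine_exp q M n (\<lambda>t. of_bool (Q t))"
  by (intro integral_mono) (use assms in auto)

text \<open>
  The two tail bounds enclose the distribution function of the height between those of two spine
  walks, one for each choice of \<open>M\<close>, shifted by \<open>c* ln m\<close> up to \<open>O (sqrt (ln m) + 1)\<close>. After
  scaling this error is below any \<open>\<delta> > 0\<close>, and the normal distribution function is continuous.
\<close>

theorem theorem1p3:
  fixes q :: "nat \<Rightarrow> real"
  assumes "\<And>n. q n \<in> {0..1}"
    and "filterlim (\<lambda>n. real n * (1 - q n) / ln (real n)) at_top sequentially"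
    and "filterlim (\<lambda>n. real n * q n) at_top sequentially"
  shows "weak_conv_m
    (\<lambda>n. distr (measure_pmf (mallows_tree_pmf n (q n))) borel
       (\<lambda>T. (real (height T) - real n * (1 - q n) - c_star * ln (inverse (1 - q n)))
             / sqrt (real n * (1 - q n) * q n)))
    std_normal_distribution"
proof -
  define s where "s n = sqrt (real n * (1 - q n) * q n)" for n
  define l where "l n = ln (1 / (1 - q n))" for n
  define b where "b n = sqrt (l n)" for n
  note lims = ln_gap_over_scale[OF assms]
  have s_top: "filterlim s at_top sequentially" using lims(2) by (simp add: s_def[abs_def])
  have b_lim: "(\<lambda>n. b n / s n) \<longlonglongrightarrow> 0" using lims(3) by (simp add: s_def b_def l_def)
  have s_inf: "(\<lambda>n. 1 / s n) \<longlonglongrightarrow> 0"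
    using s_top by (intro tendsto_divide_0[OF tendsto_const] filterlim_at_top_imp_at_infinity)
  have affine_lim: "(\<lambda>n. (c + d * b n) / s n) \<longlonglongrightarrow> 0" for c d
  proof -
    have "(\<lambda>n. c * (1 / s n) + d * (b n / s n)) \<longlonglongrightarrow> c * 0 + d * 0"
      by (intro tendsto_intros s_inf b_lim)
    then show ?thesis by (simp add: add_divide_distrib)
  qed
  have spos: "\<forall>\<^sub>F n in sequentially. 1 \<le> s n" using s_top by (simp add: filterlim_at_top)
  have n3: "\<forall>\<^sub>F n in sequentially. 3 \<le> real n * (1 - q n)" using lims(1) by (simp add: filterlim_at_top)
  have q01: "\<forall>\<^sub>F n in sequentially. 0 < q n \<and> q n < 1"
  proof -
    have "\<forall>\<^sub>F n in sequentially. 1 \<le> real n * q n" using assms(3) by (simp add: filterlim_at_top)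
    with n3 show ?thesis
    proof eventually_elim
      case (elim n)
      then have "q n \<noteq> 0" "q n \<noteq> 1" by auto
      then show ?case using assms(1)[of n] by auto
    qed
  qed
  define Mlo where "Mlo n = core_size (q n)" for n
  define Mup where "Mup n = nat \<lceil>1 / (1 - q n)\<rceil>" for n
  have Mlt: "\<forall>\<^sub>F n in sequentially. Mlo n < n" "\<forall>\<^sub>F n in sequentially. Mup n < n"
  proof -
    have "\<forall>\<^sub>F n in sequentially. Mlo n < n \<and> Mup n < n"
      using n3 q01 eventually_ge_at_top[of 3]
    proof eventually_elim
      case (elim n)
      have m: "1 / (1 - q n) \<le> real n / 3" using elim by (simp add: field_simps)
      have "real (Mup n) \<le> 1 / (1 - q n) + 1"
        using elim ceiling_correct[of "1 / (1 - q n)"] by (simp add: Mup_def)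
      also have "\<dots> < real n" using m elim by linarith
      finally have 1: "Mup n < n" by simp
      have l0: "0 \<le> l n" using elim by (simp add: l_def)
      have "real (Mlo n) \<le> exp (l n - b n)"
        unfolding Mlo_def core_size_def l_def[symmetric] b_def[symmetric] by simp
      also have "\<dots> \<le> exp (l n)" using l0 by (simp add: b_def)
      also have "\<dots> = 1 / (1 - q n)" using elim by (simp add: l_def)
      also have "\<dots> < real n" using m elim by linarith
      finally show ?case using 1 by simp
    qed
    then show "\<forall>\<^sub>F n in sequentially. Mlo n < n" "\<forall>\<^sub>F n in sequentially. Mup n < n"
      by (auto elim: eventually_mono)
  qed
  define G where "G M n x = spine_exp (q n) (M n) n (\<lambda>t. of_bool ((real t - real n * (1 - q n)) / s n \<le> x) :: real)"
    for M :: "nat \<Rightarrow> nat" and n and x :: real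
  let ?\<Phi> = "cdf std_normal_distribution"
  have G_lim: "(\<lambda>n. G Mlo n x) \<longlonglongrightarrow> ?\<Phi> x" "(\<lambda>n. G Mup n x) \<longlonglongrightarrow> ?\<Phi> x" for x
  proof -
    have "(\<lambda>n. spine_error (q n) (Mlo n) / s n) \<longlonglongrightarrow> 0"
    proof (rule Lim_null_comparison[OF _ affine_lim[of 4 1]])
      show "\<forall>\<^sub>F n in sequentially. norm (spine_error (q n) (Mlo n) / s n) \<le> (4 + 1 * b n) / s n"
        using q01 spos
      proof eventually_elim
        case (elim n)
        then show ?case using spine_error_core_le[of "q n"]
          by (simp add: Mlo_def b_def l_def divide_right_mono)
      qed
    qed
    then show "(\<lambda>n. G Mlo n x) \<longlonglongrightarrow> ?\<Phi> x"
      unfolding G_def s_def by (intro spine_clt assms(1) q01 lims Mlt)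
    have "(\<lambda>n. spine_error (q n) (Mup n) / s n) \<longlonglongrightarrow> 0"
    proof (rule Lim_null_comparison[OF _ affine_lim[of 5 0]])
      show "\<forall>\<^sub>F n in sequentially. norm (spine_error (q n) (Mup n) / s n) \<le> (5 + 0 * b n) / s n"
        using q01 spos
      proof eventually_elim
        case (elim n)
        then show ?case using spine_error_ceiling_le[of "q n"]
          by (simp add: Mup_def divide_right_mono)
      qed
    qed
    then show "(\<lambda>n. G Mup n x) \<longlonglongrightarrow> ?\<Phi> x"
      unfolding G_def s_def by (intro spine_clt assms(1) q01 lims Mlt)
  qed
  let ?H = "\<lambda>n. distr (measure_pmf (mallows_tree_pmf n (q n))) borel
       (\<lambda>T. (real (height T) - real n * (1 - q n) - c_star * ln (inverse (1 - q n))) / sqrt (real n * (1 - q n) * q n))"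
  define z where "z x n = real n * (1 - q n) + c_star * l n + x * s n" for x n
  \<comment> \<open>The successor converts a bound on the height into one on the number of levels.\<close>
  define k where "k x n = Suc (nat \<lfloor>z x n\<rfloor>)" for x n
  have z_nonneg: "\<forall>\<^sub>F n in sequentially. 0 \<le> z x n" for x
  proof -
    have "\<forall>\<^sub>F n in sequentially. \<bar>x\<bar> \<le> s n" using s_top by (simp add: filterlim_at_top)
    then show ?thesis using q01 spos
    proof eventually_elim
      case (elim n)
      have "(s n)\<^sup>2 = real n * (1 - q n) * q n" using elim by (simp add: s_def)
      also have "\<dots> \<le> real n * (1 - q n)" using elim by (intro mult_right_le_one_le) auto
      finally have "s n * s n \<le> real n * (1 - q n)" by (simp add: power2_eq_square)
      moreover have "- x * s n \<le> s n * s n" using elim by (intro mult_right_mono) auto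
      moreover have "0 \<le> c_star * l n" using elim c_star_ge_2 by (simp add: l_def)
      ultimately show ?case by (simp add: z_def)
    qed
  qed
  have H_cdf: "\<forall>\<^sub>F n in sequentially. cdf (?H n) x = level_cdf (q n) (k x n) n" for x
    using z_nonneg[of x] spos q01
  proof eventually_elim
    case (elim n)
    have set_eq: "{T. (real (height T) - real n * (1 - q n) - c_star * ln (inverse (1 - q n))) / s n \<le> x}
        = {T. height T \<le> nat \<lfloor>z x n\<rfloor>}"
    proof (intro Collect_cong)
      fix T
      have "(real (height T) - real n * (1 - q n) - c_star * ln (inverse (1 - q n))) / s n \<le> x \<longleftrightarrow> real (height T) \<le> z x n"
        using elim by (simp add: divide_le_eq z_def l_def inverse_eq_divide) linarith
      also have "\<dots> \<longleftrightarrow> height T \<le> nat \<lfloor>z x n\<rfloor>" using elim by (simp add: le_nat_iff le_floor_iff)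
      finally show "(real (height T) - real n * (1 - q n) - c_star * ln (inverse (1 - q n))) / s n \<le> x \<longleftrightarrow> height T \<le> nat \<lfloor>z x n\<rfloor>" .
    qed
    have "cdf (?H n) x = measure_pmf.prob (mallows_tree_pmf n (q n))
        {T. (real (height T) - real n * (1 - q n) - c_star * ln (inverse (1 - q n))) / s n \<le> x}"
      by (simp add: cdf_def measure_distr vimage_def s_def)
    then show ?case unfolding set_eq k_def using assms(1)[of n] by (simp add: mallows_height_le)
  qed
  have upper: "\<forall>\<^sub>F n in sequentially. level_cdf (q n) (k x n) n \<le> G Mlo n (x + \<delta>) + \<epsilon>"
    if pos: "0 < \<delta>" "0 < \<epsilon>" for x \<delta> \<epsilon>
  proof -
    obtain C where C: "\<forall>q\<in>{0..<1}. \<forall>n k L :: nat. core_size q < n \<longrightarrow>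
        real L \<le> max 0 (c_star * ln (1 / (1 - q)) - C * (sqrt (ln (1 / (1 - q))) + 1)) \<longrightarrow>
        level_cdf q k n \<le> spine_exp q (core_size q) n (\<lambda>t. of_bool (t + L \<le> k)) + \<epsilon>"
      using level_tail_lower[OF pos(2)] by blast
    have "\<forall>\<^sub>F n in sequentially. ((2 + C) + C * b n) / s n < \<delta>"
      using affine_lim pos(1) by (rule order_tendstoD)
    then show ?thesis using q01 spos z_nonneg[of x] Mlt(1)
    proof eventually_elim
      case (elim n)
      define L where "L = nat \<lfloor>max 0 (c_star * l n - C * (b n + 1))\<rfloor>"
      have L: "real L \<le> max 0 (c_star * l n - C * (b n + 1))" "c_star * l n - C * (b n + 1) - 1 \<le> real L"
        by (simp add: L_def, unfold L_def, linarith)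
      have "level_cdf (q n) (k x n) n \<le> spine_exp (q n) (Mlo n) n (\<lambda>t. of_bool (t + L \<le> k x n)) + \<epsilon>"
        using C L elim by (simp add: Mlo_def l_def b_def)
      also have "spine_exp (q n) (Mlo n) n (\<lambda>t. of_bool (t + L \<le> k x n) :: real) \<le> G Mlo n (x + \<delta>)"
        unfolding G_def
      proof (rule spine_exp_of_bool_mono)
        fix t assume t: "t + L \<le> k x n"
        have "real (k x n) \<le> z x n + 1" using elim by (simp add: k_def)
        then have "real t \<le> z x n + 1 - real L" using t by linarith
        also have "\<dots> \<le> real n * (1 - q n) + x * s n + ((2 + C) + C * b n)"
          using L(2) by (simp add: z_def algebra_simps)
        also have "(2 + C) + C * b n \<le> \<delta> * s n" using elim by (simp add: divide_less_eq)
        finally have "real t - real n * (1 - q n) \<le> (x + \<delta>) * s n" by (simp add: algebra_simps)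
        then show "(real t - real n * (1 - q n)) / s n \<le> x + \<delta>" using elim by (simp add: divide_le_eq)
      qed
      finally show ?case by simp
    qed
  qed
  have lower: "\<forall>\<^sub>F n in sequentially. G Mup n (x - \<delta>) - \<epsilon> \<le> level_cdf (q n) (k x n) n"
    if pos: "0 < \<delta>" "0 < \<epsilon>" for x \<delta> \<epsilon>
  proof -
    obtain C \<theta> where C: "0 < C" "0 < \<theta>" "\<forall>q\<in>{0..<1}. \<forall>M U k n :: nat. 1 / (1 - q) \<le> real M \<longrightarrow> real M \<le> 1 / (1 - q) + 1 \<longrightarrow>
        1 - level_cdf q k n \<le> spine_exp q M n (\<lambda>t. of_bool (k < t + U))
          + C * exp (- \<theta> * (real U - c_star * ln (1 / (1 - q))))"
      using level_tail_upper by blast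
    define K where "K = \<bar>ln (\<epsilon> / C)\<bar> / \<theta>"
    have K: "0 \<le> K" using C by (simp add: K_def)
    have "- \<theta> * K \<le> ln (\<epsilon> / C)" using C by (simp add: K_def)
    then have "exp (- \<theta> * K) \<le> exp (ln (\<epsilon> / C))" by (subst exp_le_cancel_iff)
    then have CK: "C * exp (- \<theta> * K) \<le> \<epsilon>" using C pos by (simp add: field_simps)
    have "\<forall>\<^sub>F n in sequentially. ((K + 1) + 0 * b n) / s n < \<delta>"
      using affine_lim pos(1) by (rule order_tendstoD)
    then show ?thesis using q01 spos z_nonneg[of x]
    proof eventually_elim
      case (elim n)
      have l0: "0 \<le> l n" using elim by (simp add: l_def)
      define U where "U = nat \<lceil>c_star * l n + K\<rceil>"
      have "0 \<le> c_star * l n + K" using l0 K c_star_ge_2 by simp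
      then have U: "c_star * l n + K \<le> real U" "real U \<le> c_star * l n + K + 1"
        using ceiling_correct[of "c_star * l n + K"] by (simp_all add: U_def)
      have Mb: "1 / (1 - q n) \<le> real (Mup n)" "real (Mup n) \<le> 1 / (1 - q n) + 1"
        using elim ceiling_correct[of "1 / (1 - q n)"] by (simp_all add: Mup_def)
      have "1 - level_cdf (q n) (k x n) n \<le> spine_exp (q n) (Mup n) n (\<lambda>t. of_bool (k x n < t + U))
          + C * exp (- \<theta> * (real U - c_star * l n))"
        using C(3) Mb elim by (simp add: l_def)
      moreover have "C * exp (- \<theta> * (real U - c_star * l n)) \<le> C * exp (- \<theta> * K)"
      proof -
        have "\<theta> * K \<le> \<theta> * (real U - c_star * l n)" using U C by (intro mult_left_mono) auto
        then show ?thesis using C by (intro mult_left_mono) auto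
      qed
      moreover have "spine_exp (q n) (Mup n) n (\<lambda>t. of_bool (k x n < t + U) :: real) \<le> 1 - G Mup n (x - \<delta>)"
      proof -
        have "1 - G Mup n (x - \<delta>) = spine_exp (q n) (Mup n) n (\<lambda>t. of_bool (\<not> (real t - real n * (1 - q n)) / s n \<le> x - \<delta>) :: real)"
          unfolding G_def of_bool_not_iff by (subst Bochner_Integration.integral_diff) auto
        moreover have "spine_exp (q n) (Mup n) n (\<lambda>t. of_bool (k x n < t + U) :: real) \<le> \<dots>"
        proof (rule spine_exp_of_bool_mono)
          fix t assume t: "k x n < t + U"
          have "z x n < real (k x n)" using elim unfolding k_def by simp linarith
          then have "z x n - real U < real t" using t by linarith
          moreover have "real n * (1 - q n) + x * s n - (K + 1) \<le> z x n - real U"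
            using U(2) by (simp add: z_def)
          moreover have "K + 1 \<le> \<delta> * s n" using elim by (simp add: divide_less_eq)
          ultimately have "(x - \<delta>) * s n < real t - real n * (1 - q n)" by (simp add: algebra_simps)
          then show "\<not> (real t - real n * (1 - q n)) / s n \<le> x - \<delta>" using elim by (simp add: divide_le_eq)
        qed
        ultimately show ?thesis by simp
      qed
      ultimately show ?case using CK by linarith
    qed
  qed
  have "(\<lambda>n. level_cdf (q n) (k x n) n) \<longlonglongrightarrow> ?\<Phi> x" for x
  proof (rule LIMSEQ_I)
    fix r :: real assume r: "0 < r"
    have "isCont ?\<Phi> x" by (rule isCont_cdf_std_normal)
    then obtain d where d: "0 < d" "\<And>y. dist y x < d \<Longrightarrow> dist (?\<Phi> y) (?\<Phi> x) < r / 3"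
      unfolding continuous_at_eps_delta using r by (metis zero_less_divide_iff zero_less_numeral)
    define \<delta> where "\<delta> = d / 2"
    have \<delta>: "0 < \<delta>" using d by (simp add: \<delta>_def)
    have near: "\<bar>?\<Phi> (x + \<delta>) - ?\<Phi> x\<bar> < r / 3" "\<bar>?\<Phi> (x - \<delta>) - ?\<Phi> x\<bar> < r / 3"
      using d(2)[of "x + \<delta>"] d(2)[of "x - \<delta>"] d(1) by (auto simp: dist_real_def \<delta>_def)
    have "\<forall>\<^sub>F n in sequentially. dist (G Mlo n (x + \<delta>)) (?\<Phi> (x + \<delta>)) < r / 3"
      "\<forall>\<^sub>F n in sequentially. dist (G Mup n (x - \<delta>)) (?\<Phi> (x - \<delta>)) < r / 3"
      using r by (intro tendstoD G_lim; simp)+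
    moreover have "0 < r / 3" using r by simp
    note upper[OF \<delta> this, of x] lower[OF \<delta> this, of x]
    ultimately have "\<forall>\<^sub>F n in sequentially. norm (level_cdf (q n) (k x n) n - ?\<Phi> x) < r"
    proof eventually_elim
      case (elim n)
      then show ?case using near unfolding dist_real_def real_norm_def by linarith
    qed
    then show "\<exists>no. \<forall>n\<ge>no. norm (level_cdf (q n) (k x n) n - ?\<Phi> x) < r"
      by (simp add: eventually_sequentially)
  qed
  then have "(\<lambda>n. cdf (?H n) x) \<longlonglongrightarrow> ?\<Phi> x" for x
    using H_cdf[of x] by (subst tendsto_cong)
  then show ?thesis unfolding weak_conv_m_def weak_conv_def by blast
qed

end
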